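(* Let $I(n)=\dfrac{\psi(\phi(n))}{\phi(\psi(n))}$ for positive integers $n$. Then \[ \limsup_{n\to\infty}\frac{I(n)}{(\log\log n)^2}=\frac{6}{\pi^2}e^{2\gamma}. \]
   Context: $\phi$ is Euler's totient function, $\phi(n)=n\prod_{p\mid n}(1-1/p)$, and $\psi$ is Dedekind's arithmetic function, $\psi(n)=n\prod_{p\mid n}(1+1/p)$, where $p$ runs over the prime divisors of $n$. $\gamma$ denotes the Euler–Mascheroni constant. *)

theory Defs
  imports "HOL-Analysis.Analysis" "HOL-Number_Theory.Number_Theory"
begin

definition dedekind_psi :: "nat \<Rightarrow> nat" where
  "dedekind_psi n = n * (\<Prod>p\<in>prime_factors n. p + 1) div (\<Prod>p\<in>prime_factors n. p)"

definition I_ratio :: "nat \<Rightarrow> real" where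
  "I_ratio n = real (dedekind_psi (totient n)) / real (totient (dedekind_psi n))"

end

theory Submission
  imports Defs "HOL-Real_Asymp.Real_Asymp"
begin

text \<open>
  Writing \<open>I(n) = \<psi>(\<phi>(n))/\<phi>(n) \<cdot> \<psi>(n)/\<phi>(\<psi>(n)) \<cdot> \<phi>(n)/\<psi>(n)\<close>, the last factor is at most 1, and
  Mertens' third theorem bounds the first two by \<open>(6/\<pi>\<^sup>2) e\<^sup>\<gamma> log log n\<close> and \<open>e\<^sup>\<gamma> log log n\<close> up to \<open>1 + o(1)\<close>.

  For the lower bound one wants \<open>n\<close> with \<open>log n \<le> x\<^bsup>1+o(1)\<^esup>\<close> such that \<open>\<phi>(n)\<close> and \<open>\<psi>(n)\<close> are divisible by
  almost all primes \<open>q \<le> x\<close> while \<open>\<Sum> 1/p\<close> over the primes \<open>p\<close> dividing \<open>n\<close> is small. Let \<open>n\<close> be the product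
  of one prime \<open>p \<equiv> 1\<close> and one prime \<open>p \<equiv> -1\<close> modulo \<open>q\<close>, for each \<open>q\<close>. For \<open>q \<le> x\<^bsup>1/8\<^esup>\<close> such primes,
  with \<open>log p\<close> polynomial in \<open>x\<^bsup>1/8\<^esup>\<close>, divide \<open>(a\<^sup>q - 1)/(a - 1)\<close> and a term of a Lucas sequence. For larger \<open>q\<close>
  they are sought below \<open>N\<close> with \<open>log N = x\<^bsup>o(1)\<^esup>\<close>: if a set of primes \<open>q\<close> admits no such \<open>p\<close>, then all
  primes up to \<open>N\<close> avoid two residue classes modulo each of these \<open>q\<close>, and Brun's sieve against Chebyshev's
  lower bound shows that the sum of \<open>1/q\<close> over the exceptional \<open>q\<close>, up to nearly \<open>N\<close>, is at most
  \<open>log log log N + O(1)\<close>. This range contains about \<open>log log N\<close> blocks of the form \<open>(x\<^bsup>1/8\<^esup>, x]\<close>,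
  so one of them has few exceptional primes.
\<close>

section \<open>Mertens' theorems\<close>

text \<open>The two demands on \<open>n\<close> pull against each other: almost all primes
  \<open>q\<close> up to about \<open>log n\<close> should divide both \<open>\<phi>(n)\<close> and
  \<open>\<psi>(n)\<close>, which asks for many prime factors \<open>p\<close> of \<open>n\<close>,
  while \<open>\<phi>(n)/\<psi>(n)\<close> near 1 asks that these \<open>p\<close> be few or large.
  So every \<open>p\<close> is kept far above the range it has to serve. The exponent in
  \<open>log n \<le> x^(1+o(1))\<close> must be 1, because \<open>log log n\<close> is compared with
  \<open>log x\<close>. Hence most \<open>q\<close> may cost only \<open>x^o(1)\<close> in
  \<open>log p\<close>; the expensive explicit constructions are reserved for \<open>q\<close> up to
  \<open>x^(1/8)\<close>, where their total cost is about \<open>x^(1/2)\<close>. A bound of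
  Linnik's type for each single \<open>q\<close> is replaced by an average over \<open>q\<close>.
  This suffices for two reasons: leaving out primes with \<open>\<Sum> 1/q \<le> \<epsilon>\<close>
  changes the relevant products by a factor \<open>exp (O(\<epsilon>))\<close> only, and a limsup
  leaves the choice of the scale \<open>x\<close> free.\<close>

definition primes_le :: "nat \<Rightarrow> nat set" where
  "primes_le n = {p. prime p \<and> p \<le> n}"

lemma finite_primes_le [simp]: "finite (primes_le n)"
  by (rule finite_subset[of _ "{..n}"]) (auto simp: primes_le_def)

lemma primes_le_Suc:
  "primes_le (Suc n) = (if prime (Suc n) then insert (Suc n) (primes_le n) else primes_le n)"
  by (auto simp: primes_le_def le_Suc_eq)

lemma primes_le_0 [simp]: "primes_le 0 = {}"
  by (auto simp: primes_le_def)

lemma primes_le_mono: "m \<le> n \<Longrightarrow> primes_le m \<subseteq> primes_le n"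
  by (auto simp: primes_le_def)

lemma prod_primes_dvd:
  fixes n :: nat
  assumes "finite A" "\<And>p. p \<in> A \<Longrightarrow> prime p \<and> p dvd n"
  shows "\<Prod>A dvd n"
  using assms
proof (induction A rule: finite_induct)
  case (insert p A)
  have "coprime p (\<Prod>A)"
    using insert by (intro prod_coprime_right) (metis insertCI primes_coprime)
  thus ?case using insert by (simp add: divides_mult)
qed auto

text \<open>The row \<open>2*m+1\<close> has two equal middle entries, so one of them is at most
  half of the row sum \<open>2^(2*m+1)\<close>.\<close>

lemma choose_odd_central_le: "(2*m+1) choose m \<le> 4^m"
proof -
  have "2 * ((2*m+1) choose m) = ((2*m+1) choose m) + ((2*m+1) choose (m+1))"
    using binomial_symmetric[of m "2*m+1"] by (simp add: Suc_diff_le)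
  also have "\<dots> = (\<Sum>k\<in>{m,m+1}. (2*m+1) choose k)" by simp
  also have "\<dots> \<le> (\<Sum>k\<le>2*m+1. (2*m+1) choose k)"
    by (intro sum_mono2) auto
  also have "\<dots> = 2 * 4^m" by (simp only: choose_row_sum) (simp add: power_mult)
  finally show ?thesis by simp
qed

text \<open>Erdos' induction. An even \<open>n > 2\<close> adds no prime; for
  \<open>n = 2*m+1\<close> the primes in \<open>(m+1, n]\<close> divide \<open>n choose m\<close>,
  because they divide \<open>n!\<close> but neither \<open>m!\<close> nor \<open>(m+1)!\<close>, and
  \<open>4^(m+1) * 4^m = 4^n\<close>.\<close>

lemma primorial_le: "\<Prod>(primes_le n) \<le> 4^n"
proof (induction n rule: less_induct)
  case (less n)
  consider "n \<le> 2" | "n > 2" "even n" | m where "n = 2*m+1" "m \<ge> 1"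
    by (metis One_nat_def Suc_eq_plus1 Suc_leI even_Suc le_add2 mult_0_right nat_neq_iff
        not_less oddE one_le_numeral zero_less_iff_neq_zero le_zero_eq add_0)
  thus ?case
  proof cases
    case 1
    hence "n = 0 \<or> n = 1 \<or> n = 2" by auto
    moreover have "primes_le 1 = {}" "primes_le 2 = {2}"
      by (auto simp: primes_le_def dest: prime_ge_2_nat intro: antisym)
    ultimately show ?thesis by (elim disjE) simp_all
  next
    case 2
    then obtain k where k: "n = Suc k" by (cases n) auto
    have "\<not> prime n" using 2 prime_odd_nat by blast
    hence "primes_le n = primes_le k" by (simp add: k primes_le_Suc)
    thus ?thesis using less[of k] k by (auto intro: order_trans)
  next
    case (3 m)
    define A where "A = {p. prime p \<and> m + 1 < p \<and> p \<le> n}"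
    have fin: "finite A" by (rule finite_subset[of _ "{..n}"]) (auto simp: A_def)
    have "\<Prod>A dvd (n choose m)"
    proof (rule prod_primes_dvd[OF fin])
      fix p assume "p \<in> A"
      hence p: "prime p" "m + 1 < p" "p \<le> n" by (auto simp: A_def)
      have "p dvd fact n" using p by (simp add: prime_dvd_fact_iff)
      hence "p dvd fact m * fact (n - m) * (n choose m)"
        using 3 by (subst binomial_fact_lemma) auto
      moreover have "n - m = m + 1" using 3 by simp
      ultimately show "prime p \<and> p dvd (n choose m)"
        using p by (simp only: prime_dvd_mult_iff prime_dvd_fact_iff) auto
    qed
    hence "\<Prod>A \<le> n choose m" using 3 by (intro dvd_imp_le) (auto simp: binomial_eq_0_iff)
    also have "\<dots> \<le> 4^m" using choose_odd_central_le 3 by simp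
    finally have A: "\<Prod>A \<le> 4^m" .
    have "primes_le n = primes_le (m+1) \<union> A" using 3 by (auto simp: primes_le_def A_def)
    moreover have "primes_le (m+1) \<inter> A = {}" by (auto simp: primes_le_def A_def)
    ultimately have "\<Prod>(primes_le n) = \<Prod>(primes_le (m+1)) * \<Prod>A"
      using fin by (simp add: prod.union_disjoint)
    also have "\<dots> \<le> 4^(m+1) * 4^m" using less[of "m+1"] 3 A by (intro mult_mono) auto
    also have "\<dots> = 4^n" using 3 by (simp add: power_add[symmetric] mult_2)
    finally show ?thesis .
  qed
qed

lemma theta_le: "(\<Sum>p\<in>primes_le n. ln (real p)) \<le> real n * ln 4"
proof -
  have "(\<Sum>p\<in>primes_le n. ln (real p)) = ln (\<Prod>p\<in>primes_le n. real p)"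
    by (subst ln_prod) (auto simp: primes_le_def prime_gt_0_nat)
  also have "(\<Prod>p\<in>primes_le n. real p) = real (\<Prod>(primes_le n))" by simp
  also have "ln \<dots> \<le> ln (real (4^n))"
    using primorial_le[of n]
    by (subst ln_le_cancel_iff) (auto intro!: prod_pos simp: primes_le_def prime_gt_0_nat simp flip: of_nat_power of_nat_prod)
  also have "\<dots> = real n * ln 4" by (simp add: ln_realpow)
  finally show ?thesis .
qed

section \<open>Valuations of factorials and Mertens' first theorem\<close>

text \<open>Legendre's formula as a recursion: the multiples of \<open>p\<close> up to
  \<open>n\<close> are \<open>p*k\<close> with \<open>k \<le> n div p\<close>, and each gives one
  factor \<open>p\<close> besides the valuation of \<open>k\<close>.\<close>

lemma multiplicity_fact_rec:
  assumes "prime p"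
  shows "multiplicity p (fact n :: nat) = n div p + multiplicity p (fact (n div p) :: nat)"
proof (induction n)
  case (Suc n)
  have pe: "prime_elem p" using assms by simp
  have p0: "p > 0" "p \<noteq> 1" using assms prime_gt_0_nat by auto
  have "multiplicity p (fact (Suc n) :: nat) = multiplicity p (Suc n) + multiplicity p (fact n :: nat)"
    by (simp only: fact_Suc of_nat_id, subst prime_elem_multiplicity_mult_distrib[OF pe]) simp_all
  also have "\<dots> = multiplicity p (Suc n) + n div p + multiplicity p (fact (n div p) :: nat)"
    using Suc by simp
  also have "\<dots> = Suc n div p + multiplicity p (fact (Suc n div p) :: nat)"
  proof (cases "p dvd Suc n")
    case False
    hence "Suc n div p = n div p" "multiplicity p (Suc n) = 0"
      by (auto simp: div_Suc not_dvd_imp_multiplicity_0 dvd_eq_mod_eq_0)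
    thus ?thesis by simp
  next
    case True
    then obtain k where k: "Suc n = p * k" by blast
    have d: "Suc n div p = Suc (n div p)" using True by (simp add: div_Suc dvd_eq_mod_eq_0)
    have k': "k = Suc (n div p)" using k d p0 by (metis nonzero_mult_div_cancel_left less_not_refl)
    have "multiplicity p (Suc n) = Suc (multiplicity p k)"
      using k' p0 by (simp only: k, subst multiplicity_times_same) auto
    moreover have "multiplicity p (fact k :: nat) = multiplicity p k + multiplicity p (fact (n div p) :: nat)"
      by (simp only: k' fact_Suc of_nat_id, subst prime_elem_multiplicity_mult_distrib[OF pe]) simp_all
    ultimately show ?thesis using d k' by simp
  qed
  finally show ?case .
qed auto

text \<open>Unfolding the recursion gives the geometric series
  \<open>n/p + n/p^2 + ... = n/(p-1)\<close>.\<close>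

lemma multiplicity_fact_le:
  assumes "prime p"
  shows "real (multiplicity p (fact n :: nat)) \<le> real n / (real p - 1)"
proof (induction n rule: less_induct)
  case (less n)
  have p: "p \<ge> 2" using assms prime_ge_2_nat by auto
  show ?case
  proof (cases "n = 0")
    case False
    hence lt: "n div p < n" using p by simp
    have d: "real (n div p) \<le> real n / real p" by (rule of_nat_div_le_of_nat)
    have "real (multiplicity p (fact n :: nat)) \<le> real (n div p) + real (n div p) / (real p - 1)"
      using less[OF lt] by (subst multiplicity_fact_rec[OF assms]) simp
    also have "\<dots> = real (n div p) * (real p / (real p - 1))" using p by (simp add: field_simps)
    also have "\<dots> \<le> real n / real p * (real p / (real p - 1))"
      using p d by (intro mult_right_mono) auto
    also have "\<dots> = real n / (real p - 1)" using p by (simp add: field_simps)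
    finally show ?thesis .
  qed simp
qed

lemma multiplicity_fact_ge:
  assumes "prime p"
  shows "real (multiplicity p (fact n :: nat)) \<ge> real n / real p - 1"
proof -
  have p: "p \<ge> 2" using assms prime_ge_2_nat by auto
  have "n < p * (n div p + 1)" using p by (simp add: dividend_less_times_div mult.commute)
  hence "real n < real p * (real (n div p) + 1)" by (metis of_nat_1 of_nat_add of_nat_less_iff of_nat_mult)
  hence "real n / real p - 1 \<le> real (n div p)" using p by (simp add: field_simps)
  also have "\<dots> \<le> real (multiplicity p (fact n :: nat))"
    by (subst multiplicity_fact_rec[OF assms]) simp
  finally show ?thesis .
qed

lemma ln_fact_eq_sum_primes:
  "ln (fact n) = (\<Sum>p\<in>primes_le n. real (multiplicity p (fact n :: nat)) * ln (real p))"
proof -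
  have pf: "prime_factors (fact n :: nat) = primes_le n"
    by (auto simp: prime_factors_dvd primes_le_def prime_dvd_fact_iff)
  have "(fact n :: nat) = (\<Prod>p\<in>prime_factors (fact n :: nat). p ^ multiplicity p (fact n :: nat))"
    by (rule prime_factorization_nat) simp
  hence "real (fact n) = (\<Prod>p\<in>primes_le n. real p ^ multiplicity p (fact n :: nat))"
    unfolding pf by (metis (mono_tags, lifting) of_nat_power of_nat_prod prod.cong)
  hence "ln (real (fact n)) = (\<Sum>p\<in>primes_le n. ln (real p ^ multiplicity p (fact n :: nat)))"
    by (simp only:, subst ln_prod) (auto simp: primes_le_def prime_gt_0_nat)
  thus ?thesis by (simp add: ln_realpow primes_le_def prime_gt_0_nat)
qed

text \<open>The series of \<open>exp n\<close> has nonnegative terms, so its term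
  \<open>n^n/n!\<close> is at most \<open>exp n\<close>.\<close>

lemma ln_fact_ge: "ln (fact n) \<ge> real n * ln (real n) - real n"
proof (cases "n = 0")
  case False
  have "real n ^ n /\<^sub>R fact n \<le> (\<Sum>k. real n ^ k /\<^sub>R fact k)"
    using sum_le_suminf[OF sums_summable[OF exp_converges[of "real n"]], of "{n}"] by simp
  hence "real n ^ n / fact n \<le> exp (real n)" by (simp add: exp_def divide_inverse mult.commute)
  hence "ln (real n ^ n / fact n) \<le> ln (exp (real n))"
    using False by (subst ln_le_cancel_iff) auto
  thus ?thesis using False by (simp add: ln_div ln_realpow)
qed simp

lemma ln_fact_le: "ln (fact n) \<le> real n * ln (real n)"
proof (cases "n = 0")
  case False
  have "ln (fact n :: real) \<le> ln (real n ^ n)"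
    using fact_le_power[of n, where 'a = real] False by (subst ln_le_cancel_iff) auto
  thus ?thesis using False by (simp add: ln_realpow)
qed simp

lemma summable_ln_over_square: "summable (\<lambda>n. ln (real n) / (real n * (real n - 1)))"
proof (rule summable_comparison_test_bigo)
  show "summable (\<lambda>n. norm (real n powr (-3/2)))"
    using summable_real_powr_iff[of "-3/2"] by simp
  show "(\<lambda>n. ln (real n) / (real n * (real n - 1))) \<in> O(\<lambda>n. real n powr (-3/2))"
    by real_asymp
qed

text \<open>Both bounds come from \<open>ln (n!) = n ln n + O(n)\<close>, written as a sum over
  primes with valuations close to \<open>n/p\<close>. The deficit of at most 1 per prime is paid by
  \<open>theta_le\<close>, the excess \<open>1/(p-1) - 1/p = 1/(p(p-1))\<close> by a convergent
  series.\<close>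

theorem mertens_first:
  obtains C where "C > 0" "\<And>n. n \<ge> 1 \<Longrightarrow> \<bar>(\<Sum>p\<in>primes_le n. ln (real p) / real p) - ln (real n)\<bar> \<le> C"
proof -
  define K where "K = (\<Sum>n. ln (real n) / (real n * (real n - 1)))"
  have bd: "\<bar>(\<Sum>p\<in>primes_le n. ln (real p) / real p) - ln (real n)\<bar> \<le> \<bar>K\<bar> + 2" if n: "n \<ge> 1" for n
  proof -
    let ?S = "\<Sum>p\<in>primes_le n. ln (real p) / real p"
    have "real n * ?S - (\<Sum>p\<in>primes_le n. ln (real p)) = (\<Sum>p\<in>primes_le n. (real n / real p - 1) * ln (real p))"
      by (simp add: sum_distrib_left sum_subtractf algebra_simps)
    also have "\<dots> \<le> (\<Sum>p\<in>primes_le n. real (multiplicity p (fact n :: nat)) * ln (real p))"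
      by (intro sum_mono mult_right_mono multiplicity_fact_ge)
        (auto simp: primes_le_def intro!: ln_ge_zero dest: prime_ge_1_nat)
    also have "\<dots> \<le> real n * ln (real n)" using ln_fact_eq_sum_primes[of n] ln_fact_le[of n] by simp
    finally have "real n * ?S \<le> real n * (ln (real n) + ln 4)"
      using theta_le[of n] by (simp add: algebra_simps)
    hence up: "?S \<le> ln (real n) + ln 4" using n by simp
    have "ln 4 \<le> (2::real)"
    proof -
      have "ln (4::real) = 2 * ln 2" using ln_realpow[of 2 2] by simp
      thus ?thesis using ln_2_less_1 by linarith
    qed
    hence up: "?S \<le> ln (real n) + 2" using up by linarith
    have "real n * ln (real n) - real n \<le> (\<Sum>p\<in>primes_le n. real (multiplicity p (fact n :: nat)) * ln (real p))"
      using ln_fact_eq_sum_primes[of n] ln_fact_ge[of n] by simp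
    also have "\<dots> \<le> (\<Sum>p\<in>primes_le n. real n / (real p - 1) * ln (real p))"
      by (intro sum_mono mult_right_mono multiplicity_fact_le)
        (auto simp: primes_le_def intro!: ln_ge_zero dest: prime_ge_1_nat)
    also have "\<dots> = (\<Sum>p\<in>primes_le n. real n * (ln (real p) / real p + ln (real p) / (real p * (real p - 1))))"
    proof (intro sum.cong refl)
      fix p assume "p \<in> primes_le n"
      hence "real p > 1" by (auto simp: primes_le_def dest: prime_gt_1_nat)
      thus "real n / (real p - 1) * ln (real p) = real n * (ln (real p) / real p + ln (real p) / (real p * (real p - 1)))"
        by (simp add: divide_simps) (simp add: algebra_simps)
    qed
    also have "\<dots> = real n * (?S + (\<Sum>p\<in>primes_le n. ln (real p) / (real p * (real p - 1))))"
      by (simp add: sum_distrib_left sum.distrib algebra_simps)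
    also have "\<dots> \<le> real n * (?S + K)" unfolding K_def
    proof (intro mult_left_mono add_left_mono sum_le_suminf summable_ln_over_square)
      show "0 \<le> ln (real m) / (real m * (real m - 1))" for m
        by (cases "m = 0") auto
    qed auto
    finally have "real n * (ln (real n) - 1) \<le> real n * (?S + K)" by (simp add: algebra_simps)
    hence "ln (real n) - 1 \<le> ?S + K" using n by simp
    thus ?thesis using up by linarith
  qed
  show ?thesis by (rule that[of "\<bar>K\<bar> + 2"]) (use bd in auto)
qed

section \<open>Mertens' second theorem by summation by parts\<close>

text \<open>Dirichlet's test in difference form: \<open>e\<close> plays the bounded partial sums,
  and summation by parts moves the difference onto the weights, whose variation telescopes.\<close>

lemma summable_diff_mult_antimono:
  fixes e w :: "nat \<Rightarrow> real"
  assumes e: "\<And>k. \<bar>e k\<bar> \<le> C" and w: "\<And>k. w (Suc k) \<le> w k" and w0: "w \<longlonglongrightarrow> 0"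
  shows "summable (\<lambda>k. (e (Suc k) - e k) * w k)"
proof -
  have "summable (\<lambda>k. C * (w k - w (Suc k)))"
    by (intro summable_mult telescope_summable'[OF w0])
  hence s: "summable (\<lambda>k. e (Suc k) * (w k - w (Suc k)))"
  proof (rule summable_comparison_test[rotated], intro exI[of _ 0] allI impI)
    fix k
    have "\<bar>e (Suc k)\<bar> * \<bar>w k - w (Suc k)\<bar> \<le> C * (w k - w (Suc k))"
      using e[of "Suc k"] w[of k] by (intro mult_mono) auto
    thus "norm (e (Suc k) * (w k - w (Suc k))) \<le> C * (w k - w (Suc k))" by (simp add: abs_mult)
  qed
  have eq: "(\<Sum>k<n. (e (Suc k) - e k) * w k) = e n * w n - e 0 * w 0 + (\<Sum>k<n. e (Suc k) * (w k - w (Suc k)))" for n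
    by (induction n) (auto simp: algebra_simps)
  have ew: "(\<lambda>n. e n * w n) \<longlonglongrightarrow> 0"
  proof (rule Lim_null_comparison)
    show "eventually (\<lambda>n. norm (e n * w n) \<le> C * \<bar>w n\<bar>) sequentially"
      using e by (auto simp: abs_mult intro!: always_eventually mult_right_mono)
    show "(\<lambda>n. C * \<bar>w n\<bar>) \<longlonglongrightarrow> 0" using tendsto_mult_right_zero[OF tendsto_rabs_zero[OF w0]] .
  qed
  have "(\<lambda>n. \<Sum>k<n. (e (Suc k) - e k) * w k) \<longlonglongrightarrow> 0 - e 0 * w 0 + (\<Sum>k. e (Suc k) * (w k - w (Suc k)))"
    unfolding eq by (intro tendsto_intros ew summable_LIMSEQ s)
  thus ?thesis by (auto simp: summable_def sums_def)
qed

lemma sum_primes_le_eq: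
  "(\<Sum>p\<in>primes_le n. f p) = (\<Sum>k\<le>n. if prime k then f k else 0)"
  for f :: "nat \<Rightarrow> 'a :: comm_monoid_add"
  by (rule sum.mono_neutral_cong_left) (auto simp: primes_le_def)

theorem mertens_second:
  obtains M where "(\<lambda>n. (\<Sum>p\<in>primes_le n. 1 / real p) - ln (ln (real n))) \<longlonglongrightarrow> M"
proof -
  from mertens_first obtain C where C: "C > 0"
    "\<And>n. n \<ge> 1 \<Longrightarrow> \<bar>(\<Sum>p\<in>primes_le n. ln (real p) / real p) - ln (real n)\<bar> \<le> C" by blast
  \<comment> \<open>\<open>e\<close> is the bounded remainder of the first theorem, sampled at
    \<open>k+1\<close>, so that its jump to \<open>e (Suc k)\<close> concerns the integer
    \<open>k+2\<close>. The weight \<open>1 / ln (k+2)\<close> turns \<open>ln p / p\<close> into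
    \<open>1/p\<close> and never meets \<open>ln 1 = 0\<close>.\<close>
  define e where "e k = (\<Sum>p\<in>primes_le (Suc k). ln (real p) / real p) - ln (real (Suc k))" for k
  define w where "w k = 1 / ln (real (k + 2))" for k
  define L where "L k = ln (ln (real (k + 2)))" for k :: nat
  have s1: "summable (\<lambda>k. (e (Suc k) - e k) * w k)"
  proof (rule summable_diff_mult_antimono)
    show "\<bar>e k\<bar> \<le> C" for k unfolding e_def by (rule C) auto
    show "w (Suc k) \<le> w k" for k unfolding w_def by (intro divide_left_mono) auto
    show "w \<longlonglongrightarrow> 0" unfolding w_def by real_asymp
  qed
  \<comment> \<open>The smooth part: after weighting, the increments of \<open>ln\<close> match
    those of \<open>ln ln\<close> up to a summable error.\<close>
  have s2: "summable (\<lambda>k. (ln (real (k+2)) - ln (real (k+1))) / ln (real (k+2)) - (L (Suc k) - L k))"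
  proof (rule summable_comparison_test_bigo)
    show "summable (\<lambda>n. norm (real n powr (-3/2)))"
      using summable_real_powr_iff[of "-3/2"] by simp
    show "(\<lambda>k. (ln (real (k+2)) - ln (real (k+1))) / ln (real (k+2)) - (L (Suc k) - L k)) \<in> O(\<lambda>n. real n powr (-3/2))"
      unfolding L_def by real_asymp
  qed
  have "summable (\<lambda>k. (if prime (k+2) then 1 / real (k+2) else 0) - (L (Suc k) - L k))"
  proof -
    have "(e (Suc k) - e k) * w k + ((ln (real (k+2)) - ln (real (k+1))) / ln (real (k+2)) - (L (Suc k) - L k))
        = (if prime (k+2) then 1 / real (k+2) else 0) - (L (Suc k) - L k)" for k
    proof -
      have "e (Suc k) - e k = (if prime (k+2) then ln (real (k+2)) / real (k+2) else 0) - (ln (real (k+2)) - ln (real (k+1)))"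
        by (simp add: e_def sum_primes_le_eq)
      hence "(e (Suc k) - e k) * w k = (if prime (k+2) then ln (real (k+2)) / real (k+2) else 0) * w k - (ln (real (k+2)) - ln (real (k+1))) * w k"
        by (simp only: left_diff_distrib)
      moreover have "(if prime (k+2) then ln (real (k+2)) / real (k+2) else 0) * w k = (if prime (k+2) then 1 / real (k+2) else 0)"
        by (simp add: w_def)
      ultimately show ?thesis by (simp add: w_def)
    qed
    thus ?thesis using summable_add[OF s1 s2] by (simp only:)
  qed
  from summable_LIMSEQ[OF this] obtain M0 where
    "(\<lambda>n. \<Sum>k<n. (if prime (k+2) then 1 / real (k+2) else 0) - (L (Suc k) - L k)) \<longlonglongrightarrow> M0" by blast
  also have "(\<lambda>n. \<Sum>k<n. (if prime (k+2) then 1 / real (k+2) else 0) - (L (Suc k) - L k))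
     = (\<lambda>n. (\<Sum>p\<in>primes_le (Suc n). 1 / real p) - (L n - L 0))"
  proof
    fix n show "(\<Sum>k<n. (if prime (k+2) then 1 / real (k+2) else 0) - (L (Suc k) - L k)) = (\<Sum>p\<in>primes_le (Suc n). 1 / real p) - (L n - L 0)"
      by (induction n) (auto simp: sum_primes_le_eq)
  qed
  finally have "(\<lambda>n. (\<Sum>p\<in>primes_le (Suc n). 1 / real p) - (L n - L 0)) \<longlonglongrightarrow> M0" .
  moreover have "(\<lambda>n. L n - ln (ln (real (Suc n)))) \<longlonglongrightarrow> 0" unfolding L_def by real_asymp
  ultimately have "(\<lambda>n. ((\<Sum>p\<in>primes_le (Suc n). 1 / real p) - (L n - L 0)) + (L n - ln (ln (real (Suc n)))) - L 0) \<longlonglongrightarrow> M0 + 0 - L 0"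
    by (intro tendsto_intros)
  hence "(\<lambda>n. (\<Sum>p\<in>primes_le (Suc n). 1 / real p) - ln (ln (real (Suc n)))) \<longlonglongrightarrow> M0 - L 0" by simp
  hence "(\<lambda>n. (\<Sum>p\<in>primes_le n. 1 / real p) - ln (ln (real n))) \<longlonglongrightarrow> M0 - L 0"
    by (subst filterlim_sequentially_Suc[symmetric])
  thus ?thesis by (rule that)
qed

section \<open>Euler products and the pole of the zeta function\<close>

text \<open>Eratosthenes on a series: by multiplicativity the multiples of a further prime
  \<open>p\<close> carry the fraction \<open>f p\<close> of the current sum, so removing them
  multiplies it by \<open>1 - f p\<close>.\<close>

lemma suminf_coprime_primes:
  fixes f :: "nat \<Rightarrow> real"
  assumes mult: "\<And>m n. f (m * n) = f m * f n" and nonneg: "\<And>n. f n \<ge> 0" and summ: "summable f"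
    and P: "finite P" "\<And>p. p \<in> P \<Longrightarrow> prime p"
  shows "summable (\<lambda>n. if \<exists>p\<in>P. p dvd n then 0 else f n)"
    and "(\<Sum>n. if \<exists>p\<in>P. p dvd n then 0 else f n) = (\<Prod>p\<in>P. 1 - f p) * suminf f"
proof -
  define g where "g P n = (if \<exists>p\<in>P. p dvd n then 0 else f n)" for P n
  have gs: "summable (g P)" for P
    by (rule summable_comparison_test[OF _ summ]) (auto simp: g_def nonneg)
  show "summable (\<lambda>n. if \<exists>p\<in>P. p dvd n then 0 else f n)" using gs[of P] by (simp add: g_def[abs_def])
  from P have "suminf (g P) = (\<Prod>p\<in>P. 1 - f p) * suminf f"
  proof (induction P rule: finite_induct)
    case (insert p P)
    have p: "prime p" "p > 0" using insert.prems prime_gt_0_nat by auto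
    define h where "h n = (if p dvd n then g P n else 0)" for n
    have hs: "(\<lambda>n. h (p * n)) sums (f p * suminf (g P))"
    proof -
      have "h (p * n) = f p * g P n" for n
      proof -
        have "q dvd p * n \<longleftrightarrow> q dvd n" if "q \<in> P" for q
          using that insert p by (metis insertCI prime_dvd_mult_iff primes_dvd_imp_eq)
        thus ?thesis by (auto simp: h_def g_def mult)
      qed
      thus ?thesis using sums_mult[OF summable_sums[OF gs[of P]], of "f p"] by simp
    qed
    hence "h sums (f p * suminf (g P))"
      by (subst (asm) sums_mono_reindex) (use p in \<open>auto simp: strict_mono_def h_def elim!: dvdE\<close>)
    hence "(\<lambda>n. g P n - h n) sums (suminf (g P) - f p * suminf (g P))"
      by (intro sums_diff summable_sums gs)
    also have "(\<lambda>n. g P n - h n) = g (insert p P)" by (auto simp: g_def h_def fun_eq_iff)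
    finally have "suminf (g (insert p P)) = suminf (g P) - f p * suminf (g P)" by (simp add: sums_iff)
    thus ?case using insert by (simp add: algebra_simps)
  qed (simp add: g_def[abs_def])
  thus "(\<Sum>n. if \<exists>p\<in>P. p dvd n then 0 else f n) = (\<Prod>p\<in>P. 1 - f p) * suminf f"
    by (simp add: g_def[abs_def])
qed

text \<open>Once the primes up to \<open>n\<close> are sieved out, the sum retains the term at 1 and
  otherwise only integers beyond \<open>n\<close>, so it lies between 1 and 1 plus a tail of the
  series.\<close>

lemma euler_product:
  fixes f :: "nat \<Rightarrow> real"
  assumes mult: "\<And>m n. f (m * n) = f m * f n" and nonneg: "\<And>n. f n \<ge> 0" and summ: "summable f"
    and f0: "f 0 = 0" and f1: "f 1 = 1"
  shows "(\<lambda>n. \<Prod>p\<in>primes_le n. 1 - f p) \<longlonglongrightarrow> 1 / suminf f"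
proof -
  define g where "g N n = (if \<exists>p\<in>primes_le N. p dvd n then 0 else f n)" for N n
  have gs: "summable (g N)" for N
    unfolding g_def by (rule suminf_coprime_primes[OF mult nonneg summ]) (auto simp: primes_le_def)
  have geq: "suminf (g N) = (\<Prod>p\<in>primes_le N. 1 - f p) * suminf f" for N
    unfolding g_def by (rule suminf_coprime_primes[OF mult nonneg summ]) (auto simp: primes_le_def)
  have bounds: "1 \<le> suminf (g N) \<and> suminf (g N) \<le> 1 + (suminf f - sum f {..<Suc N})" if N: "N \<ge> 1" for N
  proof -
    have g1: "sum (g N) {..<Suc N} = 1"
    proof -
      have "g N n = (if n = 1 then 1 else 0)" if "n < Suc N" for n
      proof (cases "n = 0 \<or> n = 1")
        case True
        thus ?thesis using f0 f1 by (auto simp: g_def primes_le_def)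
      next
        case False
        then obtain p where "prime p" "p dvd n" using prime_factor_nat by blast
        moreover have "p \<le> N" using dvd_imp_le[OF \<open>p dvd n\<close>] False that by auto
        ultimately have "\<exists>p\<in>primes_le N. p dvd n" by (auto simp: primes_le_def)
        thus ?thesis using False by (simp add: g_def)
      qed
      hence "sum (g N) {..<Suc N} = (\<Sum>n<Suc N. if n = 1 then 1 else 0)" by (intro sum.cong) auto
      thus ?thesis using N by simp
    qed
    have "suminf (g N) = (\<Sum>n. g N (n + Suc N)) + 1"
      using suminf_split_initial_segment[OF gs[of N], of "Suc N"] g1 by simp
    moreover have "(\<Sum>n. g N (n + Suc N)) \<ge> 0"
      by (intro suminf_nonneg summable_ignore_initial_segment gs) (auto simp: g_def nonneg)
    moreover have "(\<Sum>n. g N (n + Suc N)) \<le> (\<Sum>n. f (n + Suc N))"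
      by (intro suminf_le summable_ignore_initial_segment gs summ) (auto simp: g_def nonneg)
    moreover have "suminf f = (\<Sum>n. f (n + Suc N)) + sum f {..<Suc N}"
      by (rule suminf_split_initial_segment[OF summ])
    ultimately show ?thesis by linarith
  qed
  have "(\<lambda>N. 1 + (suminf f - sum f {..<Suc N})) \<longlonglongrightarrow> 1 + (suminf f - suminf f)"
    by (intro tendsto_intros filterlim_compose[OF summable_LIMSEQ[OF summ] filterlim_Suc])
  hence lim1: "(\<lambda>N. 1 + (suminf f - sum f {..<Suc N})) \<longlonglongrightarrow> 1" by simp
  have "(\<lambda>N. suminf (g N)) \<longlonglongrightarrow> 1"
  proof (rule tendsto_sandwich[OF _ _ tendsto_const lim1])
    show "\<forall>\<^sub>F N in sequentially. 1 \<le> suminf (g N)"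
      using eventually_ge_at_top[of 1] by eventually_elim (rule conjunct1[OF bounds])
    show "\<forall>\<^sub>F N in sequentially. suminf (g N) \<le> 1 + (suminf f - sum f {..<Suc N})"
      using eventually_ge_at_top[of 1] by eventually_elim (rule conjunct2[OF bounds])
  qed
  moreover have "suminf f > 0"
    using sum_le_suminf[OF summ, of "{1}"] f1 nonneg by simp
  ultimately have "(\<lambda>N. suminf (g N) / suminf f) \<longlonglongrightarrow> 1 / suminf f"
    by (intro tendsto_intros) auto
  thus ?thesis using \<open>suminf f > 0\<close> by (simp add: geq)
qed

text \<open>The simple pole of \<open>\<zeta>(1+d)\<close> at \<open>d = 0\<close>. The mean value
  theorem for \<open>- x powr (-d) / d\<close> puts the differences of \<open>h\<close> between
  consecutive terms, and \<open>h\<close> telescopes to \<open>1/d\<close>.\<close>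

lemma zeta_bounds:
  fixes d :: real
  assumes d: "d > 0"
  defines "f \<equiv> (\<lambda>n. real n powr (-1-d))"
  shows "summable f" "1 \<le> d * suminf f" "d * suminf f \<le> 1 + d"
proof -
  show s: "summable f" unfolding f_def using d by (subst summable_real_powr_iff) simp
  define h where "h n = real (Suc n) powr (-d) / d" for n
  have step: "f (Suc (Suc n)) \<le> h n - h (Suc n) \<and> h n - h (Suc n) \<le> f (Suc n)" for n
  proof -
    have "\<exists>z::real. z > real (Suc n) \<and> z < real (Suc (Suc n)) \<and>
       - (real (Suc (Suc n)) powr (-d) / d) - - (real (Suc n) powr (-d) / d) = (real (Suc (Suc n)) - real (Suc n)) * (z powr (-1-d))"
    proof (rule MVT2)
      fix x assume "real (Suc n) \<le> x" "x \<le> real (Suc (Suc n))"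
      hence "x > 0" by simp
      thus "((\<lambda>x. - (x powr (-d) / d)) has_real_derivative (x powr (-1-d))) (at x)"
        using d by (auto intro!: derivative_eq_intros simp: field_simps powr_diff powr_minus)
    qed simp
    then obtain z where z: "z > real (Suc n)" "z < real (Suc (Suc n))"
      "h n - h (Suc n) = z powr (-1-d)" by (auto simp: h_def)
    have "z powr (-1-d) \<le> real (Suc n) powr (-1-d)"
      using z d by (intro powr_mono2') auto
    moreover have "real (Suc (Suc n)) powr (-1-d) \<le> z powr (-1-d)"
      using z d by (intro powr_mono2') auto
    ultimately show ?thesis using z by (simp add: f_def)
  qed
  have h0: "h \<longlonglongrightarrow> 0" unfolding h_def using d by real_asymp
  have hs: "(\<lambda>n. h n - h (Suc n)) sums (h 0 - 0)" by (rule telescope_sums'[OF h0])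
  have hsum: "(\<Sum>n. h n - h (Suc n)) = 1 / d" using hs by (simp add: sums_iff h_def)
  have f1: "f 0 = 0" "f 1 = 1" by (auto simp: f_def)
  have e1: "(\<Sum>n. f (Suc n)) = suminf f" using suminf_split_head[OF s] f1 by simp
  have s1: "summable (\<lambda>n. f (Suc n))" using s by (subst summable_Suc_iff)
  have s2: "summable (\<lambda>n. f (Suc (Suc n)))" using s1 by (subst summable_Suc_iff)
  have e2: "(\<Sum>n. f (Suc (Suc n))) = suminf f - 1" using suminf_split_head[OF s1] e1 f1 by simp
  have "1 / d \<le> suminf f"
    unfolding hsum[symmetric] e1[symmetric] by (intro suminf_le sums_summable[OF hs] s1) (use step in auto)
  thus "1 \<le> d * suminf f" using d by (simp add: field_simps)
  have "suminf f - 1 \<le> 1 / d"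
    unfolding hsum[symmetric] e2[symmetric] by (intro suminf_le sums_summable[OF hs] s2) (use step in auto)
  thus "d * suminf f \<le> 1 + d" using d by (simp add: field_simps)
qed

section \<open>Abelian summation and the generating function of the harmonic numbers\<close>

text \<open>For \<open>0 < x < 1\<close> the weights \<open>(1-x) x^n\<close> have total 1, and
  their mass on any fixed initial segment tends to 0 as \<open>x\<close> approaches 1, so the
  average follows the limit of \<open>c\<close>.\<close>

lemma abelian_power_series:
  fixes c :: "nat \<Rightarrow> real"
  assumes c: "c \<longlonglongrightarrow> l"
  shows "((\<lambda>x. (1 - x) * (\<Sum>n. c n * x ^ n)) \<longlongrightarrow> l) (at_left 1)"
proof (rule tendstoI)
  fix e :: real assume e: "e > 0"
  obtain N where N: "\<And>n. n \<ge> N \<Longrightarrow> \<bar>c n - l\<bar> < e / 2"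
    using LIMSEQ_D[OF c, of "e/2"] e by auto
  define K where "K = (\<Sum>n<N. \<bar>c n - l\<bar>)"
  have "((\<lambda>x. (1 - x) * K) \<longlongrightarrow> (1 - 1) * K) (at_left (1::real))" by (intro tendsto_intros)
  hence ev: "eventually (\<lambda>x. (1 - x) * K < e / 2) (at_left (1::real))"
    using e by (intro order_tendstoD) auto
  have "eventually (\<lambda>x. x \<in> {0<..<1}) (at_left (1::real))"
    by (rule eventually_at_left_real) simp
  with ev show "eventually (\<lambda>x. dist ((1 - x) * (\<Sum>n. c n * x ^ n)) l < e) (at_left 1)"
  proof eventually_elim
    case (elim x)
    hence x: "0 < x" "x < 1" by auto
    obtain B where B: "\<And>n. \<bar>c n - l\<bar> \<le> B"
      using convergent_imp_Bseq[of "\<lambda>n. c n - l"] tendsto_diff[OF c tendsto_const[of l]]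
      by (auto simp: convergent_def Bseq_def)
    have geo: "summable (\<lambda>n. x ^ n)" using x by (simp add: summable_geometric)
    have s: "summable (\<lambda>n. \<bar>c n - l\<bar> * x ^ n)"
    proof (rule summable_comparison_test[OF _ summable_mult[OF geo, of B]], intro exI[of _ 0] allI impI)
      fix n show "norm (\<bar>c n - l\<bar> * x ^ n) \<le> B * x ^ n"
        using B[of n] x by (simp add: abs_mult mult_right_mono)
    qed
    have s': "summable (\<lambda>n. (c n - l) * x ^ n)"
      by (rule summable_rabs_cancel) (use s x in \<open>simp add: abs_mult\<close>)
    have "(\<lambda>n. (c n - l) * x ^ n + l * x ^ n) sums ((\<Sum>n. (c n - l) * x ^ n) + l * (1 / (1 - x)))"
      using x by (intro sums_add summable_sums s' sums_mult geometric_sums) auto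
    hence "(\<Sum>n. c n * x ^ n) = (\<Sum>n. (c n - l) * x ^ n) + l / (1 - x)"
      by (simp add: sums_iff algebra_simps)
    hence eq: "(1 - x) * (\<Sum>n. c n * x ^ n) - l = (1 - x) * (\<Sum>n. (c n - l) * x ^ n)"
      using x by (simp add: field_simps)
    have "\<bar>\<Sum>n. (c n - l) * x ^ n\<bar> \<le> (\<Sum>n. \<bar>(c n - l) * x ^ n\<bar>)"
      by (rule summable_rabs) (use s x in \<open>simp add: abs_mult\<close>)
    also have "\<dots> = (\<Sum>n. \<bar>c n - l\<bar> * x ^ n)" using x by (simp add: abs_mult)
    also have "\<dots> = (\<Sum>n. \<bar>c (n+N) - l\<bar> * x ^ (n+N)) + (\<Sum>n<N. \<bar>c n - l\<bar> * x ^ n)"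
      by (rule suminf_split_initial_segment[OF s])
    also have "(\<Sum>n<N. \<bar>c n - l\<bar> * x ^ n) \<le> K"
      unfolding K_def using x by (intro sum_mono) (auto intro!: mult_left_le power_le_one)
    also have "(\<Sum>n. \<bar>c (n+N) - l\<bar> * x ^ (n+N)) \<le> (\<Sum>n. e / 2 * x ^ n)"
    proof (intro suminf_le summable_ignore_initial_segment s summable_mult geo mult_mono)
      show "\<bar>c (n + N) - l\<bar> \<le> e / 2" for n using N[of "n+N"] by simp
      show "x ^ (n + N) \<le> x ^ n" for n using x by (intro power_decreasing) auto
    qed (use x e in auto)
    also have "(\<Sum>n. e / 2 * x ^ n) = e / 2 / (1 - x)"
      using x by (subst suminf_mult[OF geo], subst suminf_geometric) auto
    finally have "(1 - x) * \<bar>\<Sum>n. (c n - l) * x ^ n\<bar> \<le> (1 - x) * (e / 2 / (1 - x) + K)"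
      using x by (intro mult_left_mono) auto
    also have "\<dots> = e / 2 + (1 - x) * K" using x by (simp add: field_simps)
    also have "\<dots> < e" using elim by simp
    finally show ?case using x by (simp add: dist_real_def eq abs_mult)
  qed
qed

lemma sum_diff_mult_power:
  fixes B :: "nat \<Rightarrow> real"
  assumes "B 0 = 0"
  shows "(\<Sum>n<K. (B (Suc n) - B n) * x ^ Suc n) = B K * x ^ K + (1 - x) * (\<Sum>n<K. B n * x ^ n)"
  using assms by (induction K) (auto simp: algebra_simps)

lemma sums_diff_mult_power:
  fixes B :: "nat \<Rightarrow> real"
  assumes "B 0 = 0" and s: "summable (\<lambda>n. B n * x ^ n)"
  shows "(\<lambda>n. (B (Suc n) - B n) * x ^ Suc n) sums ((1 - x) * (\<Sum>n. B n * x ^ n))"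
proof -
  have "(\<lambda>K. B K * x ^ K + (1 - x) * (\<Sum>n<K. B n * x ^ n)) \<longlonglongrightarrow> 0 + (1 - x) * (\<Sum>n. B n * x ^ n)"
    by (intro tendsto_intros summable_LIMSEQ_zero summable_LIMSEQ s)
  thus ?thesis unfolding sums_def sum_diff_mult_power[of B, OF assms(1)] by simp
qed

text \<open>The increments of \<open>harm\<close> are \<open>1/(n+1)\<close>, so summation by parts
  leads to the series of \<open>- ln (1-x)\<close>. This closed form makes \<open>harm\<close> the
  comparison sequence for the prime sums, and brings in \<open>\<gamma>\<close>.\<close>

lemma harm_power_series:
  fixes x :: real assumes "0 < x" "x < 1"
  shows "summable (\<lambda>n. harm n * x ^ n)" "(1 - x) * (\<Sum>n. harm n * x ^ n) = - ln (1 - x)"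
proof -
  show s: "summable (\<lambda>n. harm n * x ^ n)"
  proof (rule summable_comparison_test)
    have "summable (\<lambda>n. diffs (\<lambda>_. 1) n * x ^ n)"
      by (rule termdiff_converges[of _ 1]) (use assms in \<open>auto simp: summable_geometric_iff\<close>)
    thus "summable (\<lambda>n. real (Suc n) * x ^ n)" by (simp add: diffs_def)
    have "harm n \<le> real n" for n
    proof (induction n)
      case (Suc n)
      have "inverse (real (Suc n)) \<le> 1" by (simp add: field_simps)
      thus ?case using Suc by (simp add: harm_Suc)
    qed (simp add: harm_expand)
    hence "harm n \<le> real (Suc n)" for n by (rule order_trans) auto
    moreover have "harm n \<ge> (0::real)" for n by (simp add: harm_nonneg)
    ultimately show "\<exists>N. \<forall>n\<ge>N. norm (harm n * x ^ n) \<le> real (Suc n) * x ^ n"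
      using assms by (intro exI[of _ 0] allI impI) (simp add: abs_mult mult_right_mono)
  qed
  have "(\<lambda>n. (harm (Suc n) - harm n) * x ^ Suc n) sums ((1 - x) * (\<Sum>n. harm n * x ^ n))"
    by (rule sums_diff_mult_power) (use s in \<open>auto simp: harm_expand\<close>)
  also have "(\<lambda>n. (harm (Suc n) - harm n) * x ^ Suc n) = (\<lambda>n. x ^ Suc n / real (Suc n))"
    by (auto simp: harm_Suc field_simps)
  finally have "(\<lambda>n. x ^ n / real n) sums ((1 - x) * (\<Sum>n. harm n * x ^ n))"
    by (subst (asm) sums_Suc_iff) simp
  moreover have "(\<lambda>n. x ^ n / real n) sums (- ln (1 - x))"
    using sums_minus[OF ln_series'[of "-x"]] assms by simp
  ultimately show "(1 - x) * (\<Sum>n. harm n * x ^ n) = - ln (1 - x)" by (rule sums_unique2)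
qed

section \<open>The logarithm of zeta against its prime sum\<close>

lemma neg_ln_one_minus_bounds:
  fixes u :: real assumes "0 \<le> u" "u \<le> 1/2"
  shows "0 \<le> - ln (1 - u) - u" "- ln (1 - u) - u \<le> 2 * u^2"
  using ln_one_minus_pos_lower_bound[of u] ln_add_one_self_le_self2[of "-u"] assms by auto

lemma prime_powr_le_half:
  assumes "prime p" "d \<ge> 0" shows "real p powr (-1-d) \<le> 1/2"
proof -
  have "real p \<ge> 2" using prime_ge_2_nat[OF assms(1)] by simp
  hence "real p powr (-1-d) \<le> real p powr (-1)" using assms by (intro powr_mono) auto
  also have "\<dots> \<le> 1/2" using \<open>real p \<ge> 2\<close> by (simp add: powr_minus field_simps)
  finally show ?thesis .
qed

lemma tendsto_sum_primes_le:
  fixes f :: "nat \<Rightarrow> real"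
  assumes "summable (\<lambda>n. if prime n then f n else 0)"
  shows "(\<lambda>n. \<Sum>p\<in>primes_le n. f p) \<longlonglongrightarrow> (\<Sum>n. if prime n then f n else 0)"
  using summable_LIMSEQ'[OF assms] by (simp add: sum_primes_le_eq)

text \<open>The constant in Mertens' theorem: the logarithm of the zeta function near 1 is
  compared with \<open>\<Sum>x\<^sup>n/n\<close> after grouping the primes by \<open>n = \<lceil>ln p\<rceil>\<close>.\<close>
theorem mertens_constant:
  "(\<lambda>n. (\<Sum>p\<in>primes_le n. - ln (1 - 1 / real p)) - ln (ln (real n))) \<longlonglongrightarrow> euler_mascheroni"
proof -
  obtain M where M: "(\<lambda>n. (\<Sum>p\<in>primes_le n. 1 / real p) - ln (ln (real n))) \<longlonglongrightarrow> M"
    using mertens_second .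
  \<comment> \<open>\<open>\<phi> u\<close> collects the terms \<open>u^k/k\<close> with
    \<open>k \<ge> 2\<close>, so \<open>F d\<close> is the contribution of proper prime powers to
    \<open>ln \<zeta>(1+d)\<close>; it stays continuous down to \<open>d = 0\<close>.\<close>
  define \<phi> where "\<phi> u = - ln (1 - u) - u" for u :: real
  define a where "a n d = (if prime n then \<phi> (real n powr (-1-d)) else 0)" for n :: nat and d :: real
  define F where "F d = (\<Sum>n. a n d)" for d
  have abd: "0 \<le> a n d" "a n d \<le> 2 * real n powr (-2)" if "d \<ge> 0" for n d
  proof -
    show "0 \<le> a n d"
      using neg_ln_one_minus_bounds(1)[OF _ prime_powr_le_half] that by (auto simp: a_def \<phi>_def)
    show "a n d \<le> 2 * real n powr (-2)"
    proof (cases "prime n")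
      case True
      hence n: "real n \<ge> 1" using prime_ge_1_nat by simp
      have "a n d \<le> 2 * (real n powr (-1-d))^2"
        using neg_ln_one_minus_bounds(2)[OF _ prime_powr_le_half[OF True that]] True by (simp add: a_def \<phi>_def)
      also have "(real n powr (-1-d))^2 \<le> (real n powr (-1))^2"
        using n that by (intro power_mono powr_mono) auto
      also have "(real n powr (-1))^2 = real n powr (-2)" by (simp only: power2_eq_square powr_add[symmetric]) simp
      finally show ?thesis by simp
    qed (simp add: a_def)
  qed
  have msum: "summable (\<lambda>n. 2 * real n powr (-2))"
    by (intro summable_mult) (simp add: summable_real_powr_iff)
  have asum: "summable (\<lambda>n. a n d)" if "d \<ge> 0" for d
    by (rule summable_comparison_test[OF _ msum]) (use abd[OF that] in auto)
  have Flim: "(F \<longlongrightarrow> F 0) (at_right 0)"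
  proof -
    have "((\<lambda>d. a n d) \<longlongrightarrow> a n 0) (at_right 0)" for n
    proof (cases "prime n")
      case True
      hence n: "real n > 1" using prime_gt_1_nat by simp
      have lim: "((\<lambda>d. real n powr (-1-d)) \<longlongrightarrow> real n powr (-1-0)) (at_right 0)"
        using n by (intro tendsto_intros) auto
      have "1 - real n powr (-1-0) \<noteq> 0" using prime_powr_le_half[OF True, of 0] by linarith
      hence "((\<lambda>d. \<phi> (real n powr (-1-d))) \<longlongrightarrow> \<phi> (real n powr (-1-0))) (at_right 0)"
        unfolding \<phi>_def by (intro tendsto_intros lim)
      thus ?thesis using True by (simp add: a_def)
    qed (simp add: a_def)
    moreover have "eventually (\<lambda>(k,n). norm (a k n) \<le> 2 * real k powr (-2)) (at_top \<times>\<^sub>F at_right 0)"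
      unfolding eventually_prod_filter
      by (rule exI[of _ "\<lambda>_. True"], rule exI[of _ "\<lambda>d. d > 0"])
        (use abd in \<open>auto simp: eventually_at_right_less\<close>)
    ultimately show ?thesis unfolding F_def
      using tannerys_theorem[of a "\<lambda>n. a n 0" "at_right 0" "\<lambda>n. 2 * real n powr (-2)"] msum by auto
  qed
  \<comment> \<open>The primes between \<open>fl n\<close> and \<open>fl (Suc n)\<close> satisfy
    \<open>exp n < p \<le> exp (n+1)\<close>, so for them \<open>p powr (-d)\<close> lies between
    \<open>x^(n+1)\<close> and \<open>x^n\<close> with \<open>x = exp (-d)\<close>.\<close>
  define fl where "fl n = nat \<lfloor>exp (real n)\<rfloor>" for n
  define B where "B n = (\<Sum>p\<in>primes_le (fl n). 1 / real p)" for n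
  have fl: "real (fl n) \<le> exp (real n)" "exp (real n) - 1 \<le> real (fl n)" for n
    by (auto simp: fl_def of_nat_nat)
  have flmono: "fl m \<le> fl n" if "m \<le> n" for m n unfolding fl_def using that by (intro nat_mono floor_mono) simp
  have fltop: "filterlim fl at_top sequentially"
  proof -
    have "filterlim (\<lambda>n. exp (real n) - 1) at_top sequentially" by real_asymp
    hence "filterlim (\<lambda>n. real (fl n)) at_top sequentially"
      by (rule filterlim_at_top_mono) (use fl in auto)
    thus ?thesis by (simp add: filterlim_sequentially_iff_filterlim_real)
  qed
  have "(\<lambda>n. ln (ln (real (fl n))) - ln (real n)) \<longlonglongrightarrow> 0"
  proof (rule tendsto_sandwich)
    show "(\<lambda>n. ln (ln (exp (real n) - 1)) - ln (real n)) \<longlonglongrightarrow> 0" by real_asymp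
    show "(\<lambda>n. ln (ln (exp (real n))) - ln (real n)) \<longlonglongrightarrow> 0" by simp
    have "eventually (\<lambda>n. exp (real n) - 1 > exp 1) sequentially" by real_asymp
    hence "eventually (\<lambda>n. ln (ln (exp (real n) - 1)) \<le> ln (ln (real (fl n))) \<and> ln (ln (real (fl n))) \<le> ln (ln (exp (real n)))) sequentially"
    proof eventually_elim
      case (elim n)
      have e: "exp 1 > (1::real)" by simp
      have f: "real (fl n) > exp 1" using elim fl[of n] by linarith
      have pos: "real (fl n) > 0" "exp (real n) - 1 > 0" using e elim f by linarith+
      have "ln (exp 1) < ln (exp (real n) - 1)" using elim pos by (subst ln_less_cancel_iff) auto
      moreover have "ln (exp (real n) - 1) \<le> ln (real (fl n))" using fl[of n] pos by (intro ln_mono) linarith+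
      moreover have "ln (real (fl n)) \<le> ln (exp (real n))" using fl[of n] pos by (intro ln_mono) linarith+
      ultimately have "1 < ln (exp (real n) - 1)" "1 < ln (real (fl n))"
        "ln (exp (real n) - 1) \<le> ln (real (fl n))" "ln (real (fl n)) \<le> ln (exp (real n))" by auto
      thus ?case using fl[of n] pos by (intro conjI ln_mono) linarith+
    qed
    thus "eventually (\<lambda>n. ln (ln (exp (real n) - 1)) - ln (real n) \<le> ln (ln (real (fl n))) - ln (real n)) sequentially"
      "eventually (\<lambda>n. ln (ln (real (fl n))) - ln (real n) \<le> ln (ln (exp (real n))) - ln (real n)) sequentially"
      by (auto elim: eventually_mono)
  qed
  from tendsto_add[OF filterlim_compose[OF M fltop] this]
  have "(\<lambda>n. B n - ln (real n)) \<longlonglongrightarrow> M" by (simp add: B_def)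
  \<comment> \<open>Here \<open>\<gamma>\<close> enters: \<open>harm n - ln n\<close> tends to it,
    while \<open>B n - ln n\<close> tends to the constant \<open>M\<close> of the second
    theorem.\<close>
  from tendsto_diff[OF this euler_mascheroni_LIMSEQ]
  have c: "(\<lambda>n. B n - harm n) \<longlonglongrightarrow> M - euler_mascheroni" by (simp add: algebra_simps)
  have B0: "B 0 = 0"
    by (auto simp: B_def fl_def primes_le_def intro!: sum.neutral dest: prime_ge_2_nat)
  define A where "A d = (1 - exp (-d)) * (\<Sum>n. (B n - harm n) * exp (-d) ^ n)" for d :: real
  have Alim: "(A \<longlongrightarrow> M - euler_mascheroni) (at_right 0)"
    unfolding A_def by (rule filterlim_compose[OF abelian_power_series[OF c]]) real_asymp
  define Z where "Z d = (\<Sum>n. real n powr (-1-d))" for d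
  have Zpos: "Z d > 0" if "d > 0" for d
  proof -
    have "0 < d * Z d" using zeta_bounds(2)[OF that] unfolding Z_def by linarith
    thus ?thesis using that by (simp add: zero_less_mult_iff)
  qed
  \<comment> \<open>With \<open>x = exp (-d)\<close>, the prime sum
    \<open>Q = ln \<zeta>(1+d) - F d\<close> lies between \<open>S\<close> and \<open>S / x\<close>,
    where \<open>S = A d - ln (1-x)\<close>; the two bounds merge as \<open>d\<close> tends to
    0.\<close>
  have main: "A d \<le> ln (Z d) + ln (1 - exp (-d)) - F d \<and>
      ln (Z d) + ln (1 - exp (-d)) - F d \<le> A d / exp (-d) - ln (1 - exp (-d)) * (1 / exp (-d) - 1)" if d: "d > 0" for d
  proof -
    define x where "x = exp (-d)"
    have x: "0 < x" "x < 1" using d by (auto simp: x_def)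
    define Q where "Q = (\<Sum>n. if prime n then real n powr (-1-d) else 0)"
    have zs: "summable (\<lambda>n. real n powr (-1-d))" using zeta_bounds(1)[OF d] .
    have qs: "summable (\<lambda>n. if prime n then real n powr (-1-d) else 0)"
      by (rule summable_comparison_test[OF _ zs]) auto
    have Qlim: "(\<lambda>n. \<Sum>p\<in>primes_le n. real p powr (-1-d)) \<longlonglongrightarrow> Q"
      unfolding Q_def by (rule tendsto_sum_primes_le[OF qs])
    have lnZ: "ln (Z d) = Q + F d"
    proof -
      have "(\<lambda>n. \<Prod>p\<in>primes_le n. 1 - real p powr (-1-d)) \<longlonglongrightarrow> 1 / Z d"
        unfolding Z_def by (rule euler_product) (auto simp: powr_mult zs)
      hence "(\<lambda>n. - ln (\<Prod>p\<in>primes_le n. 1 - real p powr (-1-d))) \<longlonglongrightarrow> - ln (1 / Z d)"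
        using Zpos[OF d] by (intro tendsto_intros) auto
      also have "- ln (1 / Z d) = ln (Z d)" using Zpos[OF d] by (simp add: ln_div)
      also have "(\<lambda>n. - ln (\<Prod>p\<in>primes_le n. 1 - real p powr (-1-d))) =
          (\<lambda>n. (\<Sum>p\<in>primes_le n. real p powr (-1-d)) + (\<Sum>p\<in>primes_le n. \<phi> (real p powr (-1-d))))"
      proof
        fix n
        have "ln (\<Prod>p\<in>primes_le n. 1 - real p powr (-1-d)) = (\<Sum>p\<in>primes_le n. ln (1 - real p powr (-1-d)))"
        proof (rule ln_prod)
          fix p assume "p \<in> primes_le n"
          thus "1 - real p powr (-1-d) \<noteq> 0" using prime_powr_le_half[of p d] d by (auto simp: primes_le_def)
        qed simp
        thus "- ln (\<Prod>p\<in>primes_le n. 1 - real p powr (-1-d)) =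
          (\<Sum>p\<in>primes_le n. real p powr (-1-d)) + (\<Sum>p\<in>primes_le n. \<phi> (real p powr (-1-d)))"
          by (simp add: \<phi>_def sum_subtractf sum_negf)
      qed
      finally have 1: "(\<lambda>n. (\<Sum>p\<in>primes_le n. real p powr (-1-d)) + (\<Sum>p\<in>primes_le n. \<phi> (real p powr (-1-d)))) \<longlonglongrightarrow> ln (Z d)" .
      have "(\<lambda>n. \<Sum>p\<in>primes_le n. \<phi> (real p powr (-1-d))) \<longlonglongrightarrow> F d"
        unfolding F_def a_def by (rule tendsto_sum_primes_le) (use asum[of d] d in \<open>simp add: a_def\<close>)
      from tendsto_add[OF Qlim this] show ?thesis using 1 LIMSEQ_unique by blast
    qed
    have cs: "summable (\<lambda>n. (B n - harm n) * x ^ n)"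
    proof -
      obtain C where C: "\<And>n. \<bar>B n - harm n\<bar> \<le> C"
        using convergent_imp_Bseq[of "\<lambda>n. B n - harm n"] c by (auto simp: convergent_def Bseq_def)
      show ?thesis
      proof (rule summable_comparison_test)
        show "summable (\<lambda>n. C * x ^ n)" using x by (intro summable_mult) (simp add: summable_geometric)
        show "\<exists>N. \<forall>n\<ge>N. norm ((B n - harm n) * x ^ n) \<le> C * x ^ n"
          using C x by (auto simp: abs_mult intro!: exI[of _ 0] mult_right_mono)
      qed
    qed
    have Bs: "summable (\<lambda>n. B n * x ^ n)"
      using summable_add[OF cs harm_power_series(1)[OF x]] by (simp add: algebra_simps)
    define S where "S = (1 - x) * (\<Sum>n. B n * x ^ n)"
    have SA: "S = A d - ln (1 - x)"
    proof -
      have "(\<Sum>n. B n * x ^ n) = (\<Sum>n. (B n - harm n) * x ^ n) + (\<Sum>n. harm n * x ^ n)"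
        using suminf_add[OF cs harm_power_series(1)[OF x]] by (simp add: algebra_simps)
      hence "S = (1 - x) * (\<Sum>n. (B n - harm n) * x ^ n) + (1 - x) * (\<Sum>n. harm n * x ^ n)"
        by (simp add: S_def distrib_left)
      thus ?thesis using harm_power_series(2)[OF x] by (simp add: A_def x_def)
    qed
    define W where "W K = (\<Sum>n<K. (B (Suc n) - B n) * x ^ Suc n)" for K
    have Wlim: "W \<longlonglongrightarrow> S"
      using sums_diff_mult_power[OF B0 Bs] by (simp add: sums_def W_def[abs_def] S_def)
    have cmp: "W K \<le> (\<Sum>p\<in>primes_le (fl K). real p powr (-1-d)) \<and> (\<Sum>p\<in>primes_le (fl K). real p powr (-1-d)) \<le> W K / x" for K
    proof (induction K)
      case 0
      have "primes_le (fl 0) = {}" by (auto simp: fl_def primes_le_def dest: prime_ge_2_nat)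
      thus ?case by (simp add: W_def)
    next
      case (Suc K)
      define D where "D = primes_le (fl (Suc K)) - primes_le (fl K)"
      have sub: "primes_le (fl K) \<subseteq> primes_le (fl (Suc K))" by (intro primes_le_mono flmono) simp
      have split: "(\<Sum>p\<in>primes_le (fl (Suc K)). g p) = (\<Sum>p\<in>primes_le (fl K). g p) + (\<Sum>p\<in>D. g p)" for g :: "nat \<Rightarrow> real"
        unfolding D_def by (subst sum.subset_diff[OF sub]) auto
      have BD: "B (Suc K) - B K = (\<Sum>p\<in>D. 1 / real p)" by (simp add: B_def split)
      have "1 / real p * x ^ Suc K \<le> real p powr (-1-d) \<and> real p powr (-1-d) \<le> 1 / real p * x ^ K" if "p \<in> D" for p
      proof -
        have p: "prime p" "p \<le> fl (Suc K)" "p > fl K" using that by (auto simp: D_def primes_le_def)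
        have p0: "real p > 0" using p prime_gt_0_nat by simp
        have "real p \<le> real (fl (Suc K))" using p by simp
        hence "real p \<le> exp (real (Suc K))" using fl(1)[of "Suc K"] by linarith
        hence u: "ln (real p) \<le> real (Suc K)" using p0 by (metis ln_exp ln_le_cancel_iff exp_gt_zero)
        have "real p > exp (real K)" using p(3) by (simp add: fl_def nat_less_iff floor_less_iff)
        hence l: "ln (real p) \<ge> real K" using p0 by (metis less_imp_le ln_exp ln_le_cancel_iff exp_gt_zero)
        have eq: "real p powr (-1-d) = 1 / real p * exp (-d * ln (real p))"
          using p0 by (simp add: powr_diff powr_minus_divide) (simp add: powr_def exp_minus field_simps)
        have x1: "x ^ n = exp (-d * real n)" for n by (simp add: x_def mult.commute flip: exp_of_nat_mult)
        have "exp (-d * real (Suc K)) \<le> exp (-d * ln (real p))" "exp (-d * ln (real p)) \<le> exp (-d * real K)"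
          using u l d by auto
        thus ?thesis unfolding eq x1 using p0 by (auto intro!: divide_right_mono)
      qed
      hence "(\<Sum>p\<in>D. 1 / real p * x ^ Suc K) \<le> (\<Sum>p\<in>D. real p powr (-1-d))" "(\<Sum>p\<in>D. real p powr (-1-d)) \<le> (\<Sum>p\<in>D. 1 / real p * x ^ K)"
        by (auto intro!: sum_mono)
      hence "(B (Suc K) - B K) * x ^ Suc K \<le> (\<Sum>p\<in>D. real p powr (-1-d))" "(\<Sum>p\<in>D. real p powr (-1-d)) \<le> (B (Suc K) - B K) * x ^ K"
        unfolding BD by (simp_all only: sum_distrib_right)
      moreover have "W (Suc K) = W K + (B (Suc K) - B K) * x ^ Suc K" by (simp add: W_def)
      moreover have "(W K + (B (Suc K) - B K) * x ^ Suc K) / x = W K / x + (B (Suc K) - B K) * x ^ K"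
        using x by (simp add: field_simps)
      ultimately show ?case using Suc unfolding split by simp
    qed
    have Qfl: "(\<lambda>K. \<Sum>p\<in>primes_le (fl K). real p powr (-1-d)) \<longlonglongrightarrow> Q"
      by (rule filterlim_compose[OF Qlim fltop])
    have "S \<le> Q" by (rule LIMSEQ_le[OF Wlim Qfl]) (use cmp in auto)
    moreover have "Q \<le> S / x"
      by (rule LIMSEQ_le[OF Qfl tendsto_divide[OF Wlim tendsto_const]]) (use cmp x in auto)
    ultimately show ?thesis using lnZ SA x by (simp add: x_def[symmetric] field_simps)
  qed
  have ev: "eventually (\<lambda>d::real. d > 0) (at_right 0)" by (simp add: eventually_at_right_less)
  have Zlim: "((\<lambda>d. ln (Z d) + ln (1 - exp (-d))) \<longlongrightarrow> 0) (at_right 0)"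
  proof -
    have "((\<lambda>d. d * Z d) \<longlongrightarrow> 1) (at_right 0)"
    proof (rule tendsto_sandwich[OF _ _ tendsto_const])
      show "((\<lambda>d::real. 1 + d) \<longlongrightarrow> 1) (at_right 0)" by real_asymp
      show "eventually (\<lambda>d. 1 \<le> d * Z d) (at_right 0)" "eventually (\<lambda>d. d * Z d \<le> 1 + d) (at_right 0)"
        using ev by (eventually_elim, use zeta_bounds in \<open>simp add: Z_def\<close>)+
    qed
    hence "((\<lambda>d. ln (d * Z d)) \<longlongrightarrow> ln 1) (at_right 0)" by (intro tendsto_intros) auto
    moreover have "((\<lambda>d::real. ln ((1 - exp (-d)) / d)) \<longlongrightarrow> 0) (at_right 0)" by real_asymp
    ultimately have "((\<lambda>d. ln (d * Z d) + ln ((1 - exp (-d)) / d)) \<longlongrightarrow> ln 1 + 0) (at_right 0)"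
      by (rule tendsto_add)
    moreover have "eventually (\<lambda>d. ln (d * Z d) + ln ((1 - exp (-d)) / d) = ln (Z d) + ln (1 - exp (-d))) (at_right 0)"
      using ev
    proof eventually_elim
      case (elim d)
      have "1 - exp (-d) > 0" using elim by simp
      thus ?case using Zpos[OF elim] elim by (simp add: ln_mult_pos ln_div)
    qed
    ultimately show ?thesis using tendsto_cong by force
  qed
  \<comment> \<open>\<open>l1\<close> and \<open>l2\<close> squeeze \<open>- F 0\<close> to
    \<open>M - \<gamma>\<close>, so \<open>M + F 0\<close>, the constant belonging to the sum of
    \<open>- ln (1 - 1/p)\<close>, is \<open>\<gamma>\<close>.\<close>
  have l1: "M - euler_mascheroni \<le> 0 - F 0"
  proof (rule tendsto_le[OF _ tendsto_diff[OF Zlim Flim] Alim])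
    show "eventually (\<lambda>d. A d \<le> ln (Z d) + ln (1 - exp (-d)) - F d) (at_right 0)"
      using ev by eventually_elim (use main in blast)
  qed simp
  have l2: "0 - F 0 \<le> (M - euler_mascheroni) / 1 - 0"
  proof (rule tendsto_le[OF _ _ tendsto_diff[OF Zlim Flim]])
    have e: "((\<lambda>d::real. exp (-d)) \<longlongrightarrow> 1) (at_right 0)" by real_asymp
    have "((\<lambda>d::real. ln (1 - exp (-d)) * (1 / exp (-d) - 1)) \<longlongrightarrow> 0) (at_right 0)" by real_asymp
    thus "((\<lambda>d. A d / exp (-d) - ln (1 - exp (-d)) * (1 / exp (-d) - 1)) \<longlongrightarrow> (M - euler_mascheroni) / 1 - 0) (at_right 0)"
      by (intro tendsto_diff tendsto_divide Alim e) auto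
    show "eventually (\<lambda>d. ln (Z d) + ln (1 - exp (-d)) - F d \<le> A d / exp (-d) - ln (1 - exp (-d)) * (1 / exp (-d) - 1)) (at_right 0)"
      using ev by eventually_elim (use main in blast)
  qed simp
  have MF: "M + F 0 = euler_mascheroni" using l1 l2 by simp
  have "(\<lambda>n. \<Sum>p\<in>primes_le n. \<phi> (real p powr (-1-0))) \<longlonglongrightarrow> F 0"
    unfolding F_def a_def by (rule tendsto_sum_primes_le) (use asum[of 0] in \<open>simp add: a_def\<close>)
  hence "(\<lambda>n. ((\<Sum>p\<in>primes_le n. 1 / real p) - ln (ln (real n))) + (\<Sum>p\<in>primes_le n. \<phi> (real p powr (-1-0)))) \<longlonglongrightarrow> euler_mascheroni"
    unfolding MF[symmetric] by (intro tendsto_add M)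
  moreover have "((\<Sum>p\<in>primes_le n. 1 / real p) - ln (ln (real n))) + (\<Sum>p\<in>primes_le n. \<phi> (real p powr (-1-0))) =
    (\<Sum>p\<in>primes_le n. - ln (1 - 1 / real p)) - ln (ln (real n))" for n
    by (simp add: \<phi>_def powr_minus inverse_eq_divide sum_subtractf)
  ultimately show ?thesis by (simp only:)
qed

section \<open>Mertens' third theorem for both signs\<close>

lemma mertens_third_minus:
  "(\<lambda>n. (\<Prod>p\<in>primes_le n. 1 / (1 - 1 / real p)) / ln (real n)) \<longlonglongrightarrow> exp euler_mascheroni"
proof -
  have "(\<lambda>n. exp ((\<Sum>p\<in>primes_le n. - ln (1 - 1 / real p)) - ln (ln (real n)))) \<longlonglongrightarrow> exp euler_mascheroni"
    by (intro tendsto_intros mertens_constant)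
  moreover have "eventually (\<lambda>n. exp ((\<Sum>p\<in>primes_le n. - ln (1 - 1 / real p)) - ln (ln (real n)))
      = (\<Prod>p\<in>primes_le n. 1 / (1 - 1 / real p)) / ln (real n)) sequentially"
    using eventually_gt_at_top[of 1]
  proof eventually_elim
    case (elim n)
    have "exp (- ln (1 - 1 / real p)) = 1 / (1 - 1 / real p)" if "p \<in> primes_le n" for p
    proof -
      have "real p > 1" using that by (auto simp: primes_le_def dest: prime_gt_1_nat)
      thus ?thesis by (simp add: exp_minus inverse_eq_divide)
    qed
    thus ?case using elim by (simp add: exp_diff exp_sum)
  qed
  ultimately show ?thesis using tendsto_cong by force
qed

text \<open>The Euler product at 2 inverts \<open>\<zeta>(2) = \<pi>^2/6\<close>.\<close>

lemma prod_one_minus_prime_square: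
  "(\<lambda>n. \<Prod>p\<in>primes_le n. 1 - 1 / (real p)^2) \<longlonglongrightarrow> 6 / pi^2"
proof -
  have s: "(\<lambda>n. 1 / (real n)^2) sums (pi^2 / 6)"
    using inverse_squares_sums sums_Suc_iff[of "\<lambda>n. 1 / (real n)^2" "pi^2 / 6"] by simp
  hence "(\<lambda>n. \<Prod>p\<in>primes_le n. 1 - 1 / (real p)^2) \<longlonglongrightarrow> 1 / (\<Sum>n. 1 / (real n)^2)"
    by (intro euler_product) (auto simp: power_mult_distrib sums_iff)
  thus ?thesis unfolding sums_unique[OF s, symmetric] by simp
qed

text \<open>From \<open>1 + 1/p = (1 - 1/p^2) / (1 - 1/p)\<close>; this is the origin of the factor
  \<open>6/\<pi>^2\<close> in the final constant.\<close>

lemma mertens_third_plus: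
  "(\<lambda>n. (\<Prod>p\<in>primes_le n. 1 + 1 / real p) / ln (real n)) \<longlonglongrightarrow> 6 / pi^2 * exp euler_mascheroni"
proof -
  have "(\<Prod>p\<in>primes_le n. 1 + 1 / real p) = (\<Prod>p\<in>primes_le n. 1 - 1 / (real p)^2) * (\<Prod>p\<in>primes_le n. 1 / (1 - 1 / real p))" for n
    unfolding prod.distrib[symmetric]
  proof (rule prod.cong)
    fix p assume "p \<in> primes_le n"
    hence "real p > 1" by (auto simp: primes_le_def dest: prime_gt_1_nat)
    thus "1 + 1 / real p = (1 - 1 / (real p)^2) * (1 / (1 - 1 / real p))"
      by (simp add: field_simps power2_eq_square)
  qed simp
  thus ?thesis using tendsto_mult[OF prod_one_minus_prime_square mertens_third_minus] by simp
qed

section \<open>The upper bound\<close>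

definition psi_ratio :: "nat \<Rightarrow> real" where
  "psi_ratio n = (\<Prod>p\<in>prime_factors n. 1 + 1 / real p)"

text \<open>This is \<open>n / \<phi>(n)\<close> rather than its reciprocal, so that both ratios are
  products of factors above 1 and grow with the set of prime divisors.\<close>

definition phi_ratio :: "nat \<Rightarrow> real" where
  "phi_ratio n = (\<Prod>p\<in>prime_factors n. 1 / (1 - 1 / real p))"

text \<open>The \<open>div\<close> in the definition is exact, because the product of the primes
  dividing \<open>n\<close> divides \<open>n\<close>.\<close>

lemma dedekind_psi_eq: "real (dedekind_psi n) = real n * psi_ratio n"
proof (cases "n = 0")
  case False
  have "(\<Prod>p\<in>prime_factors n. p) dvd n"
    by (rule prod_primes_dvd) auto
  hence dvd: "(\<Prod>p\<in>prime_factors n. p) dvd n * (\<Prod>p\<in>prime_factors n. p + 1)" by simp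
  have "real (dedekind_psi n) = real (n * (\<Prod>p\<in>prime_factors n. p + 1)) / real (\<Prod>p\<in>prime_factors n. p)"
    unfolding dedekind_psi_def by (rule real_of_nat_div[OF dvd])
  also have "\<dots> = real n * ((\<Prod>p\<in>prime_factors n. real (p + 1)) / (\<Prod>p\<in>prime_factors n. real p))" by simp
  also have "(\<Prod>p\<in>prime_factors n. real (p + 1)) / (\<Prod>p\<in>prime_factors n. real p) = psi_ratio n"
    unfolding psi_ratio_def prod_dividef[symmetric]
    by (intro prod.cong) (auto simp: field_simps in_prime_factors_iff dest: prime_gt_0_nat)
  finally show ?thesis .
qed (simp add: dedekind_psi_def)

lemma phi_ratio_pos: "phi_ratio n > 0"
  unfolding phi_ratio_def by (intro prod_pos) (auto simp: in_prime_factors_iff dest: prime_gt_1_nat)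

lemma psi_ratio_ge_1: "psi_ratio n \<ge> 1"
  unfolding psi_ratio_def by (intro prod_ge_1) auto

lemma totient_eq: "real (totient n) = real n / phi_ratio n"
proof -
  have "real (totient n) = real n * (\<Prod>p\<in>prime_factors n. 1 - 1 / real p)" by (rule totient_formula2)
  also have "(\<Prod>p\<in>prime_factors n. 1 - 1 / real p) = 1 / phi_ratio n"
    by (simp add: phi_ratio_def prod_dividef)
  finally show ?thesis by simp
qed

lemma I_ratio_eq:
  assumes "n > 0"
  shows "I_ratio n = psi_ratio (totient n) * phi_ratio (dedekind_psi n) / (phi_ratio n * psi_ratio n)"
proof -
  have "psi_ratio n > 0" "phi_ratio n > 0" "phi_ratio (dedekind_psi n) > 0"
    using psi_ratio_ge_1[of n] phi_ratio_pos by auto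
  thus ?thesis using assms by (simp add: I_ratio_def dedekind_psi_eq totient_eq field_simps)
qed

lemma dedekind_psi_ge: "dedekind_psi n \<ge> n"
proof -
  have "real n * 1 \<le> real n * psi_ratio n" by (intro mult_left_mono psi_ratio_ge_1) auto
  thus ?thesis by (simp flip: dedekind_psi_eq)
qed

text \<open>Crude but sufficient: only \<open>ln ln\<close> of the bound matters, and squaring
  \<open>n\<close> adds just \<open>ln 2\<close> to \<open>ln ln n\<close>.\<close>

lemma dedekind_psi_le: "dedekind_psi n \<le> n^2"
proof (cases "n = 0")
  case False
  have "psi_ratio n \<le> (\<Prod>p\<in>prime_factors n. real p)"
    unfolding psi_ratio_def
  proof (intro prod_mono conjI)
    fix p assume "p \<in> prime_factors n"
    hence p: "real p \<ge> 2" by (auto simp: in_prime_factors_iff dest: prime_ge_2_nat)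
    hence "1 / real p \<le> 1" by simp
    thus "1 + 1 / real p \<le> real p" using p by linarith
  qed auto
  also have "\<dots> = real (\<Prod>p\<in>prime_factors n. p)" by simp
  also have "(\<Prod>p\<in>prime_factors n. p) \<le> n"
    by (intro dvd_imp_le prod_primes_dvd) (use False in auto)
  finally have "real n * psi_ratio n \<le> real n * real n" by (intro mult_left_mono) auto
  hence "real (dedekind_psi n) \<le> real (n^2)" by (simp add: dedekind_psi_eq power2_eq_square)
  thus ?thesis by linarith
qed (simp add: dedekind_psi_def)

section \<open>Products over the prime divisors of a bounded integer\<close>

text \<open>Primes above \<open>L = ln n\<close> hardly matter: at most \<open>L / ln L\<close> of
  them divide \<open>m\<close>, since their product is at most \<open>n\<close>, and together they
  contribute about \<open>exp (1 / ln L)\<close>. The smaller ones are bounded by the full product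
  over primes up to \<open>L\<close>.\<close>

lemma prod_prime_factors_le:
  fixes f :: "nat \<Rightarrow> real"
  assumes f: "\<And>p. prime p \<Longrightarrow> 1 \<le> f p \<and> f p \<le> 1 / (1 - 1 / real p)"
    and n: "1 < ln (real n)" and m: "m \<ge> 1" "m \<le> n"
  shows "(\<Prod>p\<in>prime_factors m. f p) \<le>
    (\<Prod>p\<in>primes_le (nat \<lfloor>ln (real n)\<rfloor>). f p) * (1 / (1 - 1 / ln (real n))) powr (ln (real n) / ln (ln (real n)))"
proof -
  define L where "L = ln (real n)"
  have L: "L > 1" using n by (simp add: L_def)
  define A where "A = prime_factors m \<inter> primes_le (nat \<lfloor>L\<rfloor>)"
  define C where "C = prime_factors m - primes_le (nat \<lfloor>L\<rfloor>)"
  have C: "prime p" "real p > L" if "p \<in> C" for p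
  proof -
    show "prime p" using that by (auto simp: C_def)
    hence "\<not> p \<le> nat \<lfloor>L\<rfloor>" using that by (auto simp: C_def primes_le_def)
    thus "real p > L" using L by (simp add: le_nat_iff le_floor_iff)
  qed
  have split: "prime_factors m = A \<union> C" "A \<inter> C = {}" "finite A" "finite C" by (auto simp: A_def C_def)
  have f0: "f p \<ge> 1" "f p \<ge> 0" if "prime p" for p using f[OF that] by auto
  have 1: "(\<Prod>p\<in>A. f p) \<le> (\<Prod>p\<in>primes_le (nat \<lfloor>L\<rfloor>). f p)"
    by (rule prod_mono2) (auto simp: A_def primes_le_def f0)
  have "(\<Prod>p\<in>C. L) \<le> (\<Prod>p\<in>C. real p)"
    by (intro prod_mono) (use C L in \<open>auto intro: less_imp_le\<close>)
  also have "\<dots> = real (\<Prod>C)" by simp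
  also have "\<Prod>C \<le> m" by (intro dvd_imp_le prod_primes_dvd) (use m in \<open>auto simp: C_def\<close>)
  also have "real m \<le> real n" using m by simp
  finally have "L ^ card C \<le> real n" by simp
  hence "ln (L ^ card C) \<le> ln (real n)" using L by (intro ln_mono) auto
  hence "real (card C) * ln L \<le> L" using L by (simp add: ln_realpow L_def)
  hence card: "real (card C) \<le> L / ln L" using L by (simp add: field_simps)
  have b: "1 / (1 - 1 / L) \<ge> 1" using L by (simp add: field_simps)
  have "(\<Prod>p\<in>C. f p) \<le> (\<Prod>p\<in>C. 1 / (1 - 1 / L))"
  proof (intro prod_mono conjI)
    fix p assume p: "p \<in> C"
    show "0 \<le> f p" using f0 C(1)[OF p] by auto
    have "f p \<le> 1 / (1 - 1 / real p)" using f C(1)[OF p] by auto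
    also have "\<dots> \<le> 1 / (1 - 1 / L)"
      using C(2)[OF p] L by (intro divide_left_mono diff_left_mono mult_pos_pos) auto
    finally show "f p \<le> 1 / (1 - 1 / L)" .
  qed
  also have "\<dots> = (1 / (1 - 1 / L)) powr real (card C)"
  proof -
    have "0 < 1 / (1 - 1 / L)" using b by linarith
    thus ?thesis by (simp only: powr_realpow prod_constant)
  qed
  also have "\<dots> \<le> (1 / (1 - 1 / L)) powr (L / ln L)" using b card by (intro powr_mono) auto
  finally have 2: "(\<Prod>p\<in>C. f p) \<le> (1 / (1 - 1 / L)) powr (L / ln L)" .
  have "(\<Prod>p\<in>prime_factors m. f p) = (\<Prod>p\<in>A. f p) * (\<Prod>p\<in>C. f p)"
    using split by (simp add: prod.union_disjoint)
  also have "\<dots> \<le> (\<Prod>p\<in>primes_le (nat \<lfloor>L\<rfloor>). f p) * (1 / (1 - 1 / L)) powr (L / ln L)"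
  proof (intro mult_mono 1 2)
    show "0 \<le> (\<Prod>p\<in>primes_le (nat \<lfloor>L\<rfloor>). f p)"
      by (intro prod_nonneg) (auto simp: primes_le_def f0)
    show "0 \<le> (\<Prod>p\<in>C. f p)" by (intro prod_nonneg) (use f0 C in auto)
  qed
  finally show ?thesis by (simp add: L_def)
qed

text \<open>Uniformity in \<open>m\<close> is the point: the estimate is applied to
  \<open>totient n\<close> and \<open>dedekind_psi n\<close>, while the bound refers to
  \<open>n\<close> or \<open>n^2\<close>.\<close>

lemma prod_prime_factors_eventually_le:
  fixes f :: "nat \<Rightarrow> real"
  assumes f: "\<And>p. prime p \<Longrightarrow> 1 \<le> f p \<and> f p \<le> 1 / (1 - 1 / real p)"
    and lim: "(\<lambda>n. (\<Prod>p\<in>primes_le n. f p) / ln (real n)) \<longlonglongrightarrow> c" and d: "d > c"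
  shows "eventually (\<lambda>n. \<forall>m\<in>{1..n}. (\<Prod>p\<in>prime_factors m. f p) \<le> d * ln (ln (real n))) sequentially"
proof -
  define k where "k n = nat \<lfloor>ln (real n)\<rfloor>" for n
  have k: "real (k n) \<le> ln (real n)" "ln (real n) - 1 \<le> real (k n)" if "n \<ge> 1" for n
    using that by (auto simp: k_def)
  have ktop: "filterlim k at_top sequentially"
  proof -
    have "filterlim (\<lambda>n. ln (real n) - 1) at_top sequentially" by real_asymp
    hence "filterlim (\<lambda>n. real (k n)) at_top sequentially"
      by (rule filterlim_at_top_mono) (use k in \<open>auto intro!: eventually_sequentiallyI[of 1]\<close>)
    thus ?thesis by (simp add: filterlim_sequentially_iff_filterlim_real)
  qed
  have kl: "(\<lambda>n. ln (real (k n)) / ln (ln (real n))) \<longlonglongrightarrow> 1"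
  proof (rule tendsto_sandwich)
    show "(\<lambda>n. ln (ln (real n) - 1) / ln (ln (real n))) \<longlonglongrightarrow> 1" by real_asymp
    have "eventually (\<lambda>n. ln (real n) > 3) sequentially" by real_asymp
    hence "eventually (\<lambda>n. ln (ln (real n) - 1) / ln (ln (real n)) \<le> ln (real (k n)) / ln (ln (real n))
       \<and> ln (real (k n)) / ln (ln (real n)) \<le> 1) sequentially"
      using eventually_ge_at_top[of 1]
    proof eventually_elim
      case (elim n)
      have "ln (ln (real n)) > 0" by (intro ln_gt_zero) (use elim in linarith)
      moreover have "ln (ln (real n) - 1) \<le> ln (real (k n))" using k[of n] elim by (intro ln_mono) linarith+
      moreover have "ln (real (k n)) \<le> ln (ln (real n))" using k[of n] elim by (intro ln_mono) linarith+
      ultimately show ?case by (auto intro!: divide_right_mono simp: divide_le_eq_1)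
    qed
    note ev = this
    show "eventually (\<lambda>n. ln (ln (real n) - 1) / ln (ln (real n)) \<le> ln (real (k n)) / ln (ln (real n))) sequentially"
      using ev by eventually_elim (rule conjunct1)
    show "eventually (\<lambda>n. ln (real (k n)) / ln (ln (real n)) \<le> 1) sequentially"
      using ev by eventually_elim (rule conjunct2)
  qed simp
  have pw: "(\<lambda>n. (1 / (1 - 1 / ln (real n))) powr (ln (real n) / ln (ln (real n)))) \<longlonglongrightarrow> 1"
  proof (rule filterlim_compose[where g = "\<lambda>L. (1 / (1 - 1 / L)) powr (L / ln L)"])
    show "((\<lambda>L::real. (1 / (1 - 1 / L)) powr (L / ln L)) \<longlongrightarrow> 1) at_top" by real_asymp
    show "filterlim (\<lambda>n. ln (real n)) at_top sequentially" by real_asymp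
  qed
  have "(\<lambda>n. (\<Prod>p\<in>primes_le (k n). f p) / ln (real (k n)) * (ln (real (k n)) / ln (ln (real n))) *
     (1 / (1 - 1 / ln (real n))) powr (ln (real n) / ln (ln (real n)))) \<longlonglongrightarrow> c * 1 * 1"
    by (intro tendsto_mult kl pw filterlim_compose[OF lim ktop])
  hence "eventually (\<lambda>n. (\<Prod>p\<in>primes_le (k n). f p) / ln (real (k n)) * (ln (real (k n)) / ln (ln (real n))) *
     (1 / (1 - 1 / ln (real n))) powr (ln (real n) / ln (ln (real n))) < d) sequentially"
    using d by (intro order_tendstoD) auto
  moreover have "eventually (\<lambda>n. ln (real n) > 3) sequentially" by real_asymp
  ultimately show ?thesis using eventually_ge_at_top[of 1]
  proof eventually_elim
    case (elim n)
    let ?P = "\<Prod>p\<in>primes_le (k n). f p" and ?w = "(1 / (1 - 1 / ln (real n))) powr (ln (real n) / ln (ln (real n)))"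
    have "ln (ln (real n)) > 0" by (intro ln_gt_zero) (use elim in linarith)
    moreover have "real (k n) > 1" using k[of n] elim by linarith
    ultimately have "?P * ?w \<le> d * ln (ln (real n))" using elim by (simp add: field_simps)
    thus ?case using prod_prime_factors_le[OF f, of n] elim unfolding k_def by fastforce
  qed
qed

lemma psi_ratio_eventually_le:
  assumes "d > 6 / pi^2 * exp euler_mascheroni"
  shows "eventually (\<lambda>n. \<forall>m\<in>{1..n}. psi_ratio m \<le> d * ln (ln (real n))) sequentially"
  unfolding psi_ratio_def
proof (rule prod_prime_factors_eventually_le[OF _ mertens_third_plus assms])
  fix p :: nat assume "prime p"
  hence "real p \<ge> 2" using prime_ge_2_nat by simp
  thus "1 \<le> 1 + 1 / real p \<and> 1 + 1 / real p \<le> 1 / (1 - 1 / real p)" by (simp add: field_simps)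
qed

lemma phi_ratio_eventually_le:
  assumes "d > exp euler_mascheroni"
  shows "eventually (\<lambda>n. \<forall>m\<in>{1..n}. phi_ratio m \<le> d * ln (ln (real n))) sequentially"
  unfolding phi_ratio_def
proof (rule prod_prime_factors_eventually_le[OF _ mertens_third_minus assms])
  fix p :: nat assume "prime p"
  hence "real p \<ge> 2" using prime_ge_2_nat by simp
  thus "1 \<le> 1 / (1 - 1 / real p) \<and> 1 / (1 - 1 / real p) \<le> 1 / (1 - 1 / real p)" by (simp add: field_simps)
qed

lemma phi_ratio_ge_1: "phi_ratio n \<ge> 1"
  unfolding phi_ratio_def
proof (intro prod_ge_1)
  fix p assume "p \<in> prime_factors n"
  hence "real p \<ge> 2" by (auto simp: in_prime_factors_iff dest: prime_ge_2_nat)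
  thus "1 \<le> 1 / (1 - 1 / real p)" by (simp add: field_simps)
qed

lemma I_ratio_eventually_le:
  assumes d1: "d1 > 6 / pi^2 * exp euler_mascheroni" and d2: "d2 > exp euler_mascheroni"
  shows "eventually (\<lambda>n. I_ratio n \<le> d1 * d2 * ln (ln (real n)) * ln (2 * ln (real n))) sequentially"
proof -
  have pos: "d1 > 0" "d2 > 0"
  proof -
    have "0 < 6 / pi^2 * exp (euler_mascheroni::real)" "0 < exp (euler_mascheroni::real)" by simp_all
    thus "d1 > 0" "d2 > 0" using d1 d2 by linarith+
  qed
  \<comment> \<open>\<open>dedekind_psi n\<close> may exceed \<open>n\<close>, so the bound for
    \<open>phi_ratio\<close> is used at \<open>n^2\<close>; this produces
    \<open>ln (2 * ln n)\<close>.\<close>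
  have "filterlim (\<lambda>n::nat. n^2) at_top sequentially"
    by (rule filterlim_at_top_mono[OF filterlim_ident]) (simp add: power2_nat_le_imp_le power2_eq_square)
  from eventually_compose_filterlim[OF phi_ratio_eventually_le[OF d2] this]
  have "eventually (\<lambda>n. \<forall>m\<in>{1..n^2}. phi_ratio m \<le> d2 * ln (ln (real (n^2)))) sequentially" .
  moreover have "eventually (\<lambda>n. ln (real n) > 3) sequentially" by real_asymp
  ultimately show ?thesis using psi_ratio_eventually_le[OF d1] eventually_ge_at_top[of 1]
  proof eventually_elim
    case (elim n)
    have n: "n > 0" using elim by simp
    have 1: "psi_ratio (totient n) \<le> d1 * ln (ln (real n))"
      using elim n by (auto simp: totient_le Suc_le_eq)
    have "phi_ratio (dedekind_psi n) \<le> d2 * ln (ln (real (n^2)))"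
      using elim(1) n dedekind_psi_le[of n] dedekind_psi_ge[of n] by auto
    also have "ln (real (n^2)) = 2 * ln (real n)" using n by (simp add: ln_realpow)
    finally have 2: "phi_ratio (dedekind_psi n) \<le> d2 * ln (2 * ln (real n))" .
    have "phi_ratio n * psi_ratio n \<ge> 1 * 1"
      by (intro mult_mono phi_ratio_ge_1 psi_ratio_ge_1) (use phi_ratio_pos[of n] in auto)
    moreover have "phi_ratio n > 0" "psi_ratio n > 0" using phi_ratio_pos[of n] psi_ratio_ge_1[of n] by auto
    ultimately have "I_ratio n \<le> psi_ratio (totient n) * phi_ratio (dedekind_psi n) / 1"
      unfolding I_ratio_eq[OF n] using psi_ratio_ge_1[of "totient n"] phi_ratio_pos[of "dedekind_psi n"]
      by (intro divide_left_mono mult_nonneg_nonneg mult_pos_pos) auto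
    also have "\<dots> \<le> (d1 * ln (ln (real n))) * (d2 * ln (2 * ln (real n)))"
      using 1 2 pos elim phi_ratio_pos[of "dedekind_psi n"] by (simp only: div_by_1, intro mult_mono) auto
    finally show ?case by (simp add: mult_ac)
  qed
qed

lemma I_ratio_upper:
  assumes "e > 0"
  shows "eventually (\<lambda>n. I_ratio n / (ln (ln (real n)))^2 \<le> 6 / pi^2 * exp (2 * euler_mascheroni) + e) sequentially"
proof -
  define c1 :: real where "c1 = 6 / pi^2 * exp euler_mascheroni"
  define c2 :: real where "c2 = exp euler_mascheroni"
  have c12: "6 / pi^2 * exp (2 * euler_mascheroni) = c1 * c2"
    unfolding c1_def c2_def mult_2 exp_add by (simp only: mult.assoc)
  \<comment> \<open>Both Mertens constants are enlarged by a margin \<open>t\<close>, small enough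
    that their product stays below the target plus \<open>e\<close>.\<close>
  have "((\<lambda>t. (c1 + t) * (c2 + t)) \<longlongrightarrow> (c1 + 0) * (c2 + 0)) (at_right 0)" by (intro tendsto_intros)
  hence "eventually (\<lambda>t. (c1 + t) * (c2 + t) < c1 * c2 + e) (at_right 0)"
    using assms by (intro order_tendstoD) auto
  moreover have "eventually (\<lambda>t::real. t > 0) (at_right 0)" by (simp add: eventually_at_right_less)
  ultimately have "eventually (\<lambda>t. t > 0 \<and> (c1 + t) * (c2 + t) < c1 * c2 + e) (at_right 0)"
    by eventually_elim auto
  then obtain t where t: "t > 0" "(c1 + t) * (c2 + t) < c1 * c2 + e"
    using eventually_happens' trivial_limit_at_right_real by blast
  have "(\<lambda>n. ln (2 * ln (real n)) / ln (ln (real n))) \<longlonglongrightarrow> 1" by real_asymp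
  from tendsto_mult[OF tendsto_const[of "(c1 + t) * (c2 + t)"] this]
  have "eventually (\<lambda>n. (c1 + t) * (c2 + t) * (ln (2 * ln (real n)) / ln (ln (real n))) < c1 * c2 + e) sequentially"
    using t by (intro order_tendstoD) auto
  moreover have "eventually (\<lambda>n. I_ratio n \<le> (c1 + t) * (c2 + t) * ln (ln (real n)) * ln (2 * ln (real n))) sequentially"
    by (rule I_ratio_eventually_le) (use t in \<open>auto simp: c1_def c2_def\<close>)
  moreover have "eventually (\<lambda>n. ln (real n) > 3) sequentially" by real_asymp
  ultimately show ?thesis unfolding c12
  proof eventually_elim
    case (elim n)
    have l: "ln (ln (real n)) > 0" by (intro ln_gt_zero) (use elim in linarith)
    have "I_ratio n / (ln (ln (real n)))^2 \<le> (c1 + t) * (c2 + t) * ln (ln (real n)) * ln (2 * ln (real n)) / (ln (ln (real n)))^2"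
      using elim by (intro divide_right_mono) auto
    also have "\<dots> = (c1 + t) * (c2 + t) * (ln (2 * ln (real n)) / ln (ln (real n)))"
      using l by (simp add: power2_eq_square)
    finally show ?case using elim by linarith
  qed
qed

section \<open>Primes congruent to 1 and -1 modulo a given prime\<close>

lemma prod_primes_le_dvd:
  assumes "prime p" "p \<le> y" shows "p dvd \<Prod>(primes_le y)"
  using assms by (intro dvd_prodI) (auto simp: primes_le_def)

text \<open>With \<open>a\<close> the product of the primes up to \<open>y\<close>,
  \<open>N = (a^q - 1)/(a - 1)\<close> is 1 modulo \<open>a\<close>, so its prime factors exceed
  \<open>y\<close>. For such a factor \<open>p\<close> the order of \<open>a\<close> divides
  \<open>q\<close>, and it is not 1, since then \<open>N \<equiv> q\<close> would force
  \<open>p dvd q\<close>. Hence \<open>q\<close> divides \<open>p - 1\<close>.\<close>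

lemma exists_prime_cong_1:
  assumes q: "prime q" "q \<le> y"
  shows "\<exists>p. prime p \<and> p > y \<and> q dvd p - 1 \<and> p \<le> 4 ^ ((y + 1) * q)"
proof -
  define a where "a = \<Prod>(primes_le y)"
  define N where "N = (\<Sum>i<q. a ^ i)"
  have q2: "q \<ge> 2" using q prime_ge_2_nat by blast
  have "2 dvd a" unfolding a_def using q q2 by (intro prod_primes_le_dvd) auto
  moreover have "a > 0" by (auto simp: a_def primes_le_def intro!: prod_pos dest: prime_gt_0_nat)
  ultimately have a2: "a \<ge> 2" by (meson dvd_imp_le)
  obtain r where r: "q = Suc (Suc r)" using q2 by (metis Suc_le_D numeral_2_eq_2 Suc_le_mono)
  have N1: "N = 1 + a * (\<Sum>i<Suc r. a ^ i)"
    unfolding N_def r by (subst sum.lessThan_Suc_shift) (simp add: sum_distrib_left distrib_left)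
  have "N \<noteq> 1" using N1 a2 by simp
  then obtain p where p: "prime p" "p dvd N" using prime_factor_nat by blast
  have na: "\<not> p dvd a"
  proof
    assume "p dvd a"
    hence "p dvd 1" using p N1 by (metis dvd_add_left_iff dvd_mult2)
    thus False using p by auto
  qed
  have py: "p > y" using na prod_primes_le_dvd[OF p(1), of y] unfolding a_def by fastforce
  have geo: "a ^ q = (a - 1) * N + 1"
  proof -
    have "int a ^ q - 1 = (int a - 1) * (\<Sum>i<q. int a ^ i)" by (rule power_diff_1_eq)
    hence "int (a ^ q) = int ((a - 1) * N + 1)" using a2 by (simp add: N_def of_nat_diff)
    thus ?thesis by linarith
  qed
  have "[a ^ q = 0 + 1] (mod p)" unfolding geo by (intro cong_add) (use p in \<open>auto simp: cong_0_iff\<close>)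
  hence "ord p a dvd q" by (simp add: ord_divides')
  hence "ord p a = 1 \<or> ord p a = q" using q by (metis prime_nat_iff)
  moreover have "ord p a \<noteq> 1"
  proof
    assume "ord p a = 1"
    hence "[a ^ 1 = 1] (mod p)" by (simp only: ord_divides) simp
    hence "[a ^ i = 1] (mod p)" for i using cong_pow[of a 1 p i] by simp
    hence "[N = (\<Sum>i<q. 1)] (mod p)" unfolding N_def by (intro cong_sum) auto
    hence "[q = 0] (mod p)" using p by (simp add: cong_0_iff cong_dvd_iff)
    hence "p dvd q" by (simp add: cong_0_iff)
    thus False using q p py by (metis dvd_imp_le le_trans not_less prime_gt_0_nat)
  qed
  ultimately have "q dvd totient p"
    using order_divides_totient[of p a] na p by (auto simp: prime_imp_coprime)
  hence 1: "q dvd p - 1" using p by (simp add: totient_prime)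
  have "p \<le> N" using p N1 by (intro dvd_imp_le) auto
  also have "1 * N \<le> (a - 1) * N" using a2 by (intro mult_right_mono) auto
  hence "N \<le> (a - 1) * N + 1" by linarith
  also have "\<dots> = a ^ q" by (rule geo[symmetric])
  \<comment> \<open>The exponent \<open>y + 1\<close> gives the bound the same form as in the case
    of -1, where \<open>a + D\<close> has to be bounded.\<close>
  also have "\<dots> \<le> (4 ^ (y + 1)) ^ q"
    using primorial_le[of y] unfolding a_def by (intro power_mono) auto
  finally have "p \<le> 4 ^ ((y + 1) * q)" by (simp only: power_mult)
  thus ?thesis using p py 1 by blast
qed

section \<open>Powers of a + sqrt D modulo a prime\<close>

text \<open>With \<open>E\<close> the shift of sequences, this is the value at 0 of
  \<open>(a + E)^n w\<close>. Taking for \<open>w\<close> the powers of \<open>\<surd>D\<close>,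
  split by parity, gives the binomial expansion of \<open>(a + \<surd>D)^n\<close> within the
  integers.\<close>

definition binom_apply :: "int \<Rightarrow> (nat \<Rightarrow> int) \<Rightarrow> nat \<Rightarrow> int" where
  "binom_apply a w n = (\<Sum>j\<le>n. of_nat (n choose j) * a ^ (n - j) * w j)"

lemma binom_apply_Suc:
  "binom_apply a w (Suc n) = a * binom_apply a w n + binom_apply a (\<lambda>j. w (Suc j)) n"
proof -
  have "binom_apply a w (Suc n) = a ^ Suc n * w 0 + (\<Sum>j\<le>n. of_nat (Suc n choose Suc j) * a ^ (n - j) * w (Suc j))"
    unfolding binom_apply_def by (subst sum.atMost_Suc_shift) simp
  also have "(\<Sum>j\<le>n. of_nat (Suc n choose Suc j) * a ^ (n - j) * w (Suc j)) =
    binom_apply a (\<lambda>j. w (Suc j)) n + (\<Sum>j\<le>n. of_nat (n choose Suc j) * a ^ (n - j) * w (Suc j))"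
    unfolding binom_apply_def by (simp add: sum.distrib algebra_simps)
  also have "a ^ Suc n * w 0 + (binom_apply a (\<lambda>j. w (Suc j)) n + (\<Sum>j\<le>n. of_nat (n choose Suc j) * a ^ (n - j) * w (Suc j)))
     = binom_apply a (\<lambda>j. w (Suc j)) n + (\<Sum>j\<le>Suc n. of_nat (n choose j) * a ^ (Suc n - j) * w j)"
    by (subst sum.atMost_Suc_shift) simp
  also have "(\<Sum>j\<le>Suc n. of_nat (n choose j) * a ^ (Suc n - j) * w j) = a * binom_apply a w n"
    unfolding binom_apply_def by (simp add: sum_distrib_left Suc_diff_le mult_ac)
  finally show ?thesis by simp
qed

lemma binom_apply_cmult: "binom_apply a (\<lambda>j. c * w j) n = c * binom_apply a w n"
  by (simp add: binom_apply_def sum_distrib_left mult_ac)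

text \<open>The Frobenius identity: \<open>p\<close> divides the inner binomial
  coefficients.\<close>

lemma binom_apply_prime:
  assumes "prime p"
  shows "[binom_apply a w p = a ^ p * w 0 + w p] (mod int p)"
proof -
  have p: "p > 0" using assms prime_gt_0_nat by blast
  have "binom_apply a w p = (\<Sum>j\<in>{0,p}. of_nat (p choose j) * a ^ (p - j) * w j)
      + (\<Sum>j\<in>{..p} - {0,p}. of_nat (p choose j) * a ^ (p - j) * w j)"
    unfolding binom_apply_def by (subst add.commute, rule sum.subset_diff) auto
  also have "[\<dots> = (\<Sum>j\<in>{0,p}. of_nat (p choose j) * a ^ (p - j) * w j) + (\<Sum>j\<in>{..p} - {0,p}. 0)] (mod int p)"
  proof (intro cong_add cong_refl cong_sum)
    fix j assume j: "j \<in> {..p} - {0,p}"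
    hence "p dvd (p choose j)" using assms by (intro dvd_choose_prime) auto
    thus "[of_nat (p choose j) * a ^ (p - j) * w j = 0] (mod int p)" by (simp add: cong_0_iff)
  qed
  finally show ?thesis using p by simp
qed

text \<open>\<open>lucas_v a D n\<close> and \<open>lucas_u a D n\<close> are the coordinates of \<open>(a + \<surd>D)\<^sup>n\<close>.\<close>
fun lucas_v :: "int \<Rightarrow> int \<Rightarrow> nat \<Rightarrow> int" and lucas_u :: "int \<Rightarrow> int \<Rightarrow> nat \<Rightarrow> int" where
  "lucas_v a D 0 = 1"
| "lucas_v a D (Suc n) = a * lucas_v a D n + D * lucas_u a D n"
| "lucas_u a D 0 = 0"
| "lucas_u a D (Suc n) = lucas_v a D n + a * lucas_u a D n"

lemma lucas_binom:
  "lucas_v a D n = binom_apply a (\<lambda>j. if even j then D ^ (j div 2) else 0) n"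
  "lucas_u a D n = binom_apply a (\<lambda>j. if odd j then D ^ (j div 2) else 0) n"
proof (induction n)
  case 0
  { case 1 show ?case by (simp add: binom_apply_def) }
  { case 2 show ?case by (simp add: binom_apply_def) }
next
  case (Suc n)
  have e: "(\<lambda>j. if even (Suc j) then D ^ (Suc j div 2) else 0) = (\<lambda>j. D * (if odd j then D ^ (j div 2) else 0))"
    by (auto simp: fun_eq_iff elim!: oddE)
  have o: "(\<lambda>j. if odd (Suc j) then D ^ (Suc j div 2) else 0) = (\<lambda>j. if even j then D ^ (j div 2) else 0)"
    by (auto simp: fun_eq_iff elim!: evenE)
  { case 1 show ?case unfolding binom_apply_Suc e binom_apply_cmult using Suc.IH by simp }
  { case 2 show ?case unfolding binom_apply_Suc o using Suc.IH by simp }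
qed

lemma lucas_add:
  "lucas_v a D (m + n) = lucas_v a D m * lucas_v a D n + D * lucas_u a D m * lucas_u a D n"
  "lucas_u a D (m + n) = lucas_u a D m * lucas_v a D n + lucas_v a D m * lucas_u a D n"
  by (induction m) (auto simp: algebra_simps)

text \<open>Multiplicativity of the norm, as \<open>a + \<surd>D\<close> has norm
  \<open>a^2 - D\<close>.\<close>

lemma lucas_norm: "(lucas_v a D n)^2 - D * (lucas_u a D n)^2 = (a^2 - D) ^ n"
proof (induction n)
  case (Suc n)
  have "(lucas_v a D (Suc n))^2 - D * (lucas_u a D (Suc n))^2 = (a^2 - D) * ((lucas_v a D n)^2 - D * (lucas_u a D n)^2)"
    by (simp add: algebra_simps power2_eq_square)
  thus ?case using Suc by simp
qed simp

text \<open>If \<open>(a + \<surd>D)^m\<close> is rational modulo \<open>p\<close>, then so are its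
  powers.\<close>

lemma dvd_lucas_u_mult: "p dvd lucas_u a D m \<Longrightarrow> p dvd lucas_u a D (k * m)"
  by (induction k) (auto simp: lucas_add)

lemma lucas_bounds:
  assumes "a \<ge> 0" "D \<ge> 1"
  shows "0 \<le> lucas_v a D n \<and> lucas_v a D n \<le> (a + D) ^ n" "0 \<le> lucas_u a D n \<and> lucas_u a D n \<le> (a + D) ^ n"
proof (induction n)
  case (Suc n)
  { case 1
    have "a * lucas_v a D n + D * lucas_u a D n \<le> a * (a + D) ^ n + D * (a + D) ^ n"
      using Suc.IH assms by (intro add_mono mult_left_mono) auto
    thus ?case using Suc.IH assms by (simp add: algebra_simps) }
  { case 2
    have "1 * lucas_v a D n + a * lucas_u a D n \<le> D * (a + D) ^ n + a * (a + D) ^ n"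
      using Suc.IH assms by (intro add_mono mult_mono) auto
    thus ?case using Suc.IH assms by (simp add: algebra_simps) }
qed auto

text \<open>Modulo \<open>p\<close>, \<open>(a + \<surd>D)^p \<equiv> a^p + (\<surd>D)^p = a^p +
  D^((p-1)/2) \<surd>D\<close>, and \<open>a^p \<equiv> a\<close> by Fermat.\<close>

lemma lucas_prime_index:
  assumes p: "prime p" "p \<noteq> 2"
  shows "[lucas_v a D p = a] (mod int p)" "[lucas_u a D p = D ^ ((p - 1) div 2)] (mod int p)"
proof -
  have odd: "odd p" using p prime_odd_nat[of p] prime_ge_2_nat[of p] by linarith
  have fermat: "[a ^ p = a] (mod int p)"
  proof (cases "int p dvd a")
    case True
    hence "[a = 0] (mod int p)" by (simp add: cong_0_iff)
    hence "[a ^ p = 0 ^ p] (mod int p)" by (rule cong_pow)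
    hence "[a ^ p = 0] (mod int p)" using p prime_gt_0_nat[of p] by (simp add: zero_power)
    thus ?thesis using \<open>[a = 0] (mod int p)\<close> by (metis cong_sym cong_trans)
  next
    case False
    define b where "b = nat (a mod int p)"
    have b: "int b = a mod int p" using p prime_gt_0_nat by (simp add: b_def)
    hence ab: "[a = int b] (mod int p)" by (simp add: cong_def)
    have "\<not> p dvd b" using False ab by (metis cong_dvd_iff cong_sym int_dvd_int_iff cong_0_iff cong_trans)
    hence "[b ^ (p - 1) = 1] (mod p)" using p by (intro fermat_theorem) auto
    hence "[int b ^ (p - 1) = 1] (mod int p)" by (metis cong_int_iff of_nat_1 of_nat_power)
    hence "[a * a ^ (p - 1) = a * 1] (mod int p)" using ab by (intro cong_mult cong_refl) (metis cong_pow cong_trans)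
    thus ?thesis using p prime_gt_0_nat[of p] by (simp add: power_eq_if)
  qed
  show "[lucas_v a D p = a] (mod int p)"
    unfolding lucas_binom using cong_trans[OF binom_apply_prime[OF p(1)]] fermat odd by auto
  have "p div 2 = (p - 1) div 2" using odd by (auto elim: oddE)
  thus "[lucas_u a D p = D ^ ((p - 1) div 2)] (mod int p)"
    unfolding lucas_binom using binom_apply_prime[OF p(1), of a "\<lambda>j. if odd j then D ^ (j div 2) else 0"] odd by simp
qed

section \<open>Quadratic nonresidues, the rank of apparition and the class -1\<close>

lemma half_power_cases:
  fixes D :: nat
  assumes p: "prime p" "p \<noteq> 2" "\<not> p dvd D"
  shows "[int D ^ ((p - 1) div 2) = 1] (mod int p) \<or> [int D ^ ((p - 1) div 2) = -1] (mod int p)"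
proof -
  have odd: "odd p" using p prime_odd_nat[of p] prime_ge_2_nat[of p] by linarith
  have "[D ^ (p - 1) = 1] (mod p)" using p by (intro fermat_theorem) auto
  hence "[int D ^ (p - 1) = 1] (mod int p)" by (metis cong_int_iff of_nat_1 of_nat_power)
  moreover have "int D ^ (p - 1) = (int D ^ ((p - 1) div 2))^2"
    using odd by (simp add: power_mult[symmetric])
  ultimately have "int p dvd (int D ^ ((p - 1) div 2))^2 - 1" by (simp add: cong_iff_dvd_diff)
  also have "(int D ^ ((p - 1) div 2))^2 - 1 = (int D ^ ((p - 1) div 2) - 1) * (int D ^ ((p - 1) div 2) + 1)"
    by (simp add: power2_eq_square algebra_simps)
  finally have "int p dvd int D ^ ((p - 1) div 2) - 1 \<or> int p dvd int D ^ ((p - 1) div 2) + 1"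
    using p by (simp add: prime_dvd_mult_iff)
  thus ?thesis by (auto simp: cong_iff_dvd_diff)
qed

text \<open>A primitive root has order \<open>q - 1\<close>, so its half power is not 1 and must be
  -1. Reducing it below \<open>q\<close> ensures later that no prime from \<open>q\<close> on
  divides \<open>D\<close>.\<close>

lemma exists_half_power_minus_1:
  assumes q: "prime q" "q \<noteq> 2"
  shows "\<exists>D::nat. 0 < D \<and> D < q \<and> [int D ^ ((q - 1) div 2) = -1] (mod int q)"
proof -
  obtain g where g: "residue_primroot q g" using prime_primitive_root_exists[of q] q prime_gt_1_nat[of q] by auto
  define D where "D = g mod q"
  have q3: "q > 2" using q prime_ge_2_nat[of q] by linarith
  have nd: "\<not> q dvd g" using g q by (auto simp: residue_primroot_def coprime_absorb_left)
  have D: "0 < D" "D < q" using nd q3 by (auto simp: D_def dvd_eq_mod_eq_0)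
  have "\<not> [D ^ ((q - 1) div 2) = 1] (mod q)"
  proof
    assume "[D ^ ((q - 1) div 2) = 1] (mod q)"
    hence "[g ^ ((q - 1) div 2) = 1] (mod q)" by (simp add: D_def cong_def power_mod)
    hence "ord q g dvd (q - 1) div 2" by (simp only: ord_divides)
    hence "q - 1 dvd (q - 1) div 2" using g q by (simp add: residue_primroot_def totient_prime)
    moreover have "(q - 1) div 2 > 0" using q3 by simp
    ultimately have "q - 1 \<le> (q - 1) div 2" by (rule dvd_imp_le)
    thus False using q3 by linarith
  qed
  hence "\<not> [int D ^ ((q - 1) div 2) = 1] (mod int q)" by (metis cong_int_iff of_nat_1 of_nat_power)
  moreover have "\<not> q dvd D" using D by (auto dest: dvd_imp_le)
  ultimately show ?thesis using half_power_cases[OF q] D by blast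
qed

text \<open>The rank of apparition of \<open>p\<close> is \<open>q\<close>. Were \<open>m\<close>
  prime to \<open>q\<close>, Bezout would give the consecutive indices \<open>y*q\<close> and
  \<open>y*q + 1\<close> at which \<open>p\<close> divides \<open>lucas_u\<close>; then
  \<open>p\<close> would divide both coordinates at \<open>y*q\<close>, and so the norm there, a
  power of \<open>a^2 - D\<close>.\<close>

lemma dvd_lucas_u_rank:
  fixes p :: nat
  assumes p: "prime p" and q: "prime q" and Q: "\<not> int p dvd a^2 - D"
    and pq: "int p dvd lucas_u a D q" and pm: "int p dvd lucas_u a D m"
  shows "q dvd m"
proof (rule ccontr)
  assume "\<not> q dvd m"
  hence cop: "coprime m q" using q by (metis prime_imp_coprime coprime_commute)
  have "m \<noteq> 0" using \<open>\<not> q dvd m\<close> by (metis dvd_0_right)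
  then obtain x y where xy: "m * x = q * y + 1" using bezout_nat[of m q] cop unfolding coprime_iff_gcd_eq_1 by metis
  have 1: "int p dvd lucas_u a D (y * q + 1)"
    using dvd_lucas_u_mult[OF pm, of x] xy by (simp add: mult.commute)
  have 2: "int p dvd lucas_u a D (y * q)" by (rule dvd_lucas_u_mult[OF pq])
  have "lucas_u a D (y * q + 1) = lucas_v a D (y * q) + a * lucas_u a D (y * q)" by simp
  hence "int p dvd lucas_v a D (y * q)" using 1 2 by (metis dvd_add_left_iff dvd_mult)
  hence "int p dvd (lucas_v a D (y * q))^2 - D * (lucas_u a D (y * q))^2"
    using 2 by (auto simp: power2_eq_square)
  hence "int p dvd (a^2 - D) ^ (y * q)" by (simp only: lucas_norm)
  thus False using Q p by (metis prime_dvd_power prime_nat_int_transfer)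
qed

lemma cong_1_if_prime_divisors_cong_1:
  fixes n q :: nat
  assumes "n > 0" "\<And>p. prime p \<Longrightarrow> p dvd n \<Longrightarrow> [p = 1] (mod q)"
  shows "[n = 1] (mod q)"
  using assms
proof (induction n rule: less_induct)
  case (less n)
  show ?case
  proof (cases "n = 1")
    case False
    then obtain p where p: "prime p" "p dvd n" using prime_factor_nat by blast
    then obtain k where k: "n = p * k" by blast
    have "k < n" "k > 0" using k less.prems p prime_gt_1_nat[of p] by auto
    hence "[k = 1] (mod q)" using less k by auto
    hence "[p * k = 1 * 1] (mod q)" using less.prems(2)[OF p] by (intro cong_mult) auto
    thus ?thesis using k by simp
  qed simp
qed

text \<open>The prime is a factor of \<open>U = lucas_u a D q\<close>, where \<open>D\<close> is a quadratic nonresidue modulo \<open>q\<close>: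
  all prime factors of \<open>U\<close> are \<open>\<plusminus>1\<close> modulo \<open>q\<close>, and \<open>U\<close> itself is \<open>-1\<close> modulo \<open>q\<close>.
  The choice of \<open>a\<close> keeps \<open>U\<close> free of prime factors up to \<open>y\<close>.\<close>
lemma exists_prime_cong_minus_1_odd:
  assumes q: "prime q" "q \<noteq> 2" "q \<le> y"
  shows "\<exists>p. prime p \<and> p > y \<and> q dvd p + 1 \<and> p \<le> 4 ^ ((y + 1) * q)"
proof -
  obtain D where D: "0 < D" "D < q" "[int D ^ ((q - 1) div 2) = -1] (mod int q)"
    using exists_half_power_minus_1[OF q(1,2)] by blast
  have q3: "q \<ge> 3" using q prime_ge_2_nat[of q] by linarith
  \<comment> \<open>Every prime up to \<open>y\<close> divides exactly one of \<open>a\<close> and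
    \<open>D\<close>. If it divides \<open>a\<close>, then \<open>u q \<equiv> D^((q-1)/2)\<close>;
    if it divides \<open>D\<close>, then \<open>u q \<equiv> q * a^(q-1)\<close>. Neither vanishes,
    so it does not divide \<open>u q\<close>.\<close>
  define P where "P = {p \<in> primes_le y. \<not> p dvd D}"
  define a where "a = \<Prod>P"
  have P: "prime p" if "p \<in> P" for p using that by (auto simp: P_def primes_le_def)
  have finP: "finite P" by (simp add: P_def)
  have adiv: "p dvd a \<longleftrightarrow> p \<in> P" if pr: "prime p" for p
  proof
    assume "p \<in> P" thus "p dvd a" unfolding a_def using finP by (intro dvd_prodI)
  next
    assume "p dvd a"
    then obtain r where "r \<in> P" "p dvd r" unfolding a_def using prime_dvd_prod_iff[OF finP pr, of "\<lambda>x. x"] by auto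
    thus "p \<in> P" using pr P by (metis primes_dvd_imp_eq)
  qed
  have "a \<le> \<Prod>(primes_le y)" unfolding a_def
    by (rule dvd_imp_le[OF prod_dvd_prod_subset]) (auto simp: P_def primes_le_def intro!: prod_pos dest: prime_gt_0_nat)
  hence a_le: "a \<le> 4 ^ y" using primorial_le[of y] by linarith
  define u where "u = lucas_u (int a) (int D)"
  define v where "v = lucas_v (int a) (int D)"
  have rec: "v (Suc n) = int a * v n + int D * u n" "u (Suc n) = v n + int a * u n" for n
    by (simp_all add: u_def v_def)
  have u0: "u 0 = 0" "v 0 = 1" by (simp_all add: u_def v_def)
  have Uq: "[u q = -1] (mod int q)"
    using lucas_prime_index(2)[OF q(1,2)] D(3) unfolding u_def by (rule cong_trans)
  have unn: "0 \<le> u q" "u q \<le> (int a + int D) ^ q"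
    using lucas_bounds(2)[of "int a" "int D" q] D unfolding u_def by auto
  have "u q \<noteq> 0"
  proof
    assume "u q = 0"
    hence "int q dvd 1" using Uq by (simp add: cong_iff_dvd_diff)
    thus False using q3 by simp
  qed
  hence upos: "nat (u q) > 0" using unn by simp
  \<comment> \<open>If all prime factors were 1 modulo \<open>q\<close>, so would be
    \<open>u q\<close>, which is -1; then \<open>q\<close> would divide 2.\<close>
  have "\<exists>p. prime p \<and> p dvd nat (u q) \<and> \<not> [p = 1] (mod q)"
  proof (rule ccontr)
    assume neg: "\<not> ?thesis"
    have "[nat (u q) = 1] (mod q)" by (rule cong_1_if_prime_divisors_cong_1[OF upos]) (use neg in blast)
    hence "[int (nat (u q)) = int 1] (mod int q)" by (simp only: cong_int_iff)
    hence "[u q = 1] (mod int q)" using unn by simp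
    hence "[-1 = (1::int)] (mod int q)" using Uq by (metis cong_sym cong_trans)
    hence "int q dvd 2" by (simp add: cong_iff_dvd_diff)
    hence "int q \<le> 2" by (rule zdvd_imp_le) simp
    thus False using q3 by simp
  qed
  then obtain p where p: "prime p" "p dvd nat (u q)" "\<not> [p = 1] (mod q)" by blast
  have pu: "int p dvd u q" using p(2) unn by (metis int_dvd_int_iff int_nat_eq)
  have pp: "prime (int p)" using p by simp
  have py: "p > y"
  proof (rule ccontr)
    assume "\<not> p > y"
    hence le: "p \<le> y" by simp
    show False
    proof (cases "p dvd D")
      case False
      hence "p \<in> P" using p le by (simp add: P_def primes_le_def)
      hence pa: "int p dvd int a" using adiv[OF p(1)] by simp
      have "[u (2 * k + 1) = int D ^ k] (mod int p) \<and> [v (2 * k + 1) = 0] (mod int p)" for k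
      proof (induction k)
        case 0
        thus ?case using pa by (simp add: u_def v_def cong_0_iff)
      next
        case (Suc k)
        have a0: "[int a = 0] (mod int p)" using pa by (simp add: cong_0_iff)
        have step: "[v (Suc n) = 0 * v n + int D * u n] (mod int p)" "[u (Suc n) = v n + 0 * u n] (mod int p)" for n
          unfolding rec by (intro cong_add cong_mult cong_refl a0)+
        have "[u (Suc (Suc (2*k+1))) = v (Suc (2*k+1))] (mod int p)" using step(2)[of "Suc (2*k+1)"] by simp
        also have "[v (Suc (2*k+1)) = int D * u (2*k+1)] (mod int p)" using step(1)[of "2*k+1"] by simp
        also have "[int D * u (2*k+1) = int D * int D ^ k] (mod int p)" using Suc by (intro cong_mult) auto
        finally have 1: "[u (Suc (Suc (2*k+1))) = int D ^ Suc k] (mod int p)" by simp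
        have "[v (Suc (Suc (2*k+1))) = int D * u (Suc (2*k+1))] (mod int p)" using step(1)[of "Suc (2*k+1)"] by simp
        also have "[int D * u (Suc (2*k+1)) = int D * v (2*k+1)] (mod int p)" using step(2)[of "2*k+1"] by (intro cong_mult) auto
        also have "[int D * v (2*k+1) = int D * 0] (mod int p)" using Suc by (intro cong_mult) auto
        finally have 2: "[v (Suc (Suc (2*k+1))) = 0] (mod int p)" by simp
        show ?case using 1 2 by simp
      qed
      moreover have "q = 2 * ((q - 1) div 2) + 1" using prime_odd_nat[OF q(1)] q3 by auto
      ultimately have "[u q = int D ^ ((q - 1) div 2)] (mod int p)" by metis
      hence "int p dvd int D ^ ((q - 1) div 2)" using pu by (simp add: cong_dvd_iff)
      hence "p dvd D" using pp by (meson int_dvd_int_iff prime_dvd_power)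
      thus False using False by simp
    next
      case True
      hence "p \<notin> P" by (simp add: P_def)
      hence na: "\<not> p dvd a" using adiv[OF p(1)] by simp
      have D0: "[int D = 0] (mod int p)" using True by (simp add: cong_0_iff)
      have "[v n = int a ^ n] (mod int p) \<and> [u (Suc n) = int (Suc n) * int a ^ n] (mod int p)" for n
      proof (induction n)
        case (Suc n)
        have v: "[v (Suc n) = int a ^ Suc n] (mod int p)"
        proof -
          have "[int a * v n + int D * u n = int a * int a ^ n + 0 * u n] (mod int p)"
            using Suc by (intro cong_add cong_mult cong_refl D0) auto
          thus ?thesis by (simp add: rec)
        qed
        have "[v (Suc n) + int a * u (Suc n) = int a ^ Suc n + int a * (int (Suc n) * int a ^ n)] (mod int p)"
          using Suc by (intro cong_add cong_mult cong_refl v) auto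
        thus ?case using v by (simp add: rec(2)[of "Suc n"] algebra_simps)
      qed (simp add: u_def v_def)
      from this[of "q - 1"] have "[u q = int q * int a ^ (q - 1)] (mod int p)" using q3 by simp
      hence "int p dvd int q * int a ^ (q - 1)" using pu by (simp add: cong_dvd_iff)
      hence "int p dvd int q \<or> int p dvd int a" using pp by (meson prime_dvd_mult_iff prime_dvd_power)
      hence "p dvd q" using na by simp
      hence "p = q" using p q by (metis primes_dvd_imp_eq)
      thus False using True D by (auto dest: dvd_imp_le)
    qed
  qed
  have p2: "p \<noteq> 2" using py q q3 by auto
  have nD: "\<not> p dvd D" using D py q by (auto dest: dvd_imp_le)
  have na: "\<not> p dvd a" using adiv[OF p(1)] py by (auto simp: P_def primes_le_def)
  \<comment> \<open>If \<open>D \<equiv> a^2\<close> modulo \<open>p\<close>, the sequence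
    degenerates to \<open>u (n+1) \<equiv> (2a)^n\<close>, which \<open>p\<close> does not divide,
    as it divides neither 2 nor \<open>a\<close>.\<close>
  have nQ: "\<not> int p dvd (int a)^2 - int D"
  proof
    assume "int p dvd (int a)^2 - int D"
    hence DQ: "[int D = (int a)^2] (mod int p)" by (metis cong_iff_dvd_diff cong_sym)
    have "[v (Suc n) = int a * u (Suc n)] (mod int p) \<and> [u (Suc n) = (2 * int a) ^ n] (mod int p)" for n
    proof (induction n)
      case (Suc n)
      have "[v (Suc n) + int a * u (Suc n) = int a * u (Suc n) + int a * u (Suc n)] (mod int p)"
        using Suc by (intro cong_add cong_refl) auto
      also have "int a * u (Suc n) + int a * u (Suc n) = (2 * int a) * u (Suc n)" by simp
      also have "[(2 * int a) * u (Suc n) = (2 * int a) * (2 * int a) ^ n] (mod int p)"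
        using Suc by (intro cong_mult cong_refl) auto
      finally have 1: "[u (Suc (Suc n)) = (2 * int a) ^ Suc n] (mod int p)" by (simp add: rec(2)[of "Suc n"])
      have "[int a * v (Suc n) + int D * u (Suc n) = int a * v (Suc n) + (int a)^2 * u (Suc n)] (mod int p)"
        by (intro cong_add cong_mult cong_refl DQ)
      also have "int a * v (Suc n) + (int a)^2 * u (Suc n) = int a * u (Suc (Suc n))"
        by (simp add: rec(2)[of "Suc n"] power2_eq_square algebra_simps)
      finally show ?case using 1 by (simp add: rec(1)[of "Suc n"])
    qed (simp add: u_def v_def)
    from this[of "q - 1"] have "[u q = (2 * int a) ^ (q - 1)] (mod int p)" using q3 by simp
    hence "int p dvd (2 * int a) ^ (q - 1)" using pu by (simp add: cong_dvd_iff)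
    hence "int p dvd int (2 * a)" using pp by (metis of_nat_mult of_nat_numeral prime_dvd_power)
    hence "p dvd 2 * a" by (simp only: int_dvd_int_iff)
    hence "p dvd 2" using p na by (simp add: prime_dvd_mult_iff)
    thus False using p p2 by (metis primes_dvd_imp_eq two_is_prime_nat)
  qed
  obtain p' where p': "p = Suc p'" using py by (cases p) auto
  note idx = lucas_prime_index[OF p(1) p2, of "int a" "int D"]
  have rank: "q dvd m" if "int p dvd u m" for m
    using dvd_lucas_u_rank[OF p(1) q(1) nQ] pu that unfolding u_def by blast
  \<comment> \<open>The sign of \<open>D^((p-1)/2)\<close> decides whether \<open>p\<close> divides
    \<open>u (p-1)\<close> or \<open>u (p+1)\<close>. Accordingly \<open>q\<close> divides
    \<open>p - 1\<close> or \<open>p + 1\<close>, and the former was excluded by the choice of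
    \<open>p\<close>.\<close>
  have "q dvd p + 1"
  proof -
    from half_power_cases[OF p(1) p2 nD] consider
      "[int D ^ ((p - 1) div 2) = 1] (mod int p)" | "[int D ^ ((p - 1) div 2) = -1] (mod int p)" by blast
    thus ?thesis
    proof cases
      case 1
      have up: "[u p = 1] (mod int p)" using cong_trans[OF idx(2) 1] by (simp add: u_def)
      have vp: "[v p = int a] (mod int p)" using idx(1) by (simp add: v_def)
      have "[int a * u p - v p = int a * 1 - int a] (mod int p)"
        by (intro cong_diff cong_mult cong_refl up vp)
      \<comment> \<open>Multiplying \<open>(a + \<surd>D)^p\<close> by the conjugate steps the index
        back by one, at the cost of the norm as a factor.\<close>
      also have "int a * u p - v p = ((int a)^2 - int D) * u p'"
        by (simp add: p' rec power2_eq_square algebra_simps)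
      finally have "int p dvd ((int a)^2 - int D) * u p'" by (simp add: cong_0_iff)
      hence "int p dvd u p'" using pp nQ by (simp add: prime_dvd_mult_iff)
      hence "q dvd p'" by (rule rank)
      hence "[p' + 1 = 0 + 1] (mod q)" by (intro cong_add) (auto simp: cong_0_iff)
      hence "[p = 1] (mod q)" by (simp add: p')
      thus ?thesis using p by simp
    next
      case 2
      have up: "[u p = -1] (mod int p)" using cong_trans[OF idx(2) 2] by (simp add: u_def)
      have vp: "[v p = int a] (mod int p)" using idx(1) by (simp add: v_def)
      have "[v p + int a * u p = int a + int a * (-1)] (mod int p)"
        by (intro cong_add cong_mult cong_refl up vp)
      hence "int p dvd u (Suc p)" by (simp add: rec cong_0_iff)
      thus ?thesis using rank by fastforce
    qed
  qed
  moreover have "p \<le> 4 ^ ((y + 1) * q)"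
  proof -
    have "D \<le> 4 ^ y" using D q less_exp[of y] power_mono[of 2 "4::nat" y] by linarith
    hence "a + D \<le> 4 ^ (y + 1)" using a_le by simp
    have "int p \<le> u q" using pu upos by (intro zdvd_imp_le) auto
    also have "\<dots> \<le> int ((a + D) ^ q)" using unn by simp
    finally have "p \<le> (a + D) ^ q" by linarith
    also have "\<dots> \<le> (4 ^ (y + 1)) ^ q" using \<open>a + D \<le> 4 ^ (y + 1)\<close> by (intro power_mono) auto
    finally show ?thesis by (simp only: power_mult)
  qed
  ultimately show ?thesis using p py by blast
qed

lemma exists_prime_cong_minus_1:
  assumes q: "prime q" "q \<le> y"
  shows "\<exists>p. prime p \<and> p > y \<and> q dvd p + 1 \<and> p \<le> 4 ^ ((y + 1) * q)"
proof (cases "q = 2")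
  case True
  \<comment> \<open>Modulo 2 the classes 1 and -1 agree.\<close>
  obtain p where p: "prime p" "p > y" "q dvd p - 1" "p \<le> 4 ^ ((y + 1) * q)"
    using exists_prime_cong_1[OF q] by blast
  have "odd p" using p q True prime_odd_nat[of p] by auto
  thus ?thesis using p True by (intro exI[of _ p]) auto
qed (use exists_prime_cong_minus_1_odd q in blast)

section \<open>Brun's sieve\<close>

lemma card_cong_less:
  fixes a m N :: nat
  assumes "m > 0"
  shows "\<bar>real (card {n. n < N \<and> [n = a] (mod m)}) - real N / real m\<bar> \<le> 1"
proof (induction N rule: less_induct)
  case (less N)
  have one: "{n. n < m \<and> [n = a] (mod m)} = {a mod m}"
    using assms by (auto simp: cong_def)
  show ?case
  proof (cases "N < m")
    case True
    have "card {n. n < N \<and> [n = a] (mod m)} \<le> card {a mod m}"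
      unfolding one[symmetric] using True by (intro card_mono) auto
    hence "real (card {n. n < N \<and> [n = a] (mod m)}) \<le> 1" by simp
    moreover have "real N / real m < 1" "real N / real m \<ge> 0" using True by simp_all
    ultimately show ?thesis by linarith
  next
    case False
    then obtain M where M: "N = M + m" by (metis add.commute le_Suc_ex not_less)
    define T where "T K = {n. n < K \<and> [n = a] (mod m)}" for K
    have T: "T N = T m \<union> (\<lambda>n. n + m) ` T M"
    proof (intro equalityI subsetI)
      fix n assume n: "n \<in> T N"
      show "n \<in> T m \<union> (\<lambda>n. n + m) ` T M"
      proof (cases "n < m")
        case False
        then obtain k where k: "n = k + m" by (metis add.commute le_Suc_ex not_less)
        thus ?thesis using n M by (auto simp: cong_def T_def)
      qed (use n in \<open>auto simp: T_def\<close>)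
    qed (use M in \<open>auto simp: cong_def T_def\<close>)
    have "card (T N) = card (T m) + card ((\<lambda>n. n + m) ` T M)"
      unfolding T by (rule card_Un_disjoint) (auto simp: T_def)
    moreover have "card (T m) = 1" using one by (simp add: T_def)
    moreover have "card ((\<lambda>n. n + m) ` T M) = card (T M)"
      by (rule card_image) (simp add: inj_on_def)
    ultimately have "real (card {n. n < N \<and> [n = a] (mod m)}) = 1 + real (card {n. n < M \<and> [n = a] (mod m)})"
      by (simp add: T_def)
    moreover have "real N / real m = 1 + real M / real m" using M assms by (simp add: field_simps)
    ultimately show ?thesis using less[of M] M assms by simp
  qed
qed

text \<open>Chinese remaindering, one prime at a time: each \<open>r\<close> splits a progression
  into \<open>card (A r)\<close> progressions of modulus \<open>m * r\<close>, and each final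
  progression is counted with an error of at most 1. The class \<open>a\<close> modulo
  \<open>m\<close> carries the primes already treated in the induction.\<close>

lemma card_residue_classes:
  fixes A :: "nat \<Rightarrow> nat set"
  assumes D: "finite D" "\<And>r. r \<in> D \<Longrightarrow> prime r" and A: "\<And>r. r \<in> D \<Longrightarrow> A r \<subseteq> {..<r}"
    and m: "m > 0" "\<And>r. r \<in> D \<Longrightarrow> coprime m r"
  shows "\<bar>real (card {n. n < N \<and> [n = a] (mod m) \<and> (\<forall>r\<in>D. n mod r \<in> A r)}) -
     real N / real m * (\<Prod>r\<in>D. real (card (A r)) / real r)\<bar> \<le> (\<Prod>r\<in>D. real (card (A r)))"
  using assms
proof (induction D arbitrary: m a rule: finite_induct)
  case empty
  thus ?case using card_cong_less[of m N a] by simp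
next
  case (insert r D)
  have r: "prime r" "r > 0" using insert.prems prime_gt_0_nat by auto
  have fA: "finite (A r)" using insert.prems(2)[of r] by (auto intro: finite_subset)
  have cop: "coprime m r" using insert.prems by auto
  have "\<exists>c. [c = a] (mod m) \<and> [c = b] (mod r)" for b
    using binary_chinese_remainder_nat[OF cop] by blast
  then obtain c where c: "\<And>b. [c b = a] (mod m)" "\<And>b. [c b = b] (mod r)" by metis
  define S where "S b = {n. n < N \<and> [n = c b] (mod m * r) \<and> (\<forall>r\<in>D. n mod r \<in> A r)}" for b
  have iff: "[n = c b] (mod m * r) \<longleftrightarrow> [n = a] (mod m) \<and> n mod r = b" if "b \<in> A r" for n b
  proof -
    have br: "b < r" using that insert.prems(2)[of r] by auto
    have "[n = c b] (mod m * r) \<longleftrightarrow> [n = c b] (mod m) \<and> [n = c b] (mod r)"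
      using coprime_cong_mult_nat[OF _ _ cop] cong_modulus_mult_nat by (metis mult.commute)
    also have "\<dots> \<longleftrightarrow> [n = a] (mod m) \<and> [n = b] (mod r)"
      using c by (meson cong_sym cong_trans)
    finally show ?thesis using br by (simp add: cong_def)
  qed
  have "{n. n < N \<and> [n = a] (mod m) \<and> (\<forall>r\<in>insert r D. n mod r \<in> A r)} = (\<Union>b\<in>A r. S b)"
    using iff by (auto simp: S_def)
  also have "card \<dots> = (\<Sum>b\<in>A r. card (S b))"
  proof (rule card_UN_disjoint)
    show "\<forall>i\<in>A r. \<forall>j\<in>A r. i \<noteq> j \<longrightarrow> S i \<inter> S j = {}" using iff by (auto simp: S_def)
  qed (auto simp: fA S_def)
  finally have eq: "real (card {n. n < N \<and> [n = a] (mod m) \<and> (\<forall>r\<in>insert r D. n mod r \<in> A r)}) = (\<Sum>b\<in>A r. real (card (S b)))"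
    by simp
  let ?M = "real N / real (m * r) * (\<Prod>r\<in>D. real (card (A r)) / real r)"
  have IH: "\<bar>real (card (S b)) - ?M\<bar> \<le> (\<Prod>r\<in>D. real (card (A r)))" for b
    unfolding S_def
  proof (rule insert.IH)
    fix q assume q: "q \<in> D"
    hence "coprime r q" using insert by (metis insertCI primes_coprime)
    thus "coprime (m * r) q" using insert.prems q by simp
  qed (use insert.prems r in auto)
  have "real N / real m * (\<Prod>r\<in>insert r D. real (card (A r)) / real r) = (\<Sum>b\<in>A r. ?M)"
    using insert.hyps by (simp add: field_simps)
  hence "\<bar>real (card {n. n < N \<and> [n = a] (mod m) \<and> (\<forall>r\<in>insert r D. n mod r \<in> A r)}) -
     real N / real m * (\<Prod>r\<in>insert r D. real (card (A r)) / real r)\<bar> = \<bar>\<Sum>b\<in>A r. real (card (S b)) - ?M\<bar>"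
    unfolding eq by (simp add: sum_subtractf)
  also have "\<dots> \<le> (\<Sum>b\<in>A r. \<bar>real (card (S b)) - ?M\<bar>)" by (rule sum_abs)
  also have "\<dots> \<le> (\<Sum>b\<in>A r. (\<Prod>r\<in>D. real (card (A r))))" by (intro sum_mono IH)
  also have "\<dots> = (\<Prod>r\<in>insert r D. real (card (A r)))" using insert.hyps by simp
  finally show ?case .
qed

lemma alternating_binomial_sum: "(\<Sum>k\<le>m. (-1)^k * int (Suc n choose k)) = (-1)^m * int (n choose m)"
  by (induction m) (auto simp: algebra_simps)

text \<open>Truncated inclusion-exclusion: for \<open>F\<close> with \<open>n + 1\<close> elements
  the sum collapses to \<open>(-1)^m * (n choose m)\<close>, which is nonnegative for even
  \<open>m\<close>.\<close>

lemma bonferroni_upper: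
  assumes "finite F" "even m"
  shows "(if F = {} then 1 else 0) \<le> (\<Sum>D | D \<subseteq> F \<and> card D \<le> m. (-1::real) ^ card D)"
proof -
  have fin: "finite {D. D \<subseteq> F \<and> card D \<le> m}" by (rule finite_subset[of _ "Pow F"]) (use assms(1) in auto)
  have "(\<Sum>D | D \<subseteq> F \<and> card D \<le> m. (-1::real) ^ card D) = (\<Sum>k\<le>m. \<Sum>D | D \<in> {D. D \<subseteq> F \<and> card D \<le> m} \<and> card D = k. (-1) ^ card D)"
    by (rule sum.group[symmetric]) (use fin in auto)
  also have "\<dots> = (\<Sum>k\<le>m. (-1) ^ k * real (card F choose k))"
  proof (intro sum.cong refl)
    fix k assume "k \<in> {..m}"
    hence "{D. D \<in> {D. D \<subseteq> F \<and> card D \<le> m} \<and> card D = k} = {D. D \<subseteq> F \<and> card D = k}" by auto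
    moreover have "(\<Sum>D | D \<subseteq> F \<and> card D = k. (-1::real) ^ card D) = (\<Sum>D | D \<subseteq> F \<and> card D = k. (-1) ^ k)" by (intro sum.cong) auto
    ultimately show "(\<Sum>D | D \<in> {D. D \<subseteq> F \<and> card D \<le> m} \<and> card D = k. (-1::real) ^ card D) = (-1) ^ k * real (card F choose k)"
      using n_subsets[OF assms(1), of k] by simp
  qed
  also have "\<dots> = real_of_int (\<Sum>k\<le>m. (-1) ^ k * int (card F choose k))" by simp
  finally have eq: "(\<Sum>D | D \<subseteq> F \<and> card D \<le> m. (-1::real) ^ card D) = real_of_int (\<Sum>k\<le>m. (-1) ^ k * int (card F choose k))" .
  show ?thesis
  proof (cases "F = {}")
    case True
    hence "{D. D \<subseteq> F \<and> card D \<le> m} = {{}}" by auto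
    thus ?thesis using True by simp
  next
    case False
    then obtain n where "card F = Suc n" using assms(1) by (metis card_0_eq not0_implies_Suc)
    thus ?thesis using False assms(2) by (simp add: eq alternating_binomial_sum)
  qed
qed

lemma prod_one_plus_eq_sum_Pow:
  fixes f :: "'a \<Rightarrow> real" assumes "finite P"
  shows "(\<Prod>r\<in>P. 1 + f r) = (\<Sum>D\<in>Pow P. \<Prod>r\<in>D. f r)"
  using prod_add[OF assms, of f "\<lambda>_. 1"] by (simp add: add.commute)

lemma prod_one_plus_le_exp:
  fixes f :: "'a \<Rightarrow> real" assumes "finite P" "\<And>r. r \<in> P \<Longrightarrow> f r \<ge> 0"
  shows "(\<Prod>r\<in>P. 1 + f r) \<le> exp (\<Sum>r\<in>P. f r)"
  unfolding exp_sum[OF assms(1)] by (intro prod_mono) (use assms in \<open>auto simp: add_nonneg_nonneg\<close>)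

text \<open>Brun's pure sieve. Truncation at \<open>m\<close> prime factors keeps the total error of
  order \<open>(2 z)^m\<close>. Its price is the tail \<open>exp (3 * X - m)\<close>, which is small
  once \<open>m\<close> is a large multiple of \<open>X\<close>.\<close>

theorem brun_sieve:
  fixes A :: "nat \<Rightarrow> nat set"
  assumes P: "finite P" "\<And>r. r \<in> P \<Longrightarrow> prime r" and A: "\<And>r. r \<in> P \<Longrightarrow> A r \<subseteq> {..<r}" "\<And>r. r \<in> P \<Longrightarrow> card (A r) \<le> 2"
    and z: "z > 0" "card P \<le> z" and m: "even m"
  defines "X \<equiv> \<Sum>r\<in>P. real (card (A r)) / real r"
  shows "real (card {n. n < N \<and> (\<forall>r\<in>P. n mod r \<notin> A r)}) \<le> real N * (exp (-X) + exp (3 * X - real m)) + 3 * (2 * real z) ^ m"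
proof -
  define x where "x r = real (card (A r)) / real r" for r
  define F where "F n = {r\<in>P. n mod r \<in> A r}" for n
  have finF: "finite (F n)" for n using P by (simp add: F_def)
  define Q where "Q = {D. D \<subseteq> P \<and> card D \<le> m}"
  have finQ: "finite Q" unfolding Q_def by (rule finite_subset[of _ "Pow P"]) (use P in auto)
  have x: "0 \<le> x r" "x r \<le> 1" if "r \<in> P" for r
  proof -
    have "real (card (A r)) \<le> real r" using card_mono[OF _ A(1)[OF that]] by simp
    moreover have "r > 0" using P that prime_gt_0_nat by auto
    ultimately show "0 \<le> x r" "x r \<le> 1" by (auto simp: x_def)
  qed
  have prodx: "(\<Prod>r\<in>D. x r) \<ge> 0" if "D \<subseteq> P" for D using that x by (intro prod_nonneg) auto
  have "real (card {n. n < N \<and> (\<forall>r\<in>P. n mod r \<notin> A r)}) = (\<Sum>n<N. if F n = {} then 1 else 0)"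
  proof -
    have "{n. n < N \<and> (\<forall>r\<in>P. n mod r \<notin> A r)} = {..<N} \<inter> {n. F n = {}}" by (auto simp: F_def)
    thus ?thesis by (simp add: sum.If_cases)
  qed
  also have "\<dots> \<le> (\<Sum>n<N. \<Sum>D | D \<subseteq> F n \<and> card D \<le> m. (-1) ^ card D)"
    by (intro sum_mono bonferroni_upper finF m)
  also have "\<dots> = (\<Sum>n<N. \<Sum>D\<in>Q. if D \<subseteq> F n then (-1) ^ card D else 0)"
  proof (rule sum.cong[OF refl])
    fix n
    have "{D. D \<subseteq> F n \<and> card D \<le> m} = Q \<inter> {D. D \<subseteq> F n}" by (auto simp: Q_def F_def)
    thus "(\<Sum>D | D \<subseteq> F n \<and> card D \<le> m. (-1::real) ^ card D) = (\<Sum>D\<in>Q. if D \<subseteq> F n then (-1) ^ card D else 0)"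
      using finQ by (simp add: sum.If_cases)
  qed
  also have "\<dots> = (\<Sum>D\<in>Q. \<Sum>n<N. if D \<subseteq> F n then (-1) ^ card D else 0)" by (rule sum.swap)
  also have "\<dots> = (\<Sum>D\<in>Q. (-1) ^ card D * real (card {n. n < N \<and> D \<subseteq> F n}))"
  proof (rule sum.cong[OF refl])
    fix D
    have "{n. n < N \<and> D \<subseteq> F n} = {..<N} \<inter> {n. D \<subseteq> F n}" by auto
    thus "(\<Sum>n<N. if D \<subseteq> F n then (-1) ^ card D else 0) = (-1) ^ card D * real (card {n. n < N \<and> D \<subseteq> F n})"
      by (simp add: sum.If_cases)
  qed
  also have "\<dots> \<le> (\<Sum>D\<in>Q. (-1) ^ card D * (real N * (\<Prod>r\<in>D. x r)) + (\<Prod>r\<in>D. real (card (A r))))"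
  proof (rule sum_mono)
    fix D assume D: "D \<in> Q"
    have DP: "D \<subseteq> P" "finite D" using D P by (auto simp: Q_def intro: finite_subset)
    have "{n. n < N \<and> D \<subseteq> F n} = {n. n < N \<and> [n = 0] (mod 1) \<and> (\<forall>r\<in>D. n mod r \<in> A r)}"
      using DP by (auto simp: F_def)
    hence "\<bar>real (card {n. n < N \<and> D \<subseteq> F n}) - real N * (\<Prod>r\<in>D. x r)\<bar> \<le> (\<Prod>r\<in>D. real (card (A r)))"
      using card_residue_classes[of D A 1 N 0, OF DP(2)] DP(1) P(2) A(1) by (simp add: x_def subset_iff)
    hence "(-1) ^ card D * (real (card {n. n < N \<and> D \<subseteq> F n}) - real N * (\<Prod>r\<in>D. x r)) \<le> (\<Prod>r\<in>D. real (card (A r)))"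
      by (cases "even (card D)") auto
    thus "(-1) ^ card D * real (card {n. n < N \<and> D \<subseteq> F n}) \<le> (-1) ^ card D * (real N * (\<Prod>r\<in>D. x r)) + (\<Prod>r\<in>D. real (card (A r)))"
      by (simp add: algebra_simps)
  qed
  also have "\<dots> = real N * (\<Sum>D\<in>Q. (-1) ^ card D * (\<Prod>r\<in>D. x r)) + (\<Sum>D\<in>Q. \<Prod>r\<in>D. real (card (A r)))"
    by (simp add: sum.distrib sum_distrib_left mult_ac)
  finally have main: "real (card {n. n < N \<and> (\<forall>r\<in>P. n mod r \<notin> A r)}) \<le>
     real N * (\<Sum>D\<in>Q. (-1) ^ card D * (\<Prod>r\<in>D. x r)) + (\<Sum>D\<in>Q. \<Prod>r\<in>D. real (card (A r)))" .
  have tail: "(\<Sum>D\<in>Pow P - Q. \<Prod>r\<in>D. x r) \<le> exp (3 * X - real m)"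
  proof -
    \<comment> \<open>Rankin's trick: a set \<open>D\<close> outside \<open>Q\<close> has more than
      \<open>m\<close> elements, so inserting the factor \<open>exp (card D - m)\<close> only
      enlarges the sum. The 3 in \<open>3 * X\<close> bounds \<open>exp 1\<close>.\<close>
    have "(\<Sum>D\<in>Pow P - Q. \<Prod>r\<in>D. x r) \<le> (\<Sum>D\<in>Pow P - Q. exp (- real m) * (\<Prod>r\<in>D. exp 1 * x r))"
    proof (rule sum_mono)
      fix D assume D: "D \<in> Pow P - Q"
      have "(\<Prod>r\<in>D. exp 1 * x r) = exp (real (card D)) * (\<Prod>r\<in>D. x r)"
        by (simp add: prod.distrib exp_of_nat_mult[of _ 1, simplified])
      hence "exp (- real m) * (\<Prod>r\<in>D. exp 1 * x r) = exp (real (card D) - real m) * (\<Prod>r\<in>D. x r)"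
        by (simp add: exp_diff exp_minus field_simps)
      moreover have "exp (real (card D) - real m) \<ge> 1" using D by (auto simp: Q_def)
      ultimately show "(\<Prod>r\<in>D. x r) \<le> exp (- real m) * (\<Prod>r\<in>D. exp 1 * x r)"
        using prodx[of D] D mult_right_mono[of 1 "exp (real (card D) - real m)" "\<Prod>r\<in>D. x r"] by auto
    qed
    also have "\<dots> \<le> (\<Sum>D\<in>Pow P. exp (- real m) * (\<Prod>r\<in>D. exp 1 * x r))"
      using P x by (intro sum_mono2) (auto intro!: prod_nonneg mult_nonneg_nonneg)
    also have "\<dots> = exp (- real m) * (\<Prod>r\<in>P. 1 + exp 1 * x r)"
      by (simp add: prod_one_plus_eq_sum_Pow[OF P(1)] sum_distrib_left)
    also have "\<dots> \<le> exp (- real m) * exp (\<Sum>r\<in>P. exp 1 * x r)"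
      using P x by (intro mult_left_mono prod_one_plus_le_exp) auto
    also have "(\<Sum>r\<in>P. exp 1 * x r) \<le> 3 * X"
    proof -
      have "(\<Sum>r\<in>P. exp 1 * x r) = exp 1 * X" by (simp add: X_def x_def sum_distrib_left)
      moreover have "X \<ge> 0" unfolding X_def using x by (intro sum_nonneg) (auto simp: x_def)
      ultimately show ?thesis using exp_le by (auto intro: mult_right_mono)
    qed
    finally show ?thesis by (simp add: exp_diff exp_minus field_simps)
  qed
  have M: "(\<Sum>D\<in>Q. (-1) ^ card D * (\<Prod>r\<in>D. x r)) \<le> exp (-X) + exp (3 * X - real m)"
  proof -
    have "(\<Sum>D\<in>Pow P. (-1) ^ card D * (\<Prod>r\<in>D. x r)) = (\<Prod>r\<in>P. 1 + - x r)"
      unfolding prod_one_plus_eq_sum_Pow[OF P(1)]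
    proof (intro sum.cong refl)
      fix D
      have "(\<Prod>r\<in>D. - x r) = (\<Prod>r\<in>D. (-1) * x r)" by simp
      thus "(-1) ^ card D * (\<Prod>r\<in>D. x r) = (\<Prod>r\<in>D. - x r)" by (simp only: prod.distrib prod_constant)
    qed
    also have "\<dots> \<le> (\<Prod>r\<in>P. exp (- x r))"
    proof (intro prod_mono conjI)
      fix r assume r: "r \<in> P"
      show "0 \<le> 1 + - x r" using x(2)[OF r] by simp
      show "1 + - x r \<le> exp (- x r)" by (rule exp_ge_add_one_self)
    qed
    also have "\<dots> = exp (-X)" using P by (simp add: X_def x_def sum_negf flip: exp_sum)
    finally have 1: "(\<Sum>D\<in>Pow P. (-1) ^ card D * (\<Prod>r\<in>D. x r)) \<le> exp (-X)" .
    have "(\<Sum>D\<in>Pow P. (-1) ^ card D * (\<Prod>r\<in>D. x r)) = (\<Sum>D\<in>Pow P - Q. (-1) ^ card D * (\<Prod>r\<in>D. x r)) + (\<Sum>D\<in>Q. (-1) ^ card D * (\<Prod>r\<in>D. x r))"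
      by (rule sum.subset_diff) (use P in \<open>auto simp: Q_def\<close>)
    moreover have "(\<Sum>D\<in>Pow P - Q. (-1) ^ card D * (\<Prod>r\<in>D. x r)) \<ge> (\<Sum>D\<in>Pow P - Q. - (\<Prod>r\<in>D. x r))"
    proof (rule sum_mono)
      fix D assume "D \<in> Pow P - Q"
      thus "- (\<Prod>r\<in>D. x r) \<le> (-1) ^ card D * (\<Prod>r\<in>D. x r)"
        using prodx[of D] by (cases "even (card D)") auto
    qed
    ultimately show ?thesis using 1 tail by (simp add: sum_negf)
  qed
  have R: "(\<Sum>D\<in>Q. \<Prod>r\<in>D. real (card (A r))) \<le> 3 * (2 * real z) ^ m"
  proof -
    \<comment> \<open>The same trick in the other direction: a set of at most \<open>m\<close>
      elements gains \<open>t^(m - card D) \<ge> 1\<close>, and \<open>t = 2 * z\<close> makes the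
      sum of \<open>card (A r) / t\<close> at most 1. The leading 3 again bounds
      \<open>exp 1\<close>.\<close>
    define t where "t = 2 * real z"
    have t: "t \<ge> 1" using z by (simp add: t_def)
    have "(\<Sum>D\<in>Q. \<Prod>r\<in>D. real (card (A r))) \<le> (\<Sum>D\<in>Q. t ^ m * (\<Prod>r\<in>D. real (card (A r)) / t))"
    proof (rule sum_mono)
      fix D assume D: "D \<in> Q"
      have "t ^ m * (\<Prod>r\<in>D. real (card (A r)) / t) = (t ^ m / t ^ card D) * (\<Prod>r\<in>D. real (card (A r)))"
        by (simp add: prod_dividef)
      moreover have "t ^ card D \<le> t ^ m" using D t by (intro power_increasing) (auto simp: Q_def)
      hence "t ^ m / t ^ card D \<ge> 1" using t by (simp add: field_simps)
      ultimately show "(\<Prod>r\<in>D. real (card (A r))) \<le> t ^ m * (\<Prod>r\<in>D. real (card (A r)) / t)"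
        using mult_right_mono[of 1 "t ^ m / t ^ card D" "\<Prod>r\<in>D. real (card (A r))"] by (auto simp: prod_nonneg)
    qed
    also have "\<dots> \<le> (\<Sum>D\<in>Pow P. t ^ m * (\<Prod>r\<in>D. real (card (A r)) / t))"
      using P t by (intro sum_mono2) (auto simp: Q_def intro!: mult_nonneg_nonneg prod_nonneg)
    also have "\<dots> = t ^ m * (\<Prod>r\<in>P. 1 + real (card (A r)) / t)"
      by (simp add: prod_one_plus_eq_sum_Pow[OF P(1)] sum_distrib_left)
    also have "\<dots> \<le> t ^ m * exp (\<Sum>r\<in>P. real (card (A r)) / t)"
      using P t by (intro mult_left_mono prod_one_plus_le_exp) auto
    also have "(\<Sum>r\<in>P. real (card (A r)) / t) \<le> (\<Sum>r\<in>P. 2 / t)"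
      using A t by (intro sum_mono divide_right_mono) auto
    also have "(\<Sum>r\<in>P. 2 / t) = real (card P) / real z" using z by (simp add: t_def)
    also have "\<dots> \<le> 1" using z by simp
    finally have "(\<Sum>D\<in>Q. \<Prod>r\<in>D. real (card (A r))) \<le> t ^ m * exp 1" using t by simp
    also have "\<dots> \<le> t ^ m * 3" using t exp_le by (intro mult_left_mono) auto
    finally show ?thesis by (simp add: t_def)
  qed
  have "real N * (\<Sum>D\<in>Q. (-1) ^ card D * (\<Prod>r\<in>D. x r)) \<le> real N * (exp (-X) + exp (3 * X - real m))"
    using M by (intro mult_left_mono) auto
  thus ?thesis using main R by linarith
qed

section \<open>Chebyshev's lower bound and the primes missed by the sieve\<close>

text \<open>By the first theorem and \<open>ln K \<ge> 2 * C + 1\<close>, the primes between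
  \<open>N/K\<close> and \<open>N\<close> carry at least 1 of the sum of \<open>ln p / p\<close>,
  while each of them carries at most \<open>K * ln N / N\<close>.\<close>

lemma card_primes_le_ge:
  obtains c :: real and N0 :: nat where "c > 0" "\<And>N. N \<ge> N0 \<Longrightarrow> c * real N / ln (real N) \<le> real (card (primes_le N))"
proof -
  from mertens_first obtain C where C: "C > 0"
    "\<And>n. n \<ge> 1 \<Longrightarrow> \<bar>(\<Sum>p\<in>primes_le n. ln (real p) / real p) - ln (real n)\<bar> \<le> C" by blast
  define K where "K = nat \<lceil>exp (2 * C + 1)\<rceil>"
  have K: "real K \<ge> exp (2 * C + 1)" by (simp add: K_def)
  have "exp (2 * C + 1) \<ge> 1" using C by simp
  hence K1: "real K \<ge> 1" "K > 0" using K by linarith+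
  have "1 / real K * real N / ln (real N) \<le> real (card (primes_le N))" if N: "N \<ge> 2 * K" for N
  proof -
    define k where "k = N div K"
    have k1: "k \<ge> 1" using N K1 div_le_mono[of K N K] by (simp add: k_def)
    have N1: "N \<ge> 2" using N K1 by simp
    have kN: "real k \<le> real N / real K" unfolding k_def by (rule of_nat_div_le_of_nat)
    define D where "D = primes_le N - primes_le k"
    have "k \<le> N" unfolding k_def by simp
    hence "(\<Sum>p\<in>primes_le N. ln (real p) / real p) = (\<Sum>p\<in>D. ln (real p) / real p) + (\<Sum>p\<in>primes_le k. ln (real p) / real p)"
      unfolding D_def by (intro sum.subset_diff primes_le_mono) auto
    hence 1: "(\<Sum>p\<in>D. ln (real p) / real p) \<ge> ln (real N) - ln (real k) - 2 * C"
      using C(2)[of N] C(2)[of k] k1 N1 by linarith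
    have "ln (real k) \<le> ln (real N / real K)" using kN k1 by (intro ln_mono) auto
    also have "\<dots> = ln (real N) - ln (real K)" using N1 K1 by (simp add: ln_div)
    finally have "ln (real N) - ln (real k) \<ge> ln (real K)" by simp
    moreover have "ln (real K) \<ge> ln (exp (2 * C + 1))" using K by (intro ln_mono) auto
    ultimately have "1 \<le> (\<Sum>p\<in>D. ln (real p) / real p)" using 1 by simp
    also have "\<dots> \<le> (\<Sum>p\<in>D. ln (real N) * (real K / real N))"
    proof (rule sum_mono)
      fix p assume "p \<in> D"
      hence p: "prime p" "p \<le> N" "p > k" by (auto simp: D_def primes_le_def)
      have p1: "real p \<ge> 1" using prime_ge_1_nat[OF p(1)] by simp
      have "N < p * K" using p(3) K1 by (simp add: k_def div_less_iff_less_mult)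
      hence "real N < real p * real K" by (metis of_nat_less_iff of_nat_mult)
      hence "1 / real p \<le> real K / real N" using p1 N1 by (simp add: field_simps)
      moreover have "ln (real p) \<le> ln (real N)" using p p1 by (intro ln_mono) auto
      ultimately have "ln (real p) * (1 / real p) \<le> ln (real N) * (real K / real N)"
        using p1 N1 by (intro mult_mono) auto
      thus "ln (real p) / real p \<le> ln (real N) * (real K / real N)" by simp
    qed
    also have "\<dots> = real (card D) * (ln (real N) * (real K / real N))" by simp
    also have "\<dots> \<le> real (card (primes_le N)) * (ln (real N) * (real K / real N))"
      using N1 by (intro mult_right_mono) (auto simp: D_def intro!: card_mono)
    finally have "1 \<le> real (card (primes_le N)) * (ln (real N) * (real K / real N))" .
    moreover have "ln (real N) > 0" using N1 by simp
    ultimately show ?thesis using N1 K1 by (simp add: field_simps)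
  qed
  thus ?thesis using K1 by (intro that[of "1 / real K" "2 * K"]) auto
qed

lemma sum_prime_reciprocals_bound:
  obtains C where "C > 0" "\<And>n. \<bar>(\<Sum>p\<in>primes_le n. 1 / real p) - ln (ln (real n))\<bar> \<le> C"
proof -
  obtain M where "(\<lambda>n. (\<Sum>p\<in>primes_le n. 1 / real p) - ln (ln (real n))) \<longlonglongrightarrow> M"
    using mertens_second .
  hence "Bseq (\<lambda>n. (\<Sum>p\<in>primes_le n. 1 / real p) - ln (ln (real n)))"
    by (intro convergent_imp_Bseq) (auto simp: convergent_def)
  thus ?thesis using that by (auto simp: Bseq_def)
qed

text \<open>The 30 ensures \<open>(2 z)\<^sup>m \<le> N\<^bsup>1/2\<^esup>\<close> for \<open>z = sieve_level N\<close> and the truncation order \<open>m\<close>, about \<open>10 log log N\<close>.\<close>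
definition sieve_level :: "nat \<Rightarrow> nat" where
  "sieve_level N = nat \<lfloor>exp (ln (real N) / (30 * ln (ln (real N))))\<rfloor>"

text \<open>With \<open>z = sieve_level N\<close>, the sieve leaves about \<open>N exp (-X)\<close>
  integers, where \<open>X = ln ln z + \<Sum> 1/q + O(1)\<close>. As there are at least
  \<open>c N / ln N\<close> primes, \<open>\<Sum> 1/q \<le> ln ln N - ln ln z + O(1)\<close>. The
  triple logarithm is the loss from \<open>ln z\<close> being smaller than \<open>ln N\<close> by
  the factor \<open>30 ln ln N\<close>.\<close>

theorem sum_missed_primes_le:
  shows "\<exists>(C::real) (N0::nat). \<forall>N\<ge>N0. \<forall>B s. B \<subseteq> primes_le (sieve_level N) \<longrightarrow> (\<forall>q\<in>B. 0 < s q \<and> s q < q) \<longrightarrow>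
       (\<forall>q\<in>B. \<forall>p. prime p \<longrightarrow> (sieve_level N)^2 < p \<longrightarrow> p < N \<longrightarrow> p mod q \<noteq> s q) \<longrightarrow>
       (\<Sum>q\<in>B. 1 / real q) \<le> ln (ln (ln (real N))) + C"
proof -
  obtain c N1 where c: "c > 0" "\<And>N. N \<ge> N1 \<Longrightarrow> c * real N / ln (real N) \<le> real (card (primes_le N))"
    using card_primes_le_ge by blast
  obtain C1 where C1: "C1 > 0" "\<And>n. \<bar>(\<Sum>p\<in>primes_le n. 1 / real p) - ln (ln (real n))\<bar> \<le> C1"
    using sum_prime_reciprocals_bound by blast
  \<comment> \<open>With \<open>L = ln N\<close>, the condition on \<open>C1\<close> lets the
    truncation order dominate \<open>3 * X\<close>, and the bounds in terms of \<open>L^2\<close>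
    make all errors negligible against the \<open>c / L\<close> of Chebyshev's bound.\<close>
  define good where "good L \<longleftrightarrow> L > 1 \<and> ln L > 1 \<and> ln (ln L) > 0 \<and> 2 * ln L \<ge> 6 * C1 \<and> 4 / L^2 \<le> c / (2 * L) \<and>
     3 * exp ((10 * ln L + 2) * (ln 2 + L / (30 * ln L)) - L) \<le> 1 / L^2 \<and>
     exp (2 * (L / (30 * ln L))) + 1 \<le> exp L / L^2 \<and> exp (L / (31 * ln L)) > 3 \<and>
     exp (L / (30 * ln L)) - 1 \<ge> exp (L / (31 * ln L))" for L :: real
  have "eventually good at_top"
    unfolding good_def
  proof (intro eventually_conj)
    have "eventually (\<lambda>L::real. ln L \<ge> 3 * C1) at_top" by real_asymp
    thus "eventually (\<lambda>L::real. 2 * ln L \<ge> 6 * C1) at_top" by eventually_elim simp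
    have "eventually (\<lambda>L::real. L \<ge> 8 / c) at_top" by real_asymp
    thus "eventually (\<lambda>L::real. 4 / L^2 \<le> c / (2 * L)) at_top"
      using eventually_gt_at_top[of "0::real"]
    proof eventually_elim
      case (elim L)
      thus ?case using c by (simp add: field_simps power2_eq_square)
    qed
  qed real_asymp+
  hence "eventually (\<lambda>N. good (ln (real N))) sequentially"
    by (rule eventually_compose_filterlim) real_asymp
  then obtain N2 where N2: "\<And>N. N \<ge> N2 \<Longrightarrow> good (ln (real N))"
    by (auto simp: eventually_sequentially)
  define C where "C = C1 + ln 31 - ln (c / 2)"
  show ?thesis
  proof (intro exI[of _ C] exI[of _ "max (max N1 N2) 3"] allI impI)
    fix N :: nat and B :: "nat set" and s :: "nat \<Rightarrow> nat"
    assume N: "N \<ge> max (max N1 N2) 3" and B: "B \<subseteq> primes_le (sieve_level N)"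
      and "\<forall>q\<in>B. 0 < s q \<and> s q < q"
      and "\<forall>q\<in>B. \<forall>p. prime p \<longrightarrow> (sieve_level N)^2 < p \<longrightarrow> p < N \<longrightarrow> p mod q \<noteq> s q"
    hence s: "\<And>q. q \<in> B \<Longrightarrow> 0 < s q \<and> s q < q"
      and bad: "\<And>p q. q \<in> B \<Longrightarrow> prime p \<Longrightarrow> (sieve_level N)^2 < p \<Longrightarrow> p < N \<Longrightarrow> p mod q \<noteq> s q"
      by blast+
    define z where "z = sieve_level N"
    define L where "L = ln (real N)"
    have g: "good L" using N2[of N] N by (simp add: L_def)
    have L: "L > 1" "ln L > 1" "ln (ln L) > 0" using g by (auto simp: good_def)
    have NL: "real N = exp L" using N by (simp add: L_def)
    have zle: "real z \<le> exp (L / (30 * ln L))" by (simp add: z_def sieve_level_def L_def)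
    \<comment> \<open>Passing from 30 to 31 absorbs the floor in \<open>sieve_level\<close>.\<close>
    have zge: "real z \<ge> exp (L / (31 * ln L))"
    proof -
      have "exp (L / (30 * ln L)) - 1 \<le> real z" by (simp add: z_def sieve_level_def L_def of_nat_nat)
      thus ?thesis using g unfolding good_def by linarith
    qed
    have z3: "real z > 3" using zge g unfolding good_def by linarith
    define A where "A r = (if r \<in> B then {0, s r} else {0})" for r
    define P where "P = primes_le z"
    have BP: "B \<subseteq> P" using B by (simp add: P_def z_def)
    have cardA: "card (A r) = (if r \<in> B then 2 else 1)" for r
      using s[of r] by (auto simp: A_def card_insert_if)
    define X where "X = (\<Sum>r\<in>P. real (card (A r)) / real r)"
    have Xeq: "X = (\<Sum>r\<in>P. 1 / real r) + (\<Sum>q\<in>B. 1 / real q)"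
    proof -
      have "X = (\<Sum>r\<in>P. 1 / real r + (if r \<in> B then 1 / real r else 0))"
        unfolding X_def by (intro sum.cong) (auto simp: cardA)
      also have "\<dots> = (\<Sum>r\<in>P. 1 / real r) + (\<Sum>r\<in>P. if r \<in> B then 1 / real r else 0)" by (rule sum.distrib)
      also have "(\<Sum>r\<in>P. if r \<in> B then 1 / real r else 0) = (\<Sum>q\<in>B. 1 / real q)"
        by (rule sum.mono_neutral_cong_right) (use BP in \<open>auto simp: P_def\<close>)
      finally show ?thesis .
    qed
    have lnz: "ln (real z) \<le> L / (30 * ln L)" using ln_mono[OF zle] z3 by simp
    have llz: "ln (ln (real z)) \<le> ln L"
    proof -
      have "L / (30 * ln L) \<le> L" using L by (simp add: field_simps)
      moreover have "ln (real z) > 0" using z3 by simp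
      ultimately show ?thesis using lnz by (intro ln_mono) linarith+
    qed
    have llz': "ln (ln (real z)) \<ge> ln L - ln (ln L) - ln 31"
    proof -
      have "L / (31 * ln L) \<le> ln (real z)" using ln_mono[OF zge] z3 by simp
      moreover have "L / (31 * ln L) > 0" using L by simp
      ultimately have "ln (L / (31 * ln L)) \<le> ln (ln (real z))" by (intro ln_mono) linarith+
      moreover have "ln (L / (31 * ln L)) = ln L - (ln 31 + ln (ln L))"
        using L by (simp add: ln_div ln_mult)
      ultimately show ?thesis by simp
    qed
    \<comment> \<open>An a priori bound to fix the truncation order: \<open>B\<close> consists of
      primes up to \<open>z\<close>, so \<open>X\<close> is at most about twice the sum over all of
      these.\<close>
    have "(\<Sum>q\<in>B. 1 / real q) \<le> (\<Sum>r\<in>P. 1 / real r)" using BP by (intro sum_mono2) (auto simp: P_def)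
    moreover have SP: "(\<Sum>r\<in>P. 1 / real r) \<le> ln (ln (real z)) + C1" "(\<Sum>r\<in>P. 1 / real r) \<ge> ln (ln (real z)) - C1"
      using C1(2)[of z] by (auto simp: P_def)
    ultimately have Xle: "X \<le> 2 * ln L + 2 * C1" using Xeq llz by linarith
    \<comment> \<open>Since \<open>3 * X \<le> 6 ln L + 6 * C1 \<le> 8 ln L\<close>, the order
      \<open>10 ln L\<close> leaves a margin of \<open>2 ln L\<close>, hence the factor
      \<open>1 / L^2\<close>.\<close>
    define m where "m = 2 * nat \<lceil>5 * ln L\<rceil>"
    have m: "real m \<ge> 10 * ln L" "real m \<le> 10 * ln L + 2" using L by (auto simp: m_def of_nat_nat) linarith+
    have brun: "real (card {n. n < N \<and> (\<forall>r\<in>P. n mod r \<notin> A r)}) \<le> real N * (exp (-X) + exp (3 * X - real m)) + 3 * (2 * real z) ^ m"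
      unfolding X_def
    proof (rule brun_sieve)
      show "A r \<subseteq> {..<r}" if "r \<in> P" for r
        using s[of r] that by (auto simp: A_def P_def primes_le_def dest: prime_gt_0_nat)
      show "card P \<le> z"
      proof -
        have "P \<subseteq> {1..z}" by (auto simp: P_def primes_le_def dest: prime_gt_0_nat)
        from card_mono[OF _ this] show ?thesis by simp
      qed
    qed (use z3 in \<open>auto simp: P_def primes_le_def cardA m_def\<close>)
    have main: "exp (3 * X - real m) \<le> 1 / L^2"
    proof -
      have "3 * X - real m \<le> - (2 * ln L)" using Xle m g unfolding good_def by linarith
      hence "exp (3 * X - real m) \<le> exp (- (2 * ln L))" by simp
      also have "\<dots> = 1 / L^2" using L by (simp add: exp_minus exp_double inverse_eq_divide)
      finally show ?thesis .
    qed
    have rem: "3 * (2 * real z) ^ m \<le> real N * (1 / L^2)"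
    proof -
      have "(2 * real z) ^ m = exp (real m * (ln 2 + ln (real z)))"
        unfolding exp_of_nat_mult using z3 by (simp add: exp_add)
      also have "real m * (ln 2 + ln (real z)) \<le> (10 * ln L + 2) * (ln 2 + L / (30 * ln L))"
      proof (rule mult_mono)
        show "ln 2 + ln (real z) \<le> ln 2 + L / (30 * ln L)" using lnz by simp
        show "0 \<le> 10 * ln L + 2" "0 \<le> ln 2 + ln (real z)" using L z3 by simp_all
      qed (rule m)
      finally have "3 * (2 * real z) ^ m \<le> 3 * exp ((10 * ln L + 2) * (ln 2 + L / (30 * ln L)))" by simp
      also have "\<dots> = exp L * (3 * exp ((10 * ln L + 2) * (ln 2 + L / (30 * ln L)) - L))"
        by (simp add: exp_diff)
      also have "\<dots> \<le> exp L * (1 / L^2)" using g unfolding good_def by (intro mult_left_mono) auto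
      finally show ?thesis by (simp add: NL)
    qed
    have "real N * (exp (-X) + exp (3 * X - real m)) \<le> real N * (exp (-X) + 1 / L^2)"
      using main by (intro mult_left_mono) auto
    hence sieve: "real (card {n. n < N \<and> (\<forall>r\<in>P. n mod r \<notin> A r)}) \<le> real N * (exp (-X) + 1 / L^2) + real N * (1 / L^2)"
      using brun rem by linarith
    have "primes_le N \<subseteq> {..z^2} \<union> {N} \<union> {n. n < N \<and> (\<forall>r\<in>P. n mod r \<notin> A r)}"
    proof
      fix p assume "p \<in> primes_le N"
      hence p: "prime p" "p \<le> N" by (auto simp: primes_le_def)
      show "p \<in> {..z^2} \<union> {N} \<union> {n. n < N \<and> (\<forall>r\<in>P. n mod r \<notin> A r)}"
      proof (cases "p \<le> z^2 \<or> p = N")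
        case False
        hence p': "z^2 < p" "p < N" using p by auto
        have "p mod r \<notin> A r" if r: "r \<in> P" for r
        proof -
          have rp: "prime r" "r \<le> z" using r by (auto simp: P_def primes_le_def)
          have "r < p"
          proof -
            have "z \<le> z^2" using z3 by (simp add: power2_eq_square)
            thus ?thesis using rp p' by linarith
          qed
          hence "p mod r \<noteq> 0" using p rp by (metis dvd_eq_mod_eq_0 less_irrefl primes_dvd_imp_eq)
          thus ?thesis using bad[of r p] p p' by (auto simp: A_def z_def)
        qed
        thus ?thesis using p' by auto
      qed auto
    qed
    hence "card (primes_le N) \<le> card ({..z^2} \<union> {N} \<union> {n. n < N \<and> (\<forall>r\<in>P. n mod r \<notin> A r)})"
      by (intro card_mono) auto
    also have "\<dots> \<le> (z^2 + 1) + 1 + card {n. n < N \<and> (\<forall>r\<in>P. n mod r \<notin> A r)}"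
      by (intro order_trans[OF card_Un_le] add_mono) auto
    finally have "real (card (primes_le N)) \<le> (real z)^2 + 2 + real (card {n. n < N \<and> (\<forall>r\<in>P. n mod r \<notin> A r)})"
      by (simp flip: of_nat_power)
    moreover have "(real z)^2 + 1 \<le> real N * (1 / L^2)"
    proof -
      have "(real z)^2 \<le> (exp (L / (30 * ln L)))^2" using zle by (intro power_mono) auto
      also have "\<dots> = exp (2 * (L / (30 * ln L)))" by (rule exp_double[symmetric])
      finally show ?thesis using g unfolding good_def NL by simp
    qed
    moreover have "1 \<le> real N * (1 / L^2)" using calculation(2) by (smt (verit) zero_le_power2)
    moreover have "c * real N / L \<le> real (card (primes_le N))" using c(2)[of N] N by (simp add: L_def)
    \<comment> \<open>The \<open>4 / L^2\<close> adds up the tail of the sieve, its remainder,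
      \<open>z^2 + 1\<close> and one further unit.\<close>
    ultimately have "c * real N / L \<le> real N * (exp (-X) + 4 / L^2)" using sieve by (simp add: algebra_simps)
    hence "real N * (c / L) \<le> real N * (exp (-X) + 4 / L^2)" by (simp add: mult.commute)
    moreover have "real N > 0" using N by simp
    ultimately have "c / L \<le> exp (-X) + 4 / L^2" by (simp only: mult_le_cancel_left_pos)
    moreover have "4 / L^2 \<le> c / (2 * L)" using g unfolding good_def by blast
    moreover have "c / L = c / (2 * L) + c / (2 * L)" by simp
    ultimately have "exp (-X) \<ge> c / (2 * L)" by linarith
    hence "ln (c / (2 * L)) \<le> ln (exp (-X))" using c L by (intro ln_mono) auto
    moreover have "ln (c / (2 * L)) = ln (c / 2) - ln L" using c L by (simp add: ln_div ln_mult)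
    ultimately have "X \<le> ln L - ln (c / 2)" by simp
    thus "(\<Sum>q\<in>B. 1 / real q) \<le> ln (ln (ln (real N))) + C"
      using Xeq SP llz' unfolding C_def L_def[symmetric] by linarith
  qed
qed

section \<open>The lower bound\<close>

lemma prime_minus_1_dvd_totient: "prime p \<Longrightarrow> p dvd n \<Longrightarrow> p - 1 dvd totient n"
  using totient_dvd[of p n] by (simp add: totient_prime)

lemma prime_factors_prod_primes:
  fixes S :: "nat set"
  assumes "finite S" "\<And>p. p \<in> S \<Longrightarrow> prime p"
  shows "prime_factors (\<Prod>S) = S"
proof (intro equalityI subsetI)
  fix p assume "p \<in> prime_factors (\<Prod>S)"
  hence p: "prime p" "p dvd \<Prod>S" by (auto simp: in_prime_factors_iff)
  then obtain r where "r \<in> S" "p dvd r" using prime_dvd_prod_iff[OF assms(1) p(1), of "\<lambda>x. x"] by auto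
  thus "p \<in> S" using p assms by (metis primes_dvd_imp_eq)
next
  fix p assume p: "p \<in> S"
  hence "p dvd \<Prod>S" using assms(1) by (intro dvd_prodI)
  moreover have "0 \<notin> S" using assms(2)[of 0] by auto
  hence "\<Prod>S \<noteq> 0" using assms(1) by simp
  ultimately show "p \<in> prime_factors (\<Prod>S)" using p assms by (simp add: in_prime_factors_iff)
qed

lemma dedekind_psi_prod_primes:
  assumes "finite S" "\<And>p. p \<in> S \<Longrightarrow> prime p"
  shows "dedekind_psi (\<Prod>S) = (\<Prod>p\<in>S. p + 1)"
proof -
  have "\<Prod>S > 0" using assms by (auto intro!: prod_pos dest: prime_gt_0_nat)
  moreover have "prime_factors (\<Prod>S) = S" by (rule prime_factors_prod_primes[OF assms])
  ultimately show ?thesis unfolding dedekind_psi_def by (simp only: nonzero_mult_div_cancel_left less_numeral_extra)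
qed

text \<open>Pigeonhole over disjoint blocks. The endpoints \<open>L^(8^j)\<close> give every block
  the shape \<open>(t, t^8]\<close>.\<close>

lemma exists_sparse_block:
  fixes f :: "nat \<Rightarrow> real" and L :: real
  assumes P: "finite P" "\<And>q. q \<in> P \<Longrightarrow> f q \<ge> 0" and L: "L \<ge> 1"
    and bound: "(\<Sum>q\<in>P. f q) \<le> e * real (J - j0)" and J: "j0 < J"
  shows "\<exists>j\<in>{j0..<J}. (\<Sum>q | q \<in> P \<and> L ^ 8 ^ j < real q \<and> real q \<le> L ^ 8 ^ Suc j. f q) \<le> e"
proof (rule ccontr)
  define W where "W j = {q. q \<in> P \<and> L ^ 8 ^ j < real q \<and> real q \<le> L ^ 8 ^ Suc j}" for j
  assume "\<not> ?thesis"
  hence "(\<Sum>j\<in>{j0..<J}. e) < (\<Sum>j\<in>{j0..<J}. \<Sum>q\<in>W j. f q)"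
    using J by (intro sum_strict_mono) (auto simp: W_def not_le)
  also have "\<dots> = (\<Sum>q\<in>(\<Union>j\<in>{j0..<J}. W j). f q)"
  proof (rule sum.UNION_disjoint[symmetric])
    have "W i \<inter> W j = {}" if "i < j" for i j
    proof -
      have "L ^ 8 ^ Suc i \<le> L ^ 8 ^ j" using that L by (intro power_increasing) auto
      thus ?thesis by (auto simp: W_def)
    qed
    thus "\<forall>i\<in>{j0..<J}. \<forall>j\<in>{j0..<J}. i \<noteq> j \<longrightarrow> W i \<inter> W j = {}" by (metis Int_commute nat_neq_iff)
  qed (use P in \<open>auto simp: W_def\<close>)
  also have "\<dots> \<le> (\<Sum>q\<in>P. f q)" by (rule sum_mono2) (use P in \<open>auto simp: W_def\<close>)
  finally show False using bound by (simp add: mult.commute)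
qed

text \<open>\<open>D q p\<close> stands for \<open>q dvd p - 1\<close> or \<open>q dvd p + 1\<close>; \<open>B\<close> is the set of primes missed by the sieve.\<close>
lemma exists_collecting_set:
  fixes t L :: real and D :: "nat \<Rightarrow> nat \<Rightarrow> bool"
  assumes t: "t \<ge> 2"
    and small: "\<And>q y. prime q \<Longrightarrow> q \<le> y \<Longrightarrow> \<exists>p. prime p \<and> p > y \<and> D q p \<and> p \<le> 4 ^ ((y + 1) * q)"
    and large: "\<And>q. prime q \<Longrightarrow> real q > t \<Longrightarrow> real q \<le> t^8 \<Longrightarrow> q \<notin> B \<Longrightarrow> \<exists>p. prime p \<and> real p > (t^8)^2 \<and> ln (real p) \<le> L \<and> D q p"
  shows "\<exists>S. finite S \<and> (\<forall>p\<in>S. prime p \<and> real p > t^2) \<and>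
     (\<forall>q. prime q \<longrightarrow> real q \<le> t^8 \<longrightarrow> \<not> (real q > t \<and> q \<in> B) \<longrightarrow> (\<exists>p\<in>S. D q p)) \<and>
     (\<Sum>p\<in>S. ln (real p)) \<le> 4 * t^8 + t^8 * \<bar>L\<bar> \<and> (\<Sum>p\<in>S. 1 / real p) \<le> 2 / t"
proof -
  \<comment> \<open>The explicit primes must exceed \<open>t^2\<close>, because up to
    \<open>t\<close> of them are used: their reciprocals then sum to at most
    \<open>1/t\<close>.\<close>
  define y where "y = nat \<lfloor>t^2\<rfloor>"
  have y: "real y \<le> t^2" "t^2 < real y + 1" by (auto simp: y_def)
  define Q1 where "Q1 = {q. prime q \<and> real q \<le> t}"
  define Q2 where "Q2 = {q. prime q \<and> real q > t \<and> real q \<le> t^8 \<and> q \<notin> B}"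
  have Q1: "Q1 \<subseteq> {1..nat \<lfloor>t\<rfloor>}" using t by (auto simp: Q1_def le_nat_iff le_floor_iff dest: prime_gt_0_nat)
  have Q2: "Q2 \<subseteq> {1..nat \<lfloor>t^8\<rfloor>}" using t by (auto simp: Q2_def le_nat_iff le_floor_iff dest: prime_gt_0_nat)
  have fin: "finite Q1" "finite Q2" using finite_subset[OF Q1] finite_subset[OF Q2] by auto
  have c1: "real (card Q1) \<le> t" using card_mono[OF _ Q1] t by (simp add: le_nat_iff le_floor_iff)
  have c2: "real (card Q2) \<le> t^8" using card_mono[OF _ Q2] t by (simp add: le_nat_iff le_floor_iff)
  have tt: "t \<le> t^2" using t by (simp add: power2_eq_square)
  have "\<forall>q\<in>Q1. \<exists>p. prime p \<and> p > y \<and> D q p \<and> p \<le> 4 ^ ((y + 1) * q)"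
  proof
    fix q assume "q \<in> Q1"
    hence q: "prime q" "real q \<le> t^2" using tt by (auto simp: Q1_def)
    have "q \<le> y" using q unfolding y_def by (simp add: le_nat_iff le_floor_iff)
    thus "\<exists>p. prime p \<and> p > y \<and> D q p \<and> p \<le> 4 ^ ((y + 1) * q)" using small q by blast
  qed
  then obtain g1 where g1: "\<And>q. q \<in> Q1 \<Longrightarrow> prime (g1 q) \<and> g1 q > y \<and> D q (g1 q) \<and> g1 q \<le> 4 ^ ((y + 1) * q)"
    by metis
  have "\<forall>q\<in>Q2. \<exists>p. prime p \<and> real p > (t^8)^2 \<and> ln (real p) \<le> L \<and> D q p"
    using large by (auto simp: Q2_def)
  then obtain g2 where g2: "\<And>q. q \<in> Q2 \<Longrightarrow> prime (g2 q) \<and> real (g2 q) > (t^8)^2 \<and> ln (real (g2 q)) \<le> L \<and> D q (g2 q)"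
    by metis
  define S where "S = g1 ` Q1 \<union> g2 ` Q2"
  \<comment> \<open>Several \<open>q\<close> may share one prime \<open>p\<close>, so a sum over
    \<open>S\<close> is only bounded by the sum over the \<open>q\<close>.\<close>
  have sumS: "(\<Sum>p\<in>S. h p) \<le> (\<Sum>q\<in>Q1. h (g1 q)) + (\<Sum>q\<in>Q2. h (g2 q))"
    if h: "\<And>p. prime p \<Longrightarrow> h p \<ge> 0" for h :: "nat \<Rightarrow> real"
  proof -
    have nn: "h p \<ge> 0" if "p \<in> S" for p using that g1 g2 h by (auto simp: S_def)
    have "(\<Sum>p\<in>S. h p) \<le> (\<Sum>p\<in>g1 ` Q1. h p) + (\<Sum>p\<in>g2 ` Q2. h p)"
      unfolding S_def using fin nn by (subst sum_Un) (auto simp: S_def intro!: sum_nonneg)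
    also have "(\<Sum>p\<in>g1 ` Q1. h p) \<le> (\<Sum>q\<in>Q1. h (g1 q))"
      using sum_image_le[of Q1 h g1] fin g1 h by (auto simp: o_def)
    also have "(\<Sum>p\<in>g2 ` Q2. h p) \<le> (\<Sum>q\<in>Q2. h (g2 q))"
      using sum_image_le[of Q2 h g2] fin g2 h by (auto simp: o_def)
    finally show ?thesis by simp
  qed
  have t8: "t^2 \<le> (t^8)^2" using t by (simp add: power_increasing flip: power_mult)
  have big: "prime p \<and> real p > t^2" if pS: "p \<in> S" for p
  proof -
    consider q where "q \<in> Q1" "p = g1 q" | q where "q \<in> Q2" "p = g2 q"
      using pS unfolding S_def by blast
    thus ?thesis
    proof cases
      case 1
      hence "prime p" "real y + 1 \<le> real p" using g1[of q] by auto
      thus ?thesis using y by linarith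
    next
      case 2
      thus ?thesis using g2[of q] t8 by auto
    qed
  qed
  have ln4: "ln (4::real) \<le> 2"
  proof -
    have "ln (4::real) = 2 * ln 2" using ln_realpow[of 2 2] by simp
    thus ?thesis using ln_2_less_1 by linarith
  qed
  have l1: "(\<Sum>q\<in>Q1. ln (real (g1 q))) \<le> 4 * t^8"
  proof -
    \<comment> \<open>Each \<open>ln p\<close> is at most of order \<open>t^3\<close>, for at most
      \<open>t\<close> values of \<open>q\<close>. The total of order \<open>t^4\<close> is well
      within the allowance \<open>t^8\<close>, which is why the block may start at the eighth root
      of its end.\<close>
    have "(\<Sum>q\<in>Q1. ln (real (g1 q))) \<le> (\<Sum>q\<in>Q1. (t^2 + 1) * t * 2)"
    proof (rule sum_mono)
      fix q assume q: "q \<in> Q1"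
      have "real (g1 q) \<le> real (4 ^ ((y + 1) * q))" using g1[OF q] by (simp only: of_nat_le_iff)
      hence "ln (real (g1 q)) \<le> ln (real (4 ^ ((y + 1) * q)))"
        using g1[OF q] prime_gt_0_nat by (intro ln_mono) auto
      also have "\<dots> = ln (4 ^ ((y + 1) * q))" by simp
      also have "\<dots> = real ((y + 1) * q) * ln 4" by (rule ln_realpow)
      also have "\<dots> = (real y + 1) * real q * ln 4" by (simp only: of_nat_mult of_nat_add of_nat_1)
      also have "\<dots> \<le> (t^2 + 1) * t * 2" using y q ln4 t by (intro mult_mono) (auto simp: Q1_def)
      finally show "ln (real (g1 q)) \<le> (t^2 + 1) * t * 2" .
    qed
    also have "\<dots> = real (card Q1) * ((t^2 + 1) * t * 2)" by simp
    also have "\<dots> \<le> t * ((t^2 + 1) * t * 2)" using c1 t by (intro mult_right_mono) auto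
    also have "\<dots> = 2 * t^4 + 2 * t^2" by (simp add: algebra_simps power2_eq_square power4_eq_xxxx)
    also have "\<dots> \<le> 2 * t^8 + 2 * t^8" using t by (intro add_mono mult_left_mono power_increasing) auto
    finally show ?thesis by simp
  qed
  have l2: "(\<Sum>q\<in>Q2. ln (real (g2 q))) \<le> t^8 * \<bar>L\<bar>"
  proof -
    have "(\<Sum>q\<in>Q2. ln (real (g2 q))) \<le> (\<Sum>q\<in>Q2. \<bar>L\<bar>)" by (rule sum_mono) (use g2 in fastforce)
    also have "\<dots> \<le> t^8 * \<bar>L\<bar>" using c2 by (simp add: mult_right_mono)
    finally show ?thesis .
  qed
  have r1: "(\<Sum>q\<in>Q1. 1 / real (g1 q)) \<le> 1 / t"
  proof -
    have "(\<Sum>q\<in>Q1. 1 / real (g1 q)) \<le> (\<Sum>q\<in>Q1. 1 / t^2)"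
    proof (rule sum_mono)
      fix q assume "q \<in> Q1"
      hence "real (g1 q) \<ge> t^2" using big[of "g1 q"] by (auto simp: S_def)
      moreover have "0 < t^2" using t by simp
      ultimately show "1 / real (g1 q) \<le> 1 / t^2" by (intro divide_left_mono mult_pos_pos) linarith+
    qed
    also have "\<dots> = real (card Q1) * (1 / t^2)" by simp
    also have "\<dots> \<le> t * (1 / t^2)" using c1 by (intro mult_right_mono) auto
    also have "\<dots> = 1 / t" using t by (simp add: power2_eq_square)
    finally show ?thesis .
  qed
  have r2: "(\<Sum>q\<in>Q2. 1 / real (g2 q)) \<le> 1 / t"
  proof -
    \<comment> \<open>Up to \<open>t^8\<close> primes occur here, which is why \<open>large\<close>
      asks for \<open>p > (t^8)^2\<close>.\<close>
    have "(\<Sum>q\<in>Q2. 1 / real (g2 q)) \<le> (\<Sum>q\<in>Q2. 1 / (t^8)^2)"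
    proof (rule sum_mono)
      fix q assume "q \<in> Q2"
      hence "real (g2 q) \<ge> (t^8)^2" using g2[of q] by auto
      moreover have "0 < (t^8)^2" using t by simp
      ultimately show "1 / real (g2 q) \<le> 1 / (t^8)^2" by (intro divide_left_mono mult_pos_pos) linarith+
    qed
    also have "\<dots> = real (card Q2) * (1 / (t^8)^2)" by simp
    also have "\<dots> \<le> t^8 * (1 / (t^8)^2)" using c2 by (intro mult_right_mono) auto
    also have "\<dots> = 1 / t^8"
    proof -
      have "a * (1 / a^2) = 1 / a" for a :: real by (simp add: power2_eq_square)
      thus ?thesis .
    qed
    also have "\<dots> \<le> 1 / t^1" using t by (intro divide_left_mono power_increasing mult_pos_pos) auto
    finally show ?thesis by simp
  qed
  have "(\<Sum>p\<in>S. ln (real p)) \<le> 4 * t^8 + t^8 * \<bar>L\<bar>"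
  proof (rule order_trans[OF sumS add_mono[OF l1 l2]])
    fix p :: nat assume "prime p" thus "0 \<le> ln (real p)" using prime_ge_1_nat[of p] by simp
  qed
  moreover have "(\<Sum>p\<in>S. 1 / real p) \<le> 2 / t"
    using order_trans[OF sumS[of "\<lambda>p. 1 / real p"] add_mono[OF r1 r2]] by simp
  moreover have "\<exists>p\<in>S. D q p" if "prime q" "real q \<le> t^8" "\<not> (real q > t \<and> q \<in> B)" for q
  proof (cases "real q \<le> t")
    case True
    hence "q \<in> Q1" using that by (simp add: Q1_def)
    thus ?thesis using g1[of q] by (auto simp: S_def)
  next
    case False
    hence "q \<in> Q2" using that by (simp add: Q2_def)
    thus ?thesis using g2[of q] by (auto simp: S_def)
  qed
  moreover have "finite S" using fin by (simp add: S_def)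
  ultimately show ?thesis using big by (intro exI[of _ S]) blast
qed

text \<open>\<open>L\<close> stands for \<open>ln N\<close>. The condition on
  \<open>2 * (ln (ln L) + C)\<close> says that the mass missed in both classes averages to at most
  \<open>e\<close> per block. The blocks end by \<open>exp (sqrt L * ln L)\<close>, which is below
  the sieve level. The last condition, at \<open>x = t^8\<close>, absorbs the constants in the bound
  for \<open>ln n\<close> and the passage to the integer part of \<open>x\<close>.\<close>

lemma sieve_parameters_eventually:
  fixes e C :: real and j0 X0 :: nat
  assumes e: "e > 0"
  shows "eventually (\<lambda>L. L \<ge> real X0 + 2 \<and> L \<ge> 2 \<and> 4 / L \<le> e \<and> ln L > 1 \<and>
     2 * (ln (ln L) + C) \<le> e * (ln L / (2 * ln 8) - 1 - real j0) \<and> ln L / (2 * ln 8) - 2 - real j0 > 0 \<and>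
     exp (sqrt L * ln L) \<le> exp (L / (30 * ln L)) - 1 \<and>
     (\<forall>x\<ge>L. 8 * x + 2 * x powr (1 + e / 2) \<le> (x - 1) powr (1 + e))) at_top"
proof (intro eventually_conj)
  show "eventually (\<lambda>L::real. L \<ge> real X0 + 2) at_top" by (rule eventually_ge_at_top)
  show "eventually (\<lambda>L::real. L \<ge> 2) at_top" by (rule eventually_ge_at_top)
  have "((\<lambda>L::real. 4 / L) \<longlongrightarrow> 0) at_top" by real_asymp
  hence "eventually (\<lambda>L::real. 4 / L < e) at_top" using e by (intro order_tendstoD)
  thus "eventually (\<lambda>L::real. 4 / L \<le> e) at_top" by eventually_elim simp
  have "((\<lambda>L::real. 2 * (ln (ln L) + C) / (ln L / (2 * ln 8) - 1 - real j0)) \<longlongrightarrow> 0) at_top" by real_asymp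
  hence "eventually (\<lambda>L::real. 2 * (ln (ln L) + C) / (ln L / (2 * ln 8) - 1 - real j0) < e) at_top"
    using e by (intro order_tendstoD)
  moreover have "eventually (\<lambda>L::real. ln L / (2 * ln 8) - 1 - real j0 > 0) at_top" by real_asymp
  ultimately show "eventually (\<lambda>L. 2 * (ln (ln L) + C) \<le> e * (ln L / (2 * ln 8) - 1 - real j0)) at_top"
    by eventually_elim (simp add: pos_divide_less_eq)
  show "eventually (\<lambda>L::real. ln L > 1) at_top" by real_asymp
  show "eventually (\<lambda>L::real. ln L / (2 * ln 8) - 2 - real j0 > 0) at_top" by real_asymp
  show "eventually (\<lambda>L::real. exp (sqrt L * ln L) \<le> exp (L / (30 * ln L)) - 1) at_top" by real_asymp
  have "((\<lambda>x::real. (8 * x + 2 * x powr (1 + e / 2)) / (x - 1) powr (1 + e)) \<longlongrightarrow> 0) at_top"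
    using e by real_asymp
  hence "eventually (\<lambda>x::real. (8 * x + 2 * x powr (1 + e / 2)) / (x - 1) powr (1 + e) < 1) at_top"
    by (intro order_tendstoD) auto
  hence "eventually (\<lambda>x::real. 8 * x + 2 * x powr (1 + e / 2) \<le> (x - 1) powr (1 + e)) at_top"
    using eventually_gt_at_top[of "1::real"] by eventually_elim (simp add: pos_divide_less_eq)
  thus "eventually (\<lambda>L. \<forall>x\<ge>L. 8 * x + 2 * x powr (1 + e / 2) \<le> (x - 1) powr (1 + e)) at_top"
    by (rule eventually_all_ge_at_top)
qed

text \<open>The integer is a product of distinct primes, so that \<open>dedekind_psi n\<close> is
  the product of the \<open>p + 1\<close>, just as each \<open>p - 1\<close> divides
  \<open>totient n\<close>.\<close>

theorem exists_extremal_integer: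
  fixes e :: real and X0 :: nat
  assumes e: "e > 0"
  shows "\<exists>n K. K \<ge> X0 \<and> n \<ge> X0 \<and> ln (real n) \<le> real K powr (1 + e) \<and>
     (\<Sum>q | q \<in> primes_le K \<and> \<not> q dvd totient n. 1 / real q) \<le> e \<and>
     (\<Sum>q | q \<in> primes_le K \<and> \<not> q dvd dedekind_psi n. 1 / real q) \<le> e \<and>
     (\<Sum>p\<in>prime_factors n. 1 / real p) \<le> e"
proof -
  obtain C :: real and N0 :: nat where sieve: "\<forall>N\<ge>N0. \<forall>B s. B \<subseteq> primes_le (sieve_level N) \<longrightarrow> (\<forall>q\<in>B. 0 < s q \<and> s q < q) \<longrightarrow>
       (\<forall>q\<in>B. \<forall>p. prime p \<longrightarrow> (sieve_level N)^2 < p \<longrightarrow> p < N \<longrightarrow> p mod q \<noteq> s q) \<longrightarrow>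
       (\<Sum>q\<in>B. 1 / real q) \<le> ln (ln (ln (real N))) + C"
    using sum_missed_primes_le by blast
  \<comment> \<open>Blocks before \<open>j0\<close> are discarded: for \<open>j \<ge> j0\<close> the
    bound \<open>L\<close> on \<open>ln p\<close> is at most \<open>x^(e/2)\<close> with
    \<open>x = t^8\<close>, which keeps \<open>ln n\<close> within \<open>x^(1+e)\<close>.\<close>
  obtain j0 where j0: "2 / e < 8 ^ j0" using real_arch_pow[of 8 "2 / e"] by auto
  define good where "good L \<longleftrightarrow> L \<ge> real X0 + 2 \<and> L \<ge> 2 \<and> 4 / L \<le> e \<and> ln L > 1 \<and>
     2 * (ln (ln L) + C) \<le> e * (ln L / (2 * ln 8) - 1 - real j0) \<and> ln L / (2 * ln 8) - 2 - real j0 > 0 \<and>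
     exp (sqrt L * ln L) \<le> exp (L / (30 * ln L)) - 1 \<and>
     (\<forall>x\<ge>L. 8 * x + 2 * x powr (1 + e / 2) \<le> (x - 1) powr (1 + e))" for L
  have "eventually good at_top"
    unfolding good_def by (rule sieve_parameters_eventually[OF e])
  hence "eventually (\<lambda>N. good (ln (real N))) sequentially"
    by (rule eventually_compose_filterlim) real_asymp
  hence "eventually (\<lambda>N. good (ln (real N)) \<and> N \<ge> N0) sequentially"
    using eventually_ge_at_top by (rule eventually_conj)
  then obtain N where N: "good (ln (real N))" "N \<ge> N0"
    using eventually_happens'[OF sequentially_bot] by blast
  define L where "L = ln (real N)"
  have g: "L \<ge> real X0 + 2" "L \<ge> 2" "4 / L \<le> e" "ln L > 1"
     "2 * (ln (ln L) + C) \<le> e * (ln L / (2 * ln 8) - 1 - real j0)" "ln L / (2 * ln 8) - 2 - real j0 > 0"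
     "exp (sqrt L * ln L) \<le> exp (L / (30 * ln L)) - 1"
     "\<And>x. x \<ge> L \<Longrightarrow> 8 * x + 2 * x powr (1 + e / 2) \<le> (x - 1) powr (1 + e)"
    using N(1) unfolding good_def L_def[symmetric] by blast+
  define z where "z = sieve_level N"
  \<comment> \<open>Chosen so that \<open>8^J \<le> sqrt L\<close>: the last block still ends below
    \<open>z\<close>, and the number of blocks remains of order \<open>ln L\<close>.\<close>
  define J where "J = nat \<lfloor>ln L / (2 * ln 8)\<rfloor>"
  have J: "real J \<le> ln L / (2 * ln 8)" "real J > ln L / (2 * ln 8) - 1"
    using g(4) by (auto simp: J_def of_nat_nat)
  have jJ: "j0 < J" "real (J - j0) \<ge> ln L / (2 * ln 8) - 1 - real j0"
    using J g(6) by (auto simp: of_nat_diff)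
  have zJ: "L ^ 8 ^ J \<le> real z"
  proof -
    have "(8::real) ^ J = exp (real J * ln 8)" unfolding exp_of_nat_mult by simp
    also have "\<dots> \<le> exp (ln L / 2)" using J(1) by (simp add: field_simps)
    also have "\<dots> = sqrt L" using g(2) by (simp add: ln_sqrt[symmetric])
    finally have "real (8 ^ J) * ln L \<le> sqrt L * ln L" using g(4) by (intro mult_right_mono) auto
    hence "exp (real (8 ^ J) * ln L) \<le> exp (sqrt L * ln L)" by simp
    also have "exp (real (8 ^ J) * ln L) = L ^ 8 ^ J" unfolding exp_of_nat_mult using g(2) by simp
    also have "exp (sqrt L * ln L) \<le> exp (L / (30 * ln L)) - 1" by (rule g(7))
    also have "\<dots> \<le> real z" by (simp add: z_def sieve_level_def L_def of_nat_nat)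
    finally show ?thesis .
  qed
  define B where "B s = {q \<in> primes_le z. \<forall>p. prime p \<longrightarrow> z^2 < p \<longrightarrow> p < N \<longrightarrow> p mod q \<noteq> s q}" for s :: "nat \<Rightarrow> nat"
  have Bsum: "(\<Sum>q\<in>B s. 1 / real q) \<le> ln (ln L) + C" if "\<And>q. prime q \<Longrightarrow> 0 < s q \<and> s q < q" for s
    unfolding L_def
  proof (rule sieve[rule_format, OF N(2), where s = s])
    show "B s \<subseteq> primes_le (sieve_level N)" by (auto simp: B_def z_def)
  qed (use that in \<open>auto simp: B_def primes_le_def z_def\<close>)
  define s1 :: "nat \<Rightarrow> nat" where "s1 = (\<lambda>q. 1)"
  define s2 :: "nat \<Rightarrow> nat" where "s2 = (\<lambda>q. q - 1)"
  \<comment> \<open>One weight for the misses in both classes, so that a single block serves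
    \<open>totient n\<close> and \<open>dedekind_psi n\<close> alike.\<close>
  define f where "f q = (if q \<in> B s1 then 1 / real q else 0) + (if q \<in> B s2 then 1 / real q else 0)" for q
  have "(\<Sum>q\<in>primes_le z. f q) = (\<Sum>q\<in>B s1. 1 / real q) + (\<Sum>q\<in>B s2. 1 / real q)"
  proof -
    have "(\<Sum>q\<in>primes_le z. if q \<in> B s then 1 / real q else 0) = (\<Sum>q\<in>B s. 1 / real q)" for s
      by (rule sum.mono_neutral_cong_right) (auto simp: B_def)
    thus ?thesis by (simp add: f_def sum.distrib)
  qed
  also have "\<dots> \<le> (ln (ln L) + C) + (ln (ln L) + C)"
    by (intro add_mono Bsum) (auto simp: s1_def s2_def dest: prime_gt_1_nat)
  also have "\<dots> \<le> e * (ln L / (2 * ln 8) - 1 - real j0)" using g(5) by simp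
  also have "\<dots> \<le> e * real (J - j0)" using jJ(2) e by (intro mult_left_mono) auto
  finally have fsum: "(\<Sum>q\<in>primes_le z. f q) \<le> e * real (J - j0)" .
  have "\<exists>j\<in>{j0..<J}. (\<Sum>q | q \<in> primes_le z \<and> L ^ 8 ^ j < real q \<and> real q \<le> L ^ 8 ^ Suc j. f q) \<le> e"
    by (rule exists_sparse_block[OF _ _ _ fsum jJ(1)]) (use g(2) in \<open>auto simp: f_def\<close>)
  then obtain j where j: "j0 \<le> j" "j < J"
    "(\<Sum>q | q \<in> primes_le z \<and> L ^ 8 ^ j < real q \<and> real q \<le> L ^ 8 ^ Suc j. f q) \<le> e"
    by auto
  define t where "t = L ^ 8 ^ j"
  have x: "t^8 = L ^ 8 ^ Suc j" by (simp add: t_def flip: power_mult power_Suc2)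
  have tL: "t \<ge> L"
  proof -
    have "L ^ 1 \<le> L ^ 8 ^ j" using g(2) by (intro power_increasing) auto
    thus ?thesis by (simp add: t_def)
  qed
  have t2: "t \<ge> 2" using tL g(2) by linarith
  have t8: "t \<le> t^8" using t2 power_increasing[of 1 8 t] by simp
  have xz: "t^8 \<le> real z"
  proof -
    have "L ^ 8 ^ Suc j \<le> L ^ 8 ^ J" using j(2) g(2) by (intro power_increasing) auto
    thus ?thesis using zJ x by linarith
  qed
  define K where "K = nat \<lfloor>t^8\<rfloor>"
  have K: "real K \<le> t^8" "real K > t^8 - 1" using t2 by (auto simp: K_def of_nat_nat)
  have Kz: "K \<le> z" using K(1) xz by linarith
  have large: "\<exists>p. prime p \<and> real p > (t^8)^2 \<and> ln (real p) \<le> L \<and> p mod q = s q"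
    if q: "prime q" "real q > t" "real q \<le> t^8" "q \<notin> B s" for q s
  proof -
    have "q \<in> primes_le z" using q xz by (simp add: primes_le_def)
    then obtain p where p: "prime p" "z^2 < p" "p < N" "p mod q = s q" using q(4) by (auto simp: B_def)
    have "(t^8)^2 \<le> (real z)^2" using xz t2 by (intro power_mono) auto
    also have "\<dots> < real p" using p(2) by (simp flip: of_nat_power)
    finally have "real p > (t^8)^2" .
    moreover have "ln (real p) \<le> L" unfolding L_def using p prime_gt_0_nat[OF p(1)] by (intro ln_mono) auto
    ultimately show ?thesis using p by blast
  qed
  have "\<exists>S. finite S \<and> (\<forall>p\<in>S. prime p \<and> real p > t^2) \<and>
     (\<forall>q. prime q \<longrightarrow> real q \<le> t^8 \<longrightarrow> \<not> (real q > t \<and> q \<in> B s1) \<longrightarrow> (\<exists>p\<in>S. q dvd p - 1)) \<and>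
     (\<Sum>p\<in>S. ln (real p)) \<le> 4 * t^8 + t^8 * \<bar>L\<bar> \<and> (\<Sum>p\<in>S. 1 / real p) \<le> 2 / t"
  proof (rule exists_collecting_set[OF t2])
    fix q :: nat assume q: "prime q" "real q > t" "real q \<le> t^8" "q \<notin> B s1"
    then obtain p where p: "prime p" "real p > (t^8)^2" "ln (real p) \<le> L" "p mod q = 1"
      using large[of q s1] by (auto simp: s1_def)
    have "q dvd p - 1" using p(4) by (metis mod_eq_dvd_iff_nat mod_mod_trivial mod_less_eq_dividend)
    thus "\<exists>p. prime p \<and> real p > (t^8)^2 \<and> ln (real p) \<le> L \<and> q dvd p - 1" using p by blast
  qed (use exists_prime_cong_1 in blast)
  then obtain S1 where S1: "finite S1" "\<And>p. p \<in> S1 \<Longrightarrow> prime p \<and> real p > t^2"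
     "\<And>q. prime q \<Longrightarrow> real q \<le> t^8 \<Longrightarrow> \<not> (real q > t \<and> q \<in> B s1) \<Longrightarrow> \<exists>p\<in>S1. q dvd p - 1"
     "(\<Sum>p\<in>S1. ln (real p)) \<le> 4 * t^8 + t^8 * \<bar>L\<bar>" "(\<Sum>p\<in>S1. 1 / real p) \<le> 2 / t"
    by auto
  have "\<exists>S. finite S \<and> (\<forall>p\<in>S. prime p \<and> real p > t^2) \<and>
     (\<forall>q. prime q \<longrightarrow> real q \<le> t^8 \<longrightarrow> \<not> (real q > t \<and> q \<in> B s2) \<longrightarrow> (\<exists>p\<in>S. q dvd p + 1)) \<and>
     (\<Sum>p\<in>S. ln (real p)) \<le> 4 * t^8 + t^8 * \<bar>L\<bar> \<and> (\<Sum>p\<in>S. 1 / real p) \<le> 2 / t"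
  proof (rule exists_collecting_set[OF t2])
    fix q :: nat assume q: "prime q" "real q > t" "real q \<le> t^8" "q \<notin> B s2"
    then obtain p where p: "prime p" "real p > (t^8)^2" "ln (real p) \<le> L" "p mod q = q - 1"
      using large[of q s2] by (auto simp: s2_def)
    have "(p + 1) mod q = 0" using p(4) prime_gt_1_nat[OF q(1)] by (simp add: mod_Suc)
    hence "q dvd p + 1" by (simp only: dvd_eq_mod_eq_0)
    thus "\<exists>p. prime p \<and> real p > (t^8)^2 \<and> ln (real p) \<le> L \<and> q dvd p + 1" using p by blast
  qed (use exists_prime_cong_minus_1 in blast)
  then obtain S2 where S2: "finite S2" "\<And>p. p \<in> S2 \<Longrightarrow> prime p \<and> real p > t^2"
     "\<And>q. prime q \<Longrightarrow> real q \<le> t^8 \<Longrightarrow> \<not> (real q > t \<and> q \<in> B s2) \<Longrightarrow> \<exists>p\<in>S2. q dvd p + 1"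
     "(\<Sum>p\<in>S2. ln (real p)) \<le> 4 * t^8 + t^8 * \<bar>L\<bar>" "(\<Sum>p\<in>S2. 1 / real p) \<le> 2 / t"
    by auto
  define S where "S = S1 \<union> S2"
  have S: "finite S" "\<And>p. p \<in> S \<Longrightarrow> prime p" using S1(1,2) S2(1,2) by (auto simp: S_def)
  define n where "n = \<Prod>S"
  have npf: "prime_factors n = S" unfolding n_def by (rule prime_factors_prod_primes[OF S])
  have npos: "n > 0" unfolding n_def using S by (auto intro!: prod_pos dest: prime_gt_0_nat)
  have dvd_n: "p dvd n" if "p \<in> S" for p unfolding n_def using S(1) that by (intro dvd_prodI)
  have sumS: "(\<Sum>p\<in>S. h p) \<le> (\<Sum>p\<in>S1. h p) + (\<Sum>p\<in>S2. h p)" if "\<And>p. prime p \<Longrightarrow> h p \<ge> 0" for h :: "nat \<Rightarrow> real"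
    unfolding S_def using S1(1,2) S2(1,2) that by (subst sum_Un) (auto intro!: sum_nonneg)
  \<comment> \<open>Every prime up to \<open>t\<close> is served by the explicit construction, so a
    prime up to \<open>K\<close> that fails \<open>R\<close> lies in the chosen block and in
    \<open>B s\<close>, where \<open>f\<close> counts it.\<close>
  have miss: "(\<Sum>q | q \<in> primes_le K \<and> \<not> R q. 1 / real q) \<le> e"
    if R: "\<And>q. prime q \<Longrightarrow> real q \<le> t^8 \<Longrightarrow> \<not> (real q > t \<and> q \<in> B s) \<Longrightarrow> R q" and s: "s = s1 \<or> s = s2" for R s
  proof -
    have "(\<Sum>q | q \<in> primes_le K \<and> \<not> R q. 1 / real q) \<le> (\<Sum>q | q \<in> primes_le K \<and> \<not> R q. f q)"
    proof (rule sum_mono)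
      fix q assume "q \<in> {q. q \<in> primes_le K \<and> \<not> R q}"
      hence q: "prime q" "q \<le> K" "\<not> R q" by (auto simp: primes_le_def)
      have "real q \<le> t^8" using q(2) K(1) by linarith
      hence "q \<in> B s" using R q by blast
      thus "1 / real q \<le> f q" using s by (auto simp: f_def)
    qed
    also have "\<dots> \<le> (\<Sum>q | q \<in> primes_le z \<and> L ^ 8 ^ j < real q \<and> real q \<le> L ^ 8 ^ Suc j. f q)"
    proof (rule sum_mono2)
      show "{q. q \<in> primes_le K \<and> \<not> R q} \<subseteq> {q. q \<in> primes_le z \<and> L ^ 8 ^ j < real q \<and> real q \<le> L ^ 8 ^ Suc j}"
      proof
        fix q assume "q \<in> {q. q \<in> primes_le K \<and> \<not> R q}"
        hence q: "prime q" "q \<le> K" "\<not> R q" by (auto simp: primes_le_def)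
        have q8: "real q \<le> t^8" using q(2) K(1) by linarith
        hence "real q > t" using R q by blast
        hence "L ^ 8 ^ j < real q" by (simp only: t_def)
        moreover have "real q \<le> L ^ 8 ^ Suc j" using q8 by (simp only: x)
        moreover have "q \<in> primes_le z" using q Kz by (simp add: primes_le_def)
        ultimately show "q \<in> {q. q \<in> primes_le z \<and> L ^ 8 ^ j < real q \<and> real q \<le> L ^ 8 ^ Suc j}"
          by blast
      qed
    qed (auto simp: f_def)
    also have "\<dots> \<le> e" by (rule j(3))
    finally show ?thesis .
  qed
  have tot: "(\<Sum>q | q \<in> primes_le K \<and> \<not> q dvd totient n. 1 / real q) \<le> e"
  proof (rule miss[of s1])
    fix q assume q: "prime q" "real q \<le> t^8" "\<not> (real q > t \<and> q \<in> B s1)"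
    then obtain p where p: "p \<in> S1" "q dvd p - 1" using S1(3) by blast
    have "p - 1 dvd totient n" using p S dvd_n by (intro prime_minus_1_dvd_totient) (auto simp: S_def)
    thus "q dvd totient n" using p(2) dvd_trans by blast
  qed simp
  have psi: "(\<Sum>q | q \<in> primes_le K \<and> \<not> q dvd dedekind_psi n. 1 / real q) \<le> e"
  proof (rule miss[of s2])
    fix q assume q: "prime q" "real q \<le> t^8" "\<not> (real q > t \<and> q \<in> B s2)"
    then obtain p where p: "p \<in> S2" "q dvd p + 1" using S2(3) by blast
    have "p + 1 dvd (\<Prod>p\<in>S. p + 1)" using S(1) p by (intro dvd_prodI) (auto simp: S_def)
    also have "(\<Prod>p\<in>S. p + 1) = dedekind_psi n" unfolding n_def by (rule dedekind_psi_prod_primes[OF S, symmetric])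
    finally show "q dvd dedekind_psi n" using p(2) dvd_trans by blast
  qed simp
  have recip: "(\<Sum>p\<in>prime_factors n. 1 / real p) \<le> e"
  proof -
    have "(\<Sum>p\<in>S. 1 / real p) \<le> 2 / t + 2 / t"
      using sumS[of "\<lambda>p. 1 / real p"] S1(5) S2(5) by simp
    also have "\<dots> = 4 / t" by simp
    also have "\<dots> \<le> 4 / L" using tL g(2) by (intro divide_left_mono) auto
    also have "\<dots> \<le> e" by (rule g(3))
    finally show ?thesis by (simp add: npf)
  qed
  have lnn: "ln (real n) \<le> real K powr (1 + e)"
  proof -
    have "ln (real n) = ln (\<Prod>p\<in>S. real p)" by (simp add: n_def)
    also have "\<dots> = (\<Sum>p\<in>S. ln (real p))"
      by (rule ln_prod) (use S in \<open>auto dest: prime_gt_0_nat\<close>)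
    also have "\<dots> \<le> (4 * t^8 + t^8 * \<bar>L\<bar>) + (4 * t^8 + t^8 * \<bar>L\<bar>)"
    proof (rule order_trans[OF sumS add_mono[OF S1(4) S2(4)]])
      fix p :: nat assume "prime p" thus "0 \<le> ln (real p)" using prime_ge_1_nat[of p] by simp
    qed
    also have "\<dots> = 8 * t^8 + 2 * (t^8 * L)" using g(2) by simp
    also have "t^8 * L \<le> (t^8) powr (1 + e / 2)"
    proof -
      have tpos: "t^8 \<ge> 1" using t8 t2 by linarith
      have "L = (L powr real (8 ^ Suc j)) powr (1 / 8 ^ Suc j)"
        using g(2) by (simp only: powr_powr) simp
      also have "L powr real (8 ^ Suc j) = t^8" unfolding x using g(2) by (intro powr_realpow) simp
      also have "(t^8) powr (1 / 8 ^ Suc j) \<le> (t^8) powr (e / 2)"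
      proof (rule powr_mono[OF _ tpos])
        have "(8::real) ^ j0 \<le> 8 ^ Suc j" using j(1) by (intro power_increasing) auto
        hence "2 / e \<le> 8 ^ Suc j" using j0 by linarith
        thus "1 / 8 ^ Suc j \<le> e / 2" using e by (simp add: field_simps)
      qed
      finally have "t^8 * L \<le> t^8 * (t^8) powr (e / 2)" using tpos by (intro mult_left_mono) auto
      thus ?thesis using tpos by (simp add: powr_add)
    qed
    hence "8 * t^8 + 2 * (t^8 * L) \<le> 8 * t^8 + 2 * (t^8) powr (1 + e / 2)" by simp
    also have "\<dots> \<le> (t^8 - 1) powr (1 + e)" by (rule g(8)) (use t8 tL in linarith)
    also have "\<dots> \<le> real K powr (1 + e)" using K e t8 t2 by (intro powr_mono2) auto
    finally show ?thesis .
  qed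
  have KX: "K \<ge> X0"
  proof -
    have "real K > real X0" using K(2) t8 tL g(1) by linarith
    thus ?thesis by simp
  qed
  have nX: "n \<ge> X0"
  proof -
    \<comment> \<open>The prime serving \<open>q = 2\<close> already exceeds \<open>t^2\<close>,
      hence \<open>X0\<close>.\<close>
    obtain p where p: "p \<in> S1" using S1(3)[of 2] t2 t8 by auto
    have "real p > t^2" using S1(2)[OF p] by blast
    moreover have "t^2 \<ge> t" using t2 by (simp add: power2_eq_square)
    moreover have "p \<le> n" using dvd_n[of p] p npos by (intro dvd_imp_le) (auto simp: S_def)
    ultimately have "real n > real X0" using tL g(1) by linarith
    thus ?thesis by simp
  qed
  show ?thesis using KX nX lnn tot psi recip by blast
qed

section \<open>From the extremal integer to the limsup\<close>

text \<open>The left side is \<open>\<phi>(n)/\<psi>(n)\<close>: factorwise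
  \<open>(1 - x)/(1 + x) \<ge> 1 - 2 x\<close> for \<open>x = 1/p\<close>, followed by Weierstrass'
  product inequality.\<close>

lemma one_minus_le_inverse_ratios:
  "1 / (phi_ratio n * psi_ratio n) \<ge> 1 - 2 * (\<Sum>p\<in>prime_factors n. 1 / real p)"
proof -
  have p2: "real p \<ge> 2" if "p \<in> prime_factors n" for p
    using that prime_ge_2_nat[of p] by (auto simp: in_prime_factors_iff)
  have "1 - 2 * (\<Sum>p\<in>prime_factors n. 1 / real p) = 1 - (\<Sum>p\<in>prime_factors n. 2 / real p)"
    by (simp add: sum_distrib_left)
  also have "\<dots> \<le> (\<Prod>p\<in>prime_factors n. 1 - 2 / real p)"
  proof (rule Weierstrass_prod_ineq)
    fix p assume "p \<in> prime_factors n"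
    from p2[OF this] show "2 / real p \<in> {0..1}" by simp
  qed
  also have "\<dots> \<le> (\<Prod>p\<in>prime_factors n. 1 / (1 / (1 - 1 / real p) * (1 + 1 / real p)))"
  proof (intro prod_mono conjI)
    fix p assume p: "p \<in> prime_factors n"
    show "0 \<le> 1 - 2 / real p" using p2[OF p] by simp
    define x where "x = 1 / real p"
    have x: "0 < x" "x \<le> 1 / 2" using p2[OF p] by (auto simp: x_def field_simps)
    have "1 - 2 * x \<le> (1 - x) / (1 + x)" using x by (simp add: field_simps)
    thus "1 - 2 / real p \<le> 1 / (1 / (1 - 1 / real p) * (1 + 1 / real p))" by (simp add: x_def)
  qed
  also have "\<dots> = 1 / (phi_ratio n * psi_ratio n)"
    unfolding phi_ratio_def psi_ratio_def by (simp add: prod_dividef prod.distrib)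
  finally show ?thesis .
qed

text \<open>The primes up to \<open>K\<close> not dividing \<open>m\<close> account for a factor of
  at most \<open>exp (c * e)\<close>; all others occur on the right, where further factors are at
  least 1. The slope is \<open>c = 1\<close> for \<open>psi_ratio\<close> and \<open>c = 2\<close>
  for \<open>phi_ratio\<close>.\<close>

lemma prod_primes_le_le_ratio:
  fixes f :: "nat \<Rightarrow> real"
  assumes m: "m > 0" and f: "\<And>q. prime q \<Longrightarrow> 1 \<le> f q \<and> f q \<le> 1 + c / real q"
    and missing: "(\<Sum>q | q \<in> primes_le K \<and> \<not> q dvd m. 1 / real q) \<le> e" and c: "c \<ge> 0"
  shows "(\<Prod>q\<in>primes_le K. f q) * exp (- c * e) \<le> (\<Prod>q\<in>prime_factors m. f q)"
proof -
  define G where "G = {q. q \<in> primes_le K \<and> q dvd m}"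
  define B where "B = {q. q \<in> primes_le K \<and> \<not> q dvd m}"
  have GB: "primes_le K = G \<union> B" "G \<inter> B = {}" "finite G" "finite B" by (auto simp: G_def B_def)
  have f0: "f q \<ge> 1" "f q \<ge> 0" if "prime q" for q using f[OF that] by auto
  have prG: "prime q" if "q \<in> G \<union> B" for q using that by (auto simp: G_def B_def primes_le_def)
  have "(\<Prod>q\<in>B. f q) \<le> (\<Prod>q\<in>B. 1 + c / real q)"
    by (intro prod_mono) (use f f0 prG in auto)
  also have "\<dots> \<le> exp (\<Sum>q\<in>B. c / real q)" using GB c by (intro prod_one_plus_le_exp) auto
  also have "(\<Sum>q\<in>B. c / real q) = c * (\<Sum>q\<in>B. 1 / real q)" by (simp add: sum_distrib_left)
  also have "exp (c * (\<Sum>q\<in>B. 1 / real q)) \<le> exp (c * e)"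
    using missing c by (simp add: B_def mult_left_mono)
  finally have B: "(\<Prod>q\<in>B. f q) \<le> exp (c * e)" .
  have Gnn: "(\<Prod>q\<in>G. f q) \<ge> 0" by (intro prod_nonneg) (use f0 prG in auto)
  have "(\<Prod>q\<in>primes_le K. f q) * exp (- c * e) = (\<Prod>q\<in>G. f q) * ((\<Prod>q\<in>B. f q) * exp (- c * e))"
    unfolding GB(1) by (subst prod.union_disjoint) (use GB in auto)
  also have "\<dots> \<le> (\<Prod>q\<in>G. f q) * (exp (c * e) * exp (- c * e))"
    by (intro mult_left_mono mult_right_mono B Gnn) auto
  also have "\<dots> = (\<Prod>q\<in>G. f q)" by (simp flip: exp_add)
  also have "\<dots> \<le> (\<Prod>q\<in>prime_factors m. f q)"
    by (rule prod_mono2) (use m f0 in \<open>auto simp: G_def primes_le_def in_prime_factors_iff\<close>)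
  finally show ?thesis .
qed

lemma I_ratio_lower:
  assumes "e > 0"
  shows "\<exists>n\<ge>X0. I_ratio n / (ln (ln (real n)))^2 \<ge> 6 / pi^2 * exp (2 * euler_mascheroni) - e"
proof -
  define c1 :: real where "c1 = 6 / pi^2 * exp euler_mascheroni"
  define c2 :: real where "c2 = exp euler_mascheroni"
  have c12: "6 / pi^2 * exp (2 * euler_mascheroni) = c1 * c2"
    unfolding c1_def c2_def mult_2 exp_add by (simp only: mult.assoc)
  \<comment> \<open>\<open>d\<close> is a common tolerance: \<open>exp (-3 d)\<close> pays for the
    missing primes, \<open>d\<close> in \<open>psi_ratio\<close> and \<open>2 d\<close> in
    \<open>phi_ratio\<close>; \<open>1 - 2 d\<close> for \<open>\<phi>(n)/\<psi>(n)\<close>;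
    \<open>(1 + d)^2\<close> for \<open>ln ln n \<le> (1 + d) ln K\<close>; and \<open>- d\<close>
    for Mertens' products at \<open>K\<close>.\<close>
  have "((\<lambda>d. exp (- 3 * d) * (1 - 2 * d) / (1 + d)^2 * (c1 * c2 - d)) \<longlongrightarrow>
      exp (- 3 * 0) * (1 - 2 * 0) / (1 + 0)^2 * (c1 * c2 - 0)) (at_right 0)"
    by (intro tendsto_intros) auto
  hence "eventually (\<lambda>d. exp (- 3 * d) * (1 - 2 * d) / (1 + d)^2 * (c1 * c2 - d) > c1 * c2 - e) (at_right 0)"
    using assms by (intro order_tendstoD) auto
  moreover have "eventually (\<lambda>d::real. d \<in> {0<..<1/2}) (at_right 0)"
    by (rule eventually_at_right_real) simp
  ultimately have "eventually (\<lambda>d. exp (- 3 * d) * (1 - 2 * d) / (1 + d)^2 * (c1 * c2 - d) > c1 * c2 - e \<and> d \<in> {0<..<1/2}) (at_right 0)"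
    by (rule eventually_conj)
  then obtain d where d: "exp (- 3 * d) * (1 - 2 * d) / (1 + d)^2 * (c1 * c2 - d) > c1 * c2 - e" "0 < d" "d < 1 / 2"
    using eventually_happens' trivial_limit_at_right_real by fastforce
  define P1 where "P1 K = (\<Prod>q\<in>primes_le K. 1 + 1 / real q)" for K
  define P2 where "P2 K = (\<Prod>q\<in>primes_le K. 1 / (1 - 1 / real q))" for K
  have "(\<lambda>K. P1 K / ln (real K) * (P2 K / ln (real K))) \<longlonglongrightarrow> c1 * c2"
    unfolding P1_def P2_def c1_def c2_def by (intro tendsto_mult mertens_third_plus mertens_third_minus)
  hence "eventually (\<lambda>K. P1 K / ln (real K) * (P2 K / ln (real K)) > c1 * c2 - d) sequentially"
    using d by (intro order_tendstoD) auto
  then obtain K0 where K0: "\<And>K. K \<ge> K0 \<Longrightarrow> P1 K / ln (real K) * (P2 K / ln (real K)) > c1 * c2 - d"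
    by (auto simp: eventually_sequentially)
  \<comment> \<open>The 20 makes \<open>ln K\<close> and \<open>ln ln n\<close> positive.\<close>
  obtain n K where nK: "K \<ge> max (max X0 K0) 20" "n \<ge> max (max X0 K0) 20" "ln (real n) \<le> real K powr (1 + d)"
     "(\<Sum>q | q \<in> primes_le K \<and> \<not> q dvd totient n. 1 / real q) \<le> d"
     "(\<Sum>q | q \<in> primes_le K \<and> \<not> q dvd dedekind_psi n. 1 / real q) \<le> d"
     "(\<Sum>p\<in>prime_factors n. 1 / real p) \<le> d"
    using exists_extremal_integer[OF d(2), of "max (max X0 K0) 20"] by blast
  have n0: "n > 0" using nK(2) by simp
  have A: "P1 K * exp (- d) \<le> psi_ratio (totient n)"
    using prod_primes_le_le_ratio[of "totient n" "\<lambda>q. 1 + 1 / real q" 1 K d] n0 nK(4)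
    by (simp add: P1_def psi_ratio_def)
  have B: "P2 K * exp (- 2 * d) \<le> phi_ratio (dedekind_psi n)"
    unfolding P2_def phi_ratio_def
  proof (rule prod_primes_le_le_ratio[OF _ _ nK(5)])
    show "dedekind_psi n > 0" using dedekind_psi_ge[of n] n0 by linarith
    fix q :: nat assume "prime q"
    hence "real q \<ge> 2" using prime_ge_2_nat by simp
    thus "1 \<le> 1 / (1 - 1 / real q) \<and> 1 / (1 - 1 / real q) \<le> 1 + 2 / real q"
      by (simp add: field_simps)
  qed simp
  have D: "1 - 2 * d \<le> 1 / (phi_ratio n * psi_ratio n)"
    using one_minus_le_inverse_ratios[of n] nK(6) by linarith
  have Ppos: "P1 K \<ge> 0" "P2 K \<ge> 0"
    unfolding P1_def P2_def by (auto intro!: prod_nonneg simp: primes_le_def dest: prime_gt_1_nat)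
  have "exp (- d) * exp (- 2 * d) = exp (- 3 * d)" by (simp flip: exp_add)
  hence "exp (- 3 * d) * (1 - 2 * d) * (P1 K * P2 K) = (P1 K * exp (- d)) * (P2 K * exp (- 2 * d)) * (1 - 2 * d)"
    by (simp add: mult_ac)
  also have "\<dots> \<le> psi_ratio (totient n) * phi_ratio (dedekind_psi n) * (1 / (phi_ratio n * psi_ratio n))"
    using A B D d Ppos phi_ratio_pos[of "dedekind_psi n"] psi_ratio_ge_1[of "totient n"]
    by (intro mult_mono mult_nonneg_nonneg) auto
  also have "\<dots> = I_ratio n" using I_ratio_eq[OF n0] by simp
  finally have I: "exp (- 3 * d) * (1 - 2 * d) * (P1 K * P2 K) \<le> I_ratio n" .
  have lnK: "ln (real K) > 0" using nK(1) by simp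
  have lnn: "ln (real n) > 1"
  proof -
    have "exp 1 < real n" using exp_le nK(2) by linarith
    hence "ln (exp 1) < ln (real n)" using n0 by (subst ln_less_cancel_iff) auto
    thus ?thesis by simp
  qed
  have ll: "ln (ln (real n)) > 0" using lnn by simp
  have "ln (ln (real n)) \<le> ln (real K powr (1 + d))" using nK(3) lnn by (intro ln_mono) auto
  hence "ln (ln (real n)) \<le> (1 + d) * ln (real K)" using nK(1) by (simp add: ln_powr)
  hence le: "(ln (ln (real n)))^2 \<le> ((1 + d) * ln (real K))^2" using ll by (intro power_mono) auto
  have "c1 * c2 - e < exp (- 3 * d) * (1 - 2 * d) / (1 + d)^2 * (c1 * c2 - d)" by (rule d(1))
  also have "\<dots> \<le> exp (- 3 * d) * (1 - 2 * d) / (1 + d)^2 * (P1 K / ln (real K) * (P2 K / ln (real K)))"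
    using K0[of K] nK(1) d by (intro mult_left_mono) auto
  also have "\<dots> = exp (- 3 * d) * (1 - 2 * d) * (P1 K * P2 K) / ((1 + d) * ln (real K))^2"
    by (simp add: power2_eq_square)
  also have "\<dots> \<le> exp (- 3 * d) * (1 - 2 * d) * (P1 K * P2 K) / (ln (ln (real n)))^2"
    using le ll lnK d Ppos by (intro divide_left_mono mult_nonneg_nonneg mult_pos_pos) auto
  also have "\<dots> \<le> I_ratio n / (ln (ln (real n)))^2" using I by (intro divide_right_mono) auto
  finally show ?thesis unfolding c12 using nK(2) by (intro exI[of _ n]) auto
qed

theorem theorem1p1:
  shows "limsup (\<lambda>n::nat. ereal (I_ratio n / (ln (ln (real n)))^2))
           = ereal (6 / pi^2 * exp (2 * euler_mascheroni))"
proof (rule antisym)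
  let ?f = "\<lambda>n::nat. ereal (I_ratio n / (ln (ln (real n)))^2)"
  let ?c = "6 / pi^2 * exp (2 * euler_mascheroni) :: real"
  show "limsup ?f \<le> ereal ?c"
  proof (rule ereal_le_epsilon2)
    fix e :: real assume "e > 0"
    from I_ratio_upper[OF this] show "limsup ?f \<le> ereal ?c + ereal e"
      by (intro Limsup_bounded) (auto elim: eventually_mono)
  qed
  show "ereal ?c \<le> limsup ?f"
  proof (rule ereal_le_epsilon2)
    fix e :: real assume e: "e > 0"
    have "ereal (?c - e) \<le> limsup ?f"
    proof (rule ccontr)
      assume "\<not> ?thesis"
      hence "eventually (\<lambda>n. ?f n < ereal (?c - e)) sequentially" by (intro Limsup_lessD) simp
      then obtain X0 where "\<And>n. n \<ge> X0 \<Longrightarrow> I_ratio n / (ln (ln (real n)))^2 < ?c - e"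
        by (auto simp: eventually_sequentially)
      thus False using I_ratio_lower[OF e, of X0] by (meson not_less)
    qed
    hence "ereal (?c - e) + ereal e \<le> limsup ?f + ereal e" by (rule add_right_mono)
    thus "ereal ?c \<le> limsup ?f + ereal e" by simp
  qed
qed

end
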